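(* Let $\mathscr F$ be an acceptable space of analytic functions $\mathbb U\to\Sigma$. For each $m\ge1$ and $z\in\mathbb U$ the operator $E_{m,2}:\mathscr F^{(m+1)}_z\to F[m,2]$, $$E_{m,2}(x_m,x_{m-1},\dots,x_0)=\begin{pmatrix} mx_m & (m-1)x_{m-1} & \cdots & 2x_2 & x_1 \\ {} x_{m-1} & x_{m-2} & \cdots & x_1 & x_0 \end{pmatrix},$$ is an embedding with complemented range, and the quotient of $F[m,2]$ by $E_{m,2}[\mathscr F^{(m+1)}_z]$ is isomorphic to $\mathscr F^{(m-1)}_z$.
   Context: $A^\infty$ is the Fréchet algebra (pointwise product) of analytic $f:\mathbb D\to\mathbb C$ whose Taylor coefficients $(c_j)$ at $0$ are rapidly decreasing, with topology given by the norms $\sup_j|c_j|(j+1)^\alpha$, $\alpha>0$. For $\mathbb U\subset\mathbb C$ open and conformally equivalent to $\mathbb D$, $A^\infty_{\mathbb U}=\{f\circ\psi:f\in A^\infty\}$ with the transported topology, $\psi:\mathbb U\to\mathbb D$ any conformal equivalence. An acceptable space on $\mathbb U$ with values in a complex Banach space $\Sigma$ is a Banach space $\mathscr F$ of analytic functions $f:\mathbb U\to\Sigma$ such that: (a) evaluations $\delta_z:\mathscr F\to\Sigma$ are continuous; (b) $\mathscr F$ is a module over $A^\infty_{\mathbb U}$ under pointwise multiplication, with jointly continuous product; (c) for each conformal $\varphi:\mathbb U\to\mathbb D$ there is $K[\varphi]$ such that for analytic $f:\mathbb U\to\Sigma$, $\varphi f\in\mathscr F$ iff $f\in\mathscr F$,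 and then $K[\varphi]^{-1}\|\varphi f\|\le\|f\|\le K[\varphi]\|\varphi f\|$. Notation: $\tau_{(n,0]}f=\left(\frac{f^{(n-1)}}{(n-1)!},\dots,f',f\right)$, $\tau_{[n,1]}f=\left(\frac{f^{(n)}}{n!},\dots,f'\right)$. Rochberg spaces of an acceptable space: $\mathscr F^{(n)}_z=\{\tau_{(n,0]}f(z):f\in\mathscr F\}$ with the quotient norm; $\mathscr F^{(0)}_z=0$. The spaces $\mathscr T$ and $F[m,n]$: for $m\ge1$ an acceptable space $\mathscr T$ of functions $\mathbb U\to\Sigma^m$ is constructed as follows. Fix a conformal map $\psi:\mathbb D\to\mathbb U$ and put $\mathscr G=\{f\circ\psi:f\in\mathscr F\}$ with $\|f\circ\psi\|_{\mathscr G}=\|f\|_{\mathscr F}$. Define inductively spaces $\mathscr G^{(j)}$ of $j$-tuples of analytic functions $\mathbb D\to\Sigma$ by $\mathscr G^{(1)}=\mathscr G$, $\mathscr G^{(j+1)}=\{(g_j,\dots,g_1,g):g\in\mathscr G,\ (g_j,\dots,g_1)-\tau_{[j,1]}g\in\mathscr G^{(j)}\}$ with norm $\|(g_j,\dots,g_1)-\tau_{[j,1]}g\|_{\mathscr G^{(j)}}+\|g\|_{\mathscr G}$. For $u=\psi(w)\in\mathbb U$ let $L(u)$ be the invertible upper triangular complex $m\times m$ matrix with $\tau_{(m,0]}(f\circ\psi)(w)=L(u)\,\tau_{(m,0]}f(u)$ for all $f$ analytic near $u$ (Faà di Bruno). Then $\mathscr T=\{u\mapsto L(u)^{-1}G(\psi^{-1}(u)):G\in\mathscr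 G^{(m)}\}$ with the norm of $G$. It is acceptable; $\tau_{(m,0]}f\in\mathscr T$ with $\|\tau_{(m,0]}f\|_{\mathscr T}=\|f\|_{\mathscr F}$ for $f\in\mathscr F$; and $\mathscr T_u=\mathscr F^{(m)}_u$ with equivalent norms for all $u\in\mathbb U$. (When $\mathbb U=\mathbb D$ and $\psi$ is the identity, $\mathscr T=\mathscr F^{(m)}$, where $\mathscr F^{(1)}=\mathscr F$ and, inductively, $\mathscr F^{(j+1)}=\{(f_j,\dots,f_1,f):f\in\mathscr F,\ (f_j,\dots,f_1)-\tau_{[j,1]}f\in\mathscr F^{(j)}\}$, the $f_i$ being analytic functions $\mathbb D\to\Sigma$, with norm $\|(f_j,\dots,f_1)-\tau_{[j,1]}f\|_{\mathscr F^{(j)}}+\|f\|_{\mathscr F}$.) For fixed $z$, $F[m,n]=\mathscr T^{(n)}_z$ is the $n$-th Rochberg space of $\mathscr T$ at $z$; its elements are written as matrices with $n$ rows and $m$ columns with entries in $\Sigma$, whose rows, from top to bottom, are $\frac{F^{(n-1)}(z)}{(n-1)!},\dots,F'(z),F(z)$ for $F=(f_{m-1},\dots,f_0)\in\mathscr T$. The operator $E_{m,n}:\mathscr F^{(m+n-1)}_z\to F[m,n]$ sends $\tau_{(m+n-1,0]}f(z)$ to $\tau_{(n,0]}(\tau_{(m,0]}f)(z)$, $f\in\mathscr F$. "Embedding" means isomorphism onto its (closed) range. *)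

theory Defs
  imports "HOL-Complex_Analysis.Complex_Analysis" "HOL-Library.Function_Algebras"
begin

section \<open>Complex vector spaces and complex Banach spaces\<close>

class complex_vector = ab_group_add +
  fixes scaleC :: "complex \<Rightarrow> 'a \<Rightarrow> 'a"  (infixr \<open>*\<^sub>C\<close> 75)
  assumes scaleC_add_right: "a *\<^sub>C (x + y) = a *\<^sub>C x + a *\<^sub>C y"
    and scaleC_add_left: "(a + b) *\<^sub>C x = a *\<^sub>C x + b *\<^sub>C x"
    and scaleC_scaleC: "a *\<^sub>C (b *\<^sub>C x) = (a * b) *\<^sub>C x"
    and scaleC_one: "1 *\<^sub>C x = x"

class complex_banach = banach + complex_vector +
  assumes scaleR_scaleC: "r *\<^sub>R x = complex_of_real r *\<^sub>C x"
    and norm_scaleC: "norm (a *\<^sub>C x) = cmod a * norm x"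

instantiation complex :: complex_banach
begin

definition scaleC_complex_def: "a *\<^sub>C (x :: complex) = a * x"

instance
  by standard (auto simp: scaleC_complex_def algebra_simps norm_mult scaleR_conv_of_real)

end

instantiation "fun" :: (type, complex_vector) complex_vector
begin

definition scaleC_fun_def: "a *\<^sub>C f = (\<lambda>x. a *\<^sub>C f x)"

instance
  by standard (auto simp: scaleC_fun_def plus_fun_def fun_eq_iff
      scaleC_add_right scaleC_add_left scaleC_scaleC scaleC_one)

end

section \<open>Normed spaces on explicit carriers\<close>

text \<open>The operations are part of the record so that quotients, whose elements are cosets,
  are covered as well. Nothing is required of the fields outside the carrier.\<close>

record 'v nspace =
  carr :: "'v set"
  vadd :: "'v \<Rightarrow> 'v \<Rightarrow> 'v"
  vscale :: "complex \<Rightarrow> 'v \<Rightarrow> 'v"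
  vnorm :: "'v \<Rightarrow> real"

definition ndist :: "'v nspace \<Rightarrow> 'v \<Rightarrow> 'v \<Rightarrow> real" where
  "ndist X x y =
     (if x \<in> carr X \<and> y \<in> carr X then vnorm X (vadd X x (vscale X (- 1) y)) else 0)"

definition ntopology :: "'v nspace \<Rightarrow> 'v topology" where
  "ntopology X = Metric_space.mtopology (carr X) (ndist X)"

text \<open>A Banach space whose underlying vector space is a subspace of the ambient type.\<close>

definition banach_space_in :: "('v :: complex_vector) nspace \<Rightarrow> bool" where
  "banach_space_in X \<longleftrightarrow>
     vadd X = (+) \<and> vscale X = (*\<^sub>C) \<and>
     0 \<in> carr X \<and>
     (\<forall>x\<in>carr X. \<forall>y\<in>carr X. x + y \<in> carr X) \<and>
     (\<forall>a. \<forall>x\<in>carr X. a *\<^sub>C x \<in> carr X) \<and>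
     (\<forall>x\<in>carr X. 0 \<le> vnorm X x) \<and>
     (\<forall>x\<in>carr X. vnorm X x = 0 \<longleftrightarrow> x = 0) \<and>
     (\<forall>a. \<forall>x\<in>carr X. vnorm X (a *\<^sub>C x) = cmod a * vnorm X x) \<and>
     (\<forall>x\<in>carr X. \<forall>y\<in>carr X. vnorm X (x + y) \<le> vnorm X x + vnorm X y) \<and>
     Metric_space.mcomplete (carr X) (ndist X)"

definition bounded_operator :: "'v nspace \<Rightarrow> 'w nspace \<Rightarrow> ('v \<Rightarrow> 'w) \<Rightarrow> bool" where
  "bounded_operator X Y T \<longleftrightarrow>
     T ` carr X \<subseteq> carr Y \<and>
     (\<forall>x\<in>carr X. \<forall>y\<in>carr X. T (vadd X x y) = vadd Y (T x) (T y)) \<and>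
     (\<forall>a. \<forall>x\<in>carr X. T (vscale X a x) = vscale Y a (T x)) \<and>
     (\<exists>C. \<forall>x\<in>carr X. vnorm Y (T x) \<le> C * vnorm X x)"

definition isomorphism :: "'v nspace \<Rightarrow> 'w nspace \<Rightarrow> ('v \<Rightarrow> 'w) \<Rightarrow> bool" where
  "isomorphism X Y T \<longleftrightarrow>
     bounded_operator X Y T \<and> bij_betw T (carr X) (carr Y) \<and>
     (\<exists>C. \<forall>x\<in>carr X. vnorm X x \<le> C * vnorm Y (T x))"

definition embedding :: "'v nspace \<Rightarrow> 'w nspace \<Rightarrow> ('v \<Rightarrow> 'w) \<Rightarrow> bool" where
  "embedding X Y T \<longleftrightarrow>
     T ` carr X \<subseteq> carr Y \<and>
     isomorphism X (Y\<lparr>carr := T ` carr X\<rparr>) T \<and>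
     closedin (ntopology Y) (T ` carr X)"

definition complemented :: "'v nspace \<Rightarrow> 'v set \<Rightarrow> bool" where
  "complemented X W \<longleftrightarrow>
     (\<exists>P. bounded_operator X X P \<and> P ` carr X = W \<and> (\<forall>w\<in>W. P w = w))"

definition coset :: "'v nspace \<Rightarrow> 'v set \<Rightarrow> 'v \<Rightarrow> 'v set" where
  "coset X W x = vadd X x ` W"

text \<open>The operations below agree with those on representatives; adding \<open>W\<close> again in the
  scalar multiplication takes care of the scalar \<open>0\<close>.\<close>

definition quotient_space :: "'v nspace \<Rightarrow> 'v set \<Rightarrow> 'v set nspace" where
  "quotient_space X W =
     \<lparr> carr = coset X W ` carr X,
       vadd = (\<lambda>A B. {vadd X a b | a b. a \<in> A \<and> b \<in> B}),
       vscale = (\<lambda>c A. {vadd X (vscale X c a) w | a w. a \<in> A \<and> w \<in> W}),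
       vnorm = (\<lambda>A. Inf (vnorm X ` A)) \<rparr>"

text \<open>The range of a linear map \<open>t\<close> defined on \<open>X\<close>, with the quotient norm.\<close>

definition range_space :: "'v nspace \<Rightarrow> ('v \<Rightarrow> 'w :: complex_vector) \<Rightarrow> 'w nspace" where
  "range_space X t =
     \<lparr> carr = t ` carr X, vadd = (+), vscale = (*\<^sub>C),
       vnorm = (\<lambda>y. Inf {vnorm X f | f. f \<in> carr X \<and> t f = y}) \<rparr>"

section \<open>Vector-valued analytic functions\<close>

text \<open>A function on \<open>S\<close> is represented by a total function that vanishes off \<open>S\<close>.\<close>

definition zero_off :: "complex set \<Rightarrow> (complex \<Rightarrow> 'a :: zero) \<Rightarrow> complex \<Rightarrow> 'a" where
  "zero_off S f = (\<lambda>z. if z \<in> S then f z else 0)"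

definition analytic_functions :: "complex set \<Rightarrow> (complex \<Rightarrow> 'a :: complex_banach) set" where
  "analytic_functions S =
     {f. (\<forall>z\<in>S. \<exists>D. (f has_derivative (\<lambda>h. h *\<^sub>C D)) (at z)) \<and> (\<forall>z. z \<notin> S \<longrightarrow> f z = 0)}"

definition cderiv :: "(complex \<Rightarrow> 'a :: complex_banach) \<Rightarrow> complex \<Rightarrow> 'a" where
  "cderiv f z = (SOME D. (f has_derivative (\<lambda>h. h *\<^sub>C D)) (at z))"

definition taylor :: "nat \<Rightarrow> (complex \<Rightarrow> 'a :: complex_banach) \<Rightarrow> complex \<Rightarrow> 'a" where
  "taylor i f z = (1 / fact i) *\<^sub>C (cderiv ^^ i) f z"

text \<open>The same for scalar functions, in terms of the library's derivative.\<close>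

definition ctaylor :: "nat \<Rightarrow> (complex \<Rightarrow> complex) \<Rightarrow> complex \<Rightarrow> complex" where
  "ctaylor i f z = (deriv ^^ i) f z / fact i"

definition conformal_equivalence :: "(complex \<Rightarrow> complex) \<Rightarrow> complex set \<Rightarrow> complex set \<Rightarrow> bool" where
  "conformal_equivalence \<phi> S T \<longleftrightarrow> \<phi> holomorphic_on S \<and> bij_betw \<phi> S T"

abbreviation unit_disc :: "complex set" where
  "unit_disc \<equiv> ball 0 1"

section \<open>The algebras of functions with rapidly decreasing coefficients\<close>

definition Ainf :: "(complex \<Rightarrow> complex) set" where
  "Ainf = {h. h holomorphic_on unit_disc \<and> (\<forall>z. z \<notin> unit_disc \<longrightarrow> h z = 0) \<and>
     (\<forall>\<alpha>>0. bdd_above (range (\<lambda>j. cmod (ctaylor j h 0) * (real j + 1) powr \<alpha>)))}"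

definition Ainf_norm :: "real \<Rightarrow> (complex \<Rightarrow> complex) \<Rightarrow> real" where
  "Ainf_norm \<alpha> h = (SUP j. cmod (ctaylor j h 0) * (real j + 1) powr \<alpha>)"

definition Ainf_topology :: "(complex \<Rightarrow> complex) topology" where
  "Ainf_topology = topology_generated_by
     {{g \<in> Ainf. Ainf_norm \<alpha> (\<lambda>z. g z - f z) < \<epsilon>} | f \<alpha> \<epsilon>. f \<in> Ainf \<and> \<alpha> > 0 \<and> \<epsilon> > 0}"

definition Ainf_on :: "complex set \<Rightarrow> (complex \<Rightarrow> complex) \<Rightarrow> (complex \<Rightarrow> complex) set" where
  "Ainf_on U \<psi> = {zero_off U (h \<circ> \<psi>) | h. h \<in> Ainf}"

text \<open>Pulling back along the bijection \<open>h \<circ> \<psi> \<mapsto> h\<close> transports the topology.\<close>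

definition Ainf_on_topology ::
    "complex set \<Rightarrow> (complex \<Rightarrow> complex) \<Rightarrow> (complex \<Rightarrow> complex) topology" where
  "Ainf_on_topology U \<psi> = pullback_topology (Ainf_on U \<psi>)
     (\<lambda>k. zero_off unit_disc (k \<circ> inv_into U \<psi>)) Ainf_topology"

section \<open>Acceptable spaces\<close>

text \<open>The algebra \<open>Ainf_on U \<psi>\<close> and its topology do not depend on the conformal
  equivalence \<open>\<psi>\<close>, so that condition (b) is imposed for some \<open>\<psi>\<close> only.\<close>

definition acceptable_space ::
    "complex set \<Rightarrow> (complex \<Rightarrow> 'a :: complex_banach) nspace \<Rightarrow> bool" where
  "acceptable_space U F \<longleftrightarrow>
     open U \<and> banach_space_in F \<and> carr F \<subseteq> analytic_functions U \<and>
     \<comment> \<open>(a)\<close>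
     (\<forall>z\<in>U. continuous_map (ntopology F) euclidean (\<lambda>f. f z)) \<and>
     \<comment> \<open>(b)\<close>
     (\<exists>\<psi>. conformal_equivalence \<psi> U unit_disc \<and>
        (\<forall>h\<in>Ainf_on U \<psi>. \<forall>f\<in>carr F. (\<lambda>z. h z *\<^sub>C f z) \<in> carr F) \<and>
        continuous_map (prod_topology (Ainf_on_topology U \<psi>) (ntopology F)) (ntopology F)
          (\<lambda>(h, f). \<lambda>z. h z *\<^sub>C f z)) \<and>
     \<comment> \<open>(c)\<close>
     (\<forall>\<phi>. conformal_equivalence \<phi> U unit_disc \<longrightarrow>
        (\<exists>K>0. \<forall>f\<in>analytic_functions U.
           ((\<lambda>z. \<phi> z *\<^sub>C f z) \<in> carr F \<longleftrightarrow> f \<in> carr F) \<and>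
           (f \<in> carr F \<longrightarrow>
              inverse K * vnorm F (\<lambda>z. \<phi> z *\<^sub>C f z) \<le> vnorm F f \<and>
              vnorm F f \<le> K * vnorm F (\<lambda>z. \<phi> z *\<^sub>C f z))))"

section \<open>Rochberg spaces\<close>

text \<open>A tuple \<open>(x\<^sub>n\<^sub>-\<^sub>1, \<dots>, x\<^sub>0)\<close> is represented by the function \<open>i \<mapsto> x\<^sub>i\<close>, which is
  \<open>0\<close> for \<open>i \<ge> n\<close>; so \<open>tau n f z\<close> is the tuple written \<open>\<tau>\<^bsub>(n,0]\<^esub> f(z)\<close>.\<close>

definition tau :: "nat \<Rightarrow> (complex \<Rightarrow> 'a :: complex_banach) \<Rightarrow> complex \<Rightarrow> nat \<Rightarrow> 'a" where
  "tau n f z = (\<lambda>i. if i < n then taylor i f z else 0)"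

definition Rochberg ::
    "(complex \<Rightarrow> 'a :: complex_banach) nspace \<Rightarrow> nat \<Rightarrow> complex \<Rightarrow> (nat \<Rightarrow> 'a) nspace" where
  "Rochberg F n z = range_space F (\<lambda>f. tau n f z)"

text \<open>A function with values in the \<open>m\<close>-th power of \<open>'a\<close> is represented by the tuple of its
  components, of type \<open>nat \<Rightarrow> complex \<Rightarrow> 'a\<close>. Its Taylor coefficients at \<open>z\<close> form a matrix \<open>M\<close>
  in which \<open>M r c\<close> is the \<open>r\<close>-th coefficient of the component with subscript \<open>c\<close>: in the
  displayed matrices rows and columns are numbered from the bottom and from the right,
  starting with \<open>0\<close>.\<close>

definition tau_tuple ::
    "nat \<Rightarrow> (nat \<Rightarrow> complex \<Rightarrow> 'a :: complex_banach) \<Rightarrow> complex \<Rightarrow> nat \<Rightarrow> nat \<Rightarrow> 'a" where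
  "tau_tuple n T z = (\<lambda>r c. tau n (T c) z r)"

section \<open>The spaces of tuples of functions\<close>

text \<open>The space of all \<open>f \<circ> \<psi>\<close>, for \<open>\<psi>\<close> from the disc onto \<open>U\<close>.\<close>

definition disc_space :: "complex set \<Rightarrow> (complex \<Rightarrow> complex) \<Rightarrow>
    (complex \<Rightarrow> 'a :: complex_banach) nspace \<Rightarrow> (complex \<Rightarrow> 'a) nspace" where
  "disc_space U \<psi> F =
     \<lparr> carr = {zero_off unit_disc (f \<circ> \<psi>) | f. f \<in> carr F},
       vadd = (+), vscale = (*\<^sub>C),
       vnorm = (\<lambda>g. vnorm F (zero_off U (g \<circ> inv_into unit_disc \<psi>))) \<rparr>"

text \<open>For \<open>t = (g\<^sub>j, \<dots>, g\<^sub>1, g)\<close>, the \<open>j\<close>-tuple \<open>(g\<^sub>j, \<dots>, g\<^sub>1) - \<tau>\<^bsub>[j,1]\<^esub> g\<close>.\<close>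

definition tail_defect ::
    "nat \<Rightarrow> (nat \<Rightarrow> complex \<Rightarrow> 'a :: complex_banach) \<Rightarrow> nat \<Rightarrow> complex \<Rightarrow> 'a" where
  "tail_defect j t =
     (\<lambda>i. t (Suc i) - (if i < j then zero_off unit_disc (taylor (Suc i) (t 0)) else 0))"

text \<open>The recursion starts with the zero space of empty tuples, so that the spaces of
  \<open>1\<close>-tuples and \<open>G\<close> coincide.\<close>

primrec tower :: "(complex \<Rightarrow> 'a :: complex_banach) nspace \<Rightarrow> nat \<Rightarrow>
    (nat \<Rightarrow> complex \<Rightarrow> 'a) nspace" where
  "tower G 0 = \<lparr> carr = {0}, vadd = (+), vscale = (*\<^sub>C), vnorm = (\<lambda>t. 0) \<rparr>"
| "tower G (Suc j) =
     \<lparr> carr = {t. t 0 \<in> carr G \<and> tail_defect j t \<in> carr (tower G j)},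
       vadd = (+), vscale = (*\<^sub>C),
       vnorm = (\<lambda>t. vnorm (tower G j) (tail_defect j t) + vnorm G (t 0)) \<rparr>"

text \<open>The matrix \<open>L(\<psi>(w))\<close>. With subscripts increasing from right to left and from bottom to
  top, upper triangular means \<open>L i k = 0\<close> for \<open>k > i\<close>, and such a matrix is invertible
  iff it has no zero on the diagonal. Scalar functions \<open>f\<close> determine \<open>L\<close>, also when \<open>'a\<close>
  is the zero space.\<close>

definition chain_matrix :: "nat \<Rightarrow> (complex \<Rightarrow> complex) \<Rightarrow> complex \<Rightarrow> nat \<Rightarrow> nat \<Rightarrow> complex" where
  "chain_matrix m \<psi> w = (THE L.
     (\<forall>i k. L i k \<noteq> 0 \<longrightarrow> k \<le> i \<and> i < m) \<and> (\<forall>i<m. L i i \<noteq> 0) \<and>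
     (\<forall>f V. open V \<and> \<psi> w \<in> V \<and> f holomorphic_on V \<longrightarrow>
        (\<forall>i<m. ctaylor i (f \<circ> \<psi>) w = (\<Sum>k<m. L i k * ctaylor k f (\<psi> w)))))"

text \<open>The tuple \<open>w \<mapsto> L(\<psi>(w)) T(\<psi>(w))\<close> on the disc.\<close>

definition to_disc :: "nat \<Rightarrow> (complex \<Rightarrow> complex) \<Rightarrow>
    (nat \<Rightarrow> complex \<Rightarrow> 'a :: complex_banach) \<Rightarrow> nat \<Rightarrow> complex \<Rightarrow> 'a" where
  "to_disc m \<psi> T = (\<lambda>i. zero_off unit_disc
     (\<lambda>w. \<Sum>k<m. chain_matrix m \<psi> w i k *\<^sub>C T k (\<psi> w)))"

text \<open>Since the matrices \<open>L(u)\<close> are invertible, \<open>T = L\<^bsup>-1\<^esup> (G \<circ> \<psi>\<^bsup>-1\<^esup>)\<close> on \<open>U\<close> amounts to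
  \<open>G = to_disc m \<psi> T\<close>.\<close>

definition T_space :: "complex set \<Rightarrow> (complex \<Rightarrow> complex) \<Rightarrow>
    (complex \<Rightarrow> 'a :: complex_banach) nspace \<Rightarrow> nat \<Rightarrow> (nat \<Rightarrow> complex \<Rightarrow> 'a) nspace" where
  "T_space U \<psi> F m =
     \<lparr> carr = {T. (\<forall>i\<ge>m. T i = 0) \<and> (\<forall>i. \<forall>u. u \<notin> U \<longrightarrow> T i u = 0) \<and>
                to_disc m \<psi> T \<in> carr (tower (disc_space U \<psi> F) m)},
       vadd = (+), vscale = (*\<^sub>C),
       vnorm = (\<lambda>T. vnorm (tower (disc_space U \<psi> F) m) (to_disc m \<psi> T)) \<rparr>"

definition F_bracket :: "complex set \<Rightarrow> (complex \<Rightarrow> complex) \<Rightarrow>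
    (complex \<Rightarrow> 'a :: complex_banach) nspace \<Rightarrow> nat \<Rightarrow> nat \<Rightarrow> complex \<Rightarrow>
    (nat \<Rightarrow> nat \<Rightarrow> 'a) nspace" where
  "F_bracket U \<psi> F m n z = range_space (T_space U \<psi> F m) (\<lambda>T. tau_tuple n T z)"

definition E_op :: "(complex \<Rightarrow> 'a :: complex_banach) nspace \<Rightarrow> nat \<Rightarrow> nat \<Rightarrow> complex \<Rightarrow>
    (nat \<Rightarrow> 'a) \<Rightarrow> nat \<Rightarrow> nat \<Rightarrow> 'a" where
  "E_op F m n z x = (THE M. \<exists>f\<in>carr F. tau (m + n - 1) f z = x \<and>
     M = tau_tuple n (\<lambda>c w. tau m f w c) z)"

end

theory Submission
  imports Defs
begin

text \<open>
  Put \<open>\<theta> = \<psi>\<^sup>-\<^sup>1\<close>. Unwinding the recursion, the elements of \<open>\<T>\<close> are the tuples whose value at \<open>u\<close> is the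
  \<open>m\<close>-jet at \<open>u\<close> of \<open>v \<mapsto> \<Sum>\<^sub>j (\<theta> v - \<theta> u)\<^sup>j f\<^sub>j v\<close> with \<open>f\<^sub>0, \<dots>, f\<^bsub>m-1\<^esub> \<in> \<F>\<close>. Differentiating in \<open>u\<close> at \<open>z\<close>, the matrices
  in \<open>F[m,2]\<close> are those with lower row \<open>h\<^bsup>[c]\<^esup>\<close> and upper row \<open>(c + 1) h\<^bsup>[c+1]\<^esup> + k\<^bsup>[c]\<^esup>\<close> (Taylor coefficients at
  \<open>z\<close>, \<open>c < m\<close>), where \<open>h = \<Sum>\<^sub>j (\<theta> - \<theta> z)\<^sup>j f\<^sub>j\<close> and \<open>k = - \<theta>'(z) \<Sum>\<^sub>j j (\<theta> - \<theta> z)\<^bsup>j-1\<^esup> f\<^sub>j\<close> are in \<open>\<F>\<close>. The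
  range of \<open>E\<close> belongs to \<open>k = 0\<close>, and the failure of the relation \<open>y\<^sub>c = (c + 1) x\<^bsub>c+1\<^esub>\<close> for \<open>c < m - 1\<close> is
  the \<open>(m - 1)\<close>-jet of \<open>k\<close>. With \<open>\<eta> = - (\<theta> - \<theta> z) / (m \<theta>'(z))\<close> the matrix of \<open>(\<eta> k, k)\<close> depends on
  that jet only; this gives a bounded section, and \<open>(h, k) \<mapsto> h - \<eta> k\<close> gives a bounded left inverse of \<open>E\<close>.

  Banach-valued analytic functions are reduced to scalar ones by norming functionals; these come
  from minimal sublinear functionals, which are linear.
\<close>

text \<open>Boundedness is never estimated on matrices. Besides \<open>E\<close>, the operators are
  entrywise formulas, hence linear and free of choices. Each operator is bounded because it lifts to
  functions in F, or tuples of them, formed by multiplication with polynomials in \<theta>, which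
  condition (c), applied to \<theta>, controls. The obstacle is definiteness. Condition (a) bounds
  values at points, not derivatives, so a quotient norm on jets is at first only a seminorm, while
  closedness of the range refers to a metric. Condition (c) for a conformal map vanishing at
  \<open>z\<close> permits division with control of norms, and division brings a nonzero jet down to
  a nonzero value. This settles the Rochberg spaces; for F[m,2] definiteness then follows from the
  splitting. What makes the splitting delicate is the coefficient of order m - 1 of k: it enters the
  upper left corner, added to m times the coefficient of order m of h, and no other entry separates
  the two. Subtracting the matrix of (\<eta> k, k) works because this coefficient cancels in
  it.\<close>

section \<open>Norming functionals\<close>

text \<open>Scaling is demanded as an inequality only, which is easy to verify for infima; applying
  it to the inverse factor gives equality.\<close>

definition sublinear :: "('a :: real_vector \<Rightarrow> real) \<Rightarrow> bool" where
  "sublinear q \<longleftrightarrow> q 0 = 0 \<and> (\<forall>x y. q (x + y) \<le> q x + q y) \<and> (\<forall>t>0. \<forall>x. q (t *\<^sub>R x) \<le> t * q x)"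

lemma sublinear_scale:
  assumes "sublinear q" "t \<ge> 0"
  shows "q (t *\<^sub>R x) = t * q x"
proof (cases "t = 0")
  case True
  then show ?thesis using assms by (simp add: sublinear_def)
next
  case False
  then have t: "t > 0" using assms by simp
  have "q (inverse t *\<^sub>R (t *\<^sub>R x)) \<le> inverse t * q (t *\<^sub>R x)"
    using assms t unfolding sublinear_def by (metis positive_imp_inverse_positive)
  then have "t * q x \<le> q (t *\<^sub>R x)"
    using t by (simp add: field_simps)
  moreover have "q (t *\<^sub>R x) \<le> t * q x" using assms t by (simp add: sublinear_def)
  ultimately show ?thesis by simp
qed

lemma sublinear_lower:
  assumes "sublinear q"
  shows "- q (- x) \<le> q x"
proof -
  have "q (x + - x) \<le> q x + q (- x)" using assms unfolding sublinear_def by blast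
  then show ?thesis using assms by (simp add: sublinear_def)
qed

text \<open>The classical way to push a sublinear functional down: the result lies below
  \<open>q\<close> (take t = 0) and is at most - q y at - y (take t = 1).\<close>

definition sublinear_reduce :: "('a :: real_vector \<Rightarrow> real) \<Rightarrow> 'a \<Rightarrow> 'a \<Rightarrow> real" where
  "sublinear_reduce q y x = (INF t\<in>{0..}. q (x + t *\<^sub>R y) - t * q y)"

lemma sublinear_reduce:
  assumes q: "sublinear q"
  shows sublinear_reduce_le: "t \<ge> 0 \<Longrightarrow> sublinear_reduce q y x \<le> q (x + t *\<^sub>R y) - t * q y"
    and sublinear_sublinear_reduce: "sublinear (sublinear_reduce q y)"
proof -
  let ?g = "\<lambda>x t. q (x + t *\<^sub>R y) - t * q y"
  have add: "q (x + y) \<le> q x + q y" for x y using q by (simp add: sublinear_def)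
  have lower: "- q (- x) \<le> ?g x t" if "t \<ge> 0" for x t
    using add[of "- x" "x + t *\<^sub>R y"] sublinear_scale[OF q that, of y] by simp
  have bdd: "bdd_below (?g x ` {0..})" for x
    using lower by (intro bdd_belowI2[where m="- q (- x)"]) auto
  have le: "sublinear_reduce q y x \<le> ?g x t" if "t \<ge> 0" for t x
    unfolding sublinear_reduce_def using bdd that by (intro cINF_lower) auto
  show "t \<ge> 0 \<Longrightarrow> sublinear_reduce q y x \<le> ?g x t" by (rule le)
  have ge: "c \<le> sublinear_reduce q y x" if "\<And>t. t \<ge> 0 \<Longrightarrow> c \<le> ?g x t" for c x
    unfolding sublinear_reduce_def using that by (intro cINF_greatest) auto
  have "sublinear_reduce q y 0 = 0"
  proof (rule antisym)
    show "sublinear_reduce q y 0 \<le> 0" using le[of 0 0] q by (simp add: sublinear_def)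
    show "0 \<le> sublinear_reduce q y 0" by (rule ge) (simp add: sublinear_scale[OF q])
  qed
  moreover have "sublinear_reduce q y (u + v) \<le> sublinear_reduce q y u + sublinear_reduce q y v" for u v
  proof -
    have st: "sublinear_reduce q y (u + v) \<le> ?g u s + ?g v t" if "s \<ge> 0" "t \<ge> 0" for s t
    proof -
      have "u + v + (s + t) *\<^sub>R y = (u + s *\<^sub>R y) + (v + t *\<^sub>R y)" by (simp add: algebra_simps)
      then have "q (u + v + (s + t) *\<^sub>R y) \<le> q (u + s *\<^sub>R y) + q (v + t *\<^sub>R y)"
        using add by metis
      then show ?thesis using le[of "s + t" "u + v"] that by (simp add: algebra_simps)
    qed
    have "sublinear_reduce q y (u + v) - ?g u s \<le> sublinear_reduce q y v" if "s \<ge> 0" for s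
    proof (rule ge)
      show "sublinear_reduce q y (u + v) - ?g u s \<le> ?g v t" if "t \<ge> 0" for t
        using st[OF \<open>s \<ge> 0\<close> that] by simp
    qed
    then have "sublinear_reduce q y (u + v) - sublinear_reduce q y v \<le> sublinear_reduce q y u"
      by (intro ge) (simp add: algebra_simps)
    then show ?thesis by simp
  qed
  moreover have "sublinear_reduce q y (c *\<^sub>R u) \<le> c * sublinear_reduce q y u" if c: "c > 0" for c u
  proof -
    have "sublinear_reduce q y (c *\<^sub>R u) / c \<le> sublinear_reduce q y u"
    proof (rule ge)
      fix t :: real assume t: "t \<ge> 0"
      have "c *\<^sub>R u + (c * t) *\<^sub>R y = c *\<^sub>R (u + t *\<^sub>R y)" by (simp add: algebra_simps)
      then have "q (c *\<^sub>R u + (c * t) *\<^sub>R y) = c * q (u + t *\<^sub>R y)"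
        using sublinear_scale[OF q] c by (metis less_eq_real_def)
      then show "sublinear_reduce q y (c *\<^sub>R u) / c \<le> ?g u t"
        using le[of "c * t" "c *\<^sub>R u"] c t by (simp add: field_simps)
    qed
    then show ?thesis using c by (simp add: field_simps)
  qed
  ultimately show "sublinear (sublinear_reduce q y)" by (simp add: sublinear_def)
qed

text \<open>Zorn's lemma for the reversed pointwise order. The infimum of a chain is finite because
  every sublinear q below \<open>p\<close> satisfies q x >= - p (- x).\<close>

lemma minimal_sublinear:
  fixes p :: "'a :: real_vector \<Rightarrow> real"
  assumes p: "sublinear p"
  obtains q where "sublinear q" "\<And>x. q x \<le> p x"
    "\<And>r. sublinear r \<Longrightarrow> (\<And>x. r x \<le> q x) \<Longrightarrow> r = q"
proof -
  define A where "A = {q :: 'a \<Rightarrow> real. sublinear q \<and> q \<le> p}"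
  let ?P = "\<lambda>a b :: 'a \<Rightarrow> real. b \<le> a"
  have "\<exists>q\<in>A. \<forall>r\<in>A. ?P q r \<longrightarrow> r = q"
  proof (rule predicate_Zorn)
    show "partial_order_on A (relation_of ?P A)"
      by (rule partial_order_on_relation_ofI) auto
  next
    fix C assume C: "C \<in> Chains (relation_of ?P A)"
    then have CA: "C \<subseteq> A" by (rule Chains_relation_of)
    have tot: "a \<le> b \<or> b \<le> a" if "a \<in> C" "b \<in> C" for a b
      using C that by (auto simp: Chains_def relation_of_def)
    show "\<exists>u\<in>A. \<forall>a\<in>C. u \<le> a"
    proof (cases "C = {}")
      case True
      then show ?thesis using p by (auto simp: A_def)
    next
      case False
      define u where "u x = (INF q\<in>C. q x)" for x
      have sub: "sublinear q" and leq: "q x \<le> p x" if "q \<in> C" for q x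
        using CA that by (auto simp: A_def le_fun_def)
      have lower: "- p (- x) \<le> q x" if "q \<in> C" for q x
        using sublinear_lower[OF sub[OF that], of x] leq[OF that, of "- x"] by linarith
      have le: "u x \<le> q x" if "q \<in> C" for q x
        unfolding u_def using that lower by (intro cINF_lower bdd_belowI2[where m="- p (- x)"]) auto
      have ge: "c \<le> u x" if "\<And>q. q \<in> C \<Longrightarrow> c \<le> q x" for c x
        unfolding u_def using False that by (intro cINF_greatest) auto
      have "u 0 = 0"
      proof (rule antisym)
        obtain q where "q \<in> C" using False by blast
        then show "u 0 \<le> 0" using le[of q 0] sub[of q] by (simp add: sublinear_def)
        have "q 0 = 0" if "q \<in> C" for q using sub[OF that] by (simp add: sublinear_def)
        then show "0 \<le> u 0" by (intro ge) (metis order.refl)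
      qed
      moreover have "u (x + y) \<le> u x + u y" for x y
      proof -
        have st: "u (x + y) \<le> a x + b y" if ab: "a \<in> C" "b \<in> C" for a b
        proof -
          \<comment> \<open>Here the chain property enters: the smaller of \<open>a\<close> and
            \<open>b\<close> serves for both summands.\<close>
          obtain c where c: "c \<in> C" "c \<le> a" "c \<le> b" using tot[OF ab] ab by blast
          have "c (x + y) \<le> c x + c y" using sub[OF c(1)] by (simp add: sublinear_def)
          then show ?thesis using le[OF c(1), of "x + y"] c(2,3)
            by (smt (verit) le_funD)
        qed
        have "u (x + y) - a x \<le> u y" if "a \<in> C" for a
          using st[OF that] by (intro ge) (simp add: algebra_simps)
        then have "u (x + y) - u y \<le> u x"
          by (intro ge) (simp add: algebra_simps)
        then show ?thesis by simp
      qed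
      moreover have "u (c *\<^sub>R x) \<le> c * u x" if c: "c > 0" for c x
      proof -
        have "u (c *\<^sub>R x) / c \<le> u x"
        proof (rule ge)
          fix q assume q: "q \<in> C"
          show "u (c *\<^sub>R x) / c \<le> q x"
            using le[OF q, of "c *\<^sub>R x"] sublinear_scale[OF sub[OF q], of c x] c
            by (simp add: field_simps)
        qed
        then show ?thesis using c by (simp add: field_simps)
      qed
      ultimately have "sublinear u" by (simp add: sublinear_def)
      moreover have "u \<le> p"
      proof -
        obtain q where "q \<in> C" using False by blast
        then show ?thesis using le[of q] leq[of q] by (auto simp: le_fun_def intro: order_trans)
      qed
      ultimately show ?thesis using le by (auto simp: A_def le_fun_def intro!: bexI[of _ u])
    qed
  qed
  then obtain q where q: "q \<in> A" "\<And>r. r \<in> A \<Longrightarrow> r \<le> q \<Longrightarrow> r = q" by blast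
  show thesis
  proof (rule that)
    show "sublinear q" "\<And>x. q x \<le> p x" using q(1) by (auto simp: A_def le_fun_def)
    show "r = q" if "sublinear r" "\<And>x. r x \<le> q x" for r
    proof (rule q(2))
      show "r \<le> q" using that by (simp add: le_fun_def)
      then show "r \<in> A" using that q(1) by (auto simp: A_def)
    qed
  qed
qed

text \<open>Minimality forces \<open>sublinear_reduce q y = q\<close>, and the defining bound at t =
  1 then reads as superadditivity.\<close>

lemma minimal_sublinear_linear:
  assumes q: "sublinear q"
    and min: "\<And>r. sublinear r \<Longrightarrow> (\<And>x. r x \<le> q x) \<Longrightarrow> r = q"
  shows "linear q"
proof -
  have "q x + q y \<le> q (x + y)" for x y
  proof -
    have "sublinear_reduce q y = q"
      using sublinear_sublinear_reduce[OF q] sublinear_reduce_le[OF q, of 0] by (intro min) auto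
    then show ?thesis using sublinear_reduce_le[OF q, of 1 y x] by simp
  qed
  moreover have "q (x + y) \<le> q x + q y" for x y using q by (simp add: sublinear_def)
  ultimately have add: "q (x + y) = q x + q y" for x y by (meson antisym)
  have neg: "q (- x) = - q x" for x
    using add[of x "- x"] q by (simp add: sublinear_def)
  have "q (t *\<^sub>R x) = t *\<^sub>R q x" for t x
  proof (cases "t \<ge> 0")
    case True
    then show ?thesis using sublinear_scale[OF q] by simp
  next
    case False
    then show ?thesis using sublinear_scale[OF q, of "- t" x] neg[of "t *\<^sub>R x"] by simp
  qed
  with add show ?thesis by (intro linearI) auto
qed

text \<open>Hahn-Banach for one vector. A minimal functional is taken below the reduction of the
  norm at \<open>x0\<close> instead of below the norm itself; this yields l (- x0) <= - norm x0 and
  hence equality at \<open>x0\<close>.\<close>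

lemma real_norming_functional:
  fixes x0 :: "'a :: real_normed_vector"
  obtains l where "linear l" "\<And>x. l x \<le> norm x" "l x0 = norm x0"
proof -
  have n: "sublinear (norm :: 'a \<Rightarrow> real)"
    by (auto simp: sublinear_def norm_triangle_ineq)
  obtain q where q: "sublinear q" "\<And>x. q x \<le> sublinear_reduce norm x0 x"
    "\<And>r. sublinear r \<Longrightarrow> (\<And>x. r x \<le> q x) \<Longrightarrow> r = q"
    using minimal_sublinear[OF sublinear_sublinear_reduce[OF n, of x0]] by metis
  have lin: "linear q" by (rule minimal_sublinear_linear[OF q(1,3)])
  have le: "q x \<le> norm x" for x
    using q(2)[of x] sublinear_reduce_le[OF n, of 0 x0 x] by simp
  have "q (- x0) \<le> - norm x0"
    using q(2)[of "- x0"] sublinear_reduce_le[OF n, of 1 x0 "- x0"] by simp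
  then have "q x0 = norm x0"
    using le[of x0] linear_neg[OF lin, of x0] by simp
  then show thesis using lin le that by blast
qed

section \<open>Complex norming functionals\<close>

interpretation scaleC: vector_space "(*\<^sub>C) :: complex \<Rightarrow> 'a :: complex_vector \<Rightarrow> 'a"
  by standard (auto simp: scaleC_add_right scaleC_add_left scaleC_scaleC scaleC_one)

declare scaleC_one [simp] scaleC_scaleC [simp]

definition cfunctional :: "('a :: complex_banach \<Rightarrow> complex) \<Rightarrow> bool" where
  "cfunctional l \<longleftrightarrow> (\<forall>x y. l (x + y) = l x + l y) \<and> (\<forall>a x. l (a *\<^sub>C x) = a * l x) \<and>
     (\<forall>x. cmod (l x) \<le> norm x)"

lemma
  assumes "cfunctional l"
  shows cfunctional_add: "l (x + y) = l x + l y"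
    and cfunctional_scale: "l (a *\<^sub>C x) = a * l x"
    and cfunctional_le: "cmod (l x) \<le> norm x"
    and cfunctional_0: "l 0 = 0"
    and cfunctional_diff: "l (x - y) = l x - l y"
    and cfunctional_sum: "l (\<Sum>i\<in>I. f i) = (\<Sum>i\<in>I. l (f i))"
    and cfunctional_bounded_linear: "bounded_linear l"
proof -
  show add: "l (x + y) = l x + l y" and sc: "l (a *\<^sub>C x) = a * l x"
    and le: "cmod (l x) \<le> norm x" for x y a
    using assms by (auto simp: cfunctional_def)
  show bl: "bounded_linear l"
    by (rule bounded_linear_intro[where K=1])
      (simp_all add: add le scaleR_scaleC sc scaleC_complex_def)
  then interpret bounded_linear l .
  show "l 0 = 0" "l (x - y) = l x - l y" 
      "l (\<Sum>i\<in>I. f i) = (\<Sum>i\<in>I. l (f i))"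
    by (fact zero, fact diff, fact sum)
qed

lemma norming_functional:
  fixes x0 :: "'a :: complex_banach"
  obtains l where "cfunctional l" "norm x0 \<le> cmod (l x0)"
proof -
  obtain k where k: "linear k" "\<And>x. k x \<le> norm x" "k x0 = norm x0"
    using real_norming_functional by blast
  interpret k: linear k by fact
  \<comment> \<open>The only complex linear functional whose real part is \<open>k\<close>.\<close>
  define l where "l x = Complex (k x) (- k (\<i> *\<^sub>C x))" for x
  have add: "l (x + y) = l x + l y" for x y
    by (simp add: l_def complex_eq_iff k.add scaleC_add_right)
  have kre: "k (complex_of_real r *\<^sub>C x) = r * k x" for r x
    using k.scale[of r x] by (simp add: scaleR_scaleC)
  have scale: "l (a *\<^sub>C x) = a * l x" for a x
  proof -
    have a: "a = complex_of_real (Re a) + complex_of_real (Im a) * \<i>"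
      by (simp add: complex_eq_iff)
    have 1: "k (a *\<^sub>C y) = Re a * k y + Im a * k (\<i> *\<^sub>C y)" for y
    proof -
      have "a *\<^sub>C y = complex_of_real (Re a) *\<^sub>C y + complex_of_real (Im a) *\<^sub>C \<i> *\<^sub>C y"
        by (subst a) (simp add: scaleC_add_left)
      then show ?thesis by (simp only: k.add kre)
    qed
    have "\<i> *\<^sub>C a *\<^sub>C x = a *\<^sub>C \<i> *\<^sub>C x" by (simp add: mult.commute)
    moreover have "k (\<i> *\<^sub>C \<i> *\<^sub>C x) = - k x"
      using kre[of "-1" x] by simp
    ultimately show ?thesis
      using 1[of x] 1[of "\<i> *\<^sub>C x"] by (auto simp: l_def complex_eq_iff algebra_simps)
  qed
  have le: "cmod (l x) \<le> norm x" for x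
  proof (cases "l x = 0")
    case False
    \<comment> \<open>A rotation of \<open>x\<close> by a unimodular factor makes the value of
      \<open>l\<close> real and nonnegative, so that the bound for the real part suffices.\<close>
    define a where "a = cnj (sgn (l x))"
    have na: "cmod a = 1" using False by (simp add: a_def norm_sgn)
    have "l (a *\<^sub>C x) = complex_of_real (cmod (l x))"
      using False by (simp add: scale a_def sgn_div_norm complex_eq_iff
          cmod_def power2_eq_square divide_simps scaleR_conv_of_real)
    then have "cmod (l x) = Re (l (a *\<^sub>C x))" by simp
    also have "\<dots> = k (a *\<^sub>C x)" by (simp add: l_def)
    also have "\<dots> \<le> norm x" using k(2)[of "a *\<^sub>C x"] na by (simp add: norm_scaleC)
    finally show ?thesis .
  qed auto
  have "norm x0 \<le> cmod (l x0)"
    using k(3) complex_Re_le_cmod[of "l x0"] by (simp add: l_def)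
  with add scale le show thesis by (intro that[of l]) (auto simp: cfunctional_def)
qed

lemma norm_le_functionals:
  assumes "\<And>l. cfunctional l \<Longrightarrow> cmod (l x) \<le> c"
  shows "norm x \<le> c"
proof -
  obtain l where "cfunctional l" "norm x \<le> cmod (l x)" by (rule norming_functional)
  with assms[of l] show ?thesis by simp
qed

text \<open>Identities between vector-valued Taylor coefficients are proved through this rule, which
  reduces them to scalar function theory.\<close>

lemma eq_functionals:
  assumes "\<And>l. cfunctional l \<Longrightarrow> l x = l y"
  shows "x = y"
proof -
  have "norm (x - y) \<le> 0"
    by (rule norm_le_functionals) (simp add: cfunctional_diff assms)
  then show ?thesis by simp
qed

section \<open>Banach-valued analytic functions\<close>

definition analytic_in :: "complex set \<Rightarrow> (complex \<Rightarrow> 'a :: complex_banach) \<Rightarrow> bool" where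
  "analytic_in S f \<longleftrightarrow> (\<forall>z\<in>S. \<exists>D. (f has_derivative (\<lambda>h. h *\<^sub>C D)) (at z))"

lemma analytic_functions_iff:
  "f \<in> analytic_functions S \<longleftrightarrow> analytic_in S f \<and> (\<forall>z. z \<notin> S \<longrightarrow> f z = 0)"
  by (auto simp: analytic_functions_def analytic_in_def)

lemma cderiv_eq:
  assumes "(f has_derivative (\<lambda>h. h *\<^sub>C D)) (at z)"
  shows "cderiv f z = D"
proof -
  have "(f has_derivative (\<lambda>h. h *\<^sub>C cderiv f z)) (at z)"
    unfolding cderiv_def using assms by (rule someI)
  then have "(\<lambda>h. h *\<^sub>C cderiv f z) = (\<lambda>h. h *\<^sub>C D)"
    using assms by (rule has_derivative_unique)
  then show ?thesis by (metis scaleC_one)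
qed

lemma analytic_in_cderiv:
  assumes "analytic_in S f" "z \<in> S"
  shows "(f has_derivative (\<lambda>h. h *\<^sub>C cderiv f z)) (at z)"
  using assms cderiv_eq unfolding analytic_in_def by metis

lemma cfunctional_has_field_derivative:
  assumes "cfunctional l" "(f has_derivative (\<lambda>h. h *\<^sub>C D)) (at z)"
  shows "((\<lambda>w. l (f w)) has_field_derivative l D) (at z)"
proof -
  have "((\<lambda>w. l (f w)) has_derivative (\<lambda>h. l (h *\<^sub>C D))) (at z)"
    by (rule bounded_linear.has_derivative[OF cfunctional_bounded_linear[OF assms(1)] assms(2)])
  moreover have "(\<lambda>h. l (h *\<^sub>C D)) = (*) (l D)"
    using assms(1) by (auto simp: cfunctional_scale mult.commute)
  ultimately show ?thesis by (simp add: has_field_derivative_def)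
qed

lemma analytic_in_functional:
  assumes "cfunctional l" "analytic_in S f"
  shows "(\<lambda>w. l (f w)) holomorphic_on S"
  using assms cfunctional_has_field_derivative unfolding analytic_in_def holomorphic_on_def
  by (metis DERIV_subset field_differentiable_def subset_UNIV)

lemma functional_cderiv:
  assumes "cfunctional l" "analytic_in S f" "z \<in> S"
  shows "l (cderiv f z) = deriv (\<lambda>w. l (f w)) z"
  using cfunctional_has_field_derivative[OF assms(1) analytic_in_cderiv[OF assms(2,3)]]
  by (simp add: DERIV_imp_deriv)

text \<open>Taylor's formula of order one with Cauchy's estimate for the second derivative. Around
  points of the half ball, discs of radius r/4 stay inside, which gives 2 (B + 1) / (r/4)^2; the
  summand 1 puts the values into an open ball. The constant depends on \<open>B\<close> and
  \<open>r\<close> only, hence is the same for l o f with any functional l of norm at most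
  1.\<close>

lemma difference_quotient_bound:
  fixes f :: "complex \<Rightarrow> complex"
  assumes f: "f holomorphic_on ball a r" and r: "r > 0"
    and B: "\<And>w. w \<in> ball a r \<Longrightarrow> cmod (f w) \<le> B"
    and w: "w \<in> ball a (r / 2)" "w \<noteq> a"
  shows "cmod ((f w - f a) / (w - a) - deriv f a) \<le> 32 * (B + 1) / r\<^sup>2 * cmod (w - a)"
proof -
  have B0: "B \<ge> 0" using B[of a] r by (smt (verit) centre_in_ball norm_ge_zero)
  define g where "g i = (deriv ^^ i) f" for i
  have g: "g i holomorphic_on ball a r" for i
    unfolding g_def using f by (intro holomorphic_higher_deriv) auto
  have g2: "cmod (g 2 x) \<le> 32 * (B + 1) / r\<^sup>2" if x: "x \<in> ball a (r / 2)" for x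
  proof -
    have sub: "cball x (r / 4) \<subseteq> ball a r"
      using x r by (intro subset_trans[OF _ subset_ball[of "3 * r / 4" r a]])
        (auto simp: cball_subset_ball_iff dist_commute)
    then have "f holomorphic_on cball x (r / 4)" using f holomorphic_on_subset by blast
    then have "norm ((deriv ^^ 2) f x) \<le> fact 2 * (B + 1) / (r / 4) ^ 2"
      using sub r B
      by (intro Cauchy_higher_deriv_bound[where y=0])
        (force intro: holomorphic_on_imp_continuous_on holomorphic_on_subset[of _ "cball x (r/4)"]
          simp: subset_iff less_le_not_le)+
    then show ?thesis using r by (simp add: g_def field_simps power2_eq_square)
  qed
  have "cmod (g 0 w - (\<Sum>i\<le>1. g i a * (w - a) ^ i / fact i))
      \<le> 32 * (B + 1) / r\<^sup>2 * cmod (w - a) ^ Suc 1 / fact 1"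
  proof (rule complex_Taylor[where S="ball a (r / 2)"])
    fix i x assume "x \<in> ball a (r / 2)"
    then have "x \<in> ball a r" using r by auto
    then have "(g i has_field_derivative deriv (g i) x) (at x)"
      using g[of i] by (simp add: holomorphic_derivI)
    then show "(g i has_field_derivative g (Suc i) x) (at x within ball a (r / 2))"
      by (simp add: g_def has_field_derivative_at_within)
  qed (use w r g2 in \<open>auto simp: numeral_2_eq_2\<close>)
  then have "cmod (f w - f a - deriv f a * (w - a)) \<le> 32 * (B + 1) / r\<^sup>2 * cmod (w - a) ^ 2"
    by (simp add: g_def power2_eq_square algebra_simps)
  moreover have "(f w - f a) / (w - a) - deriv f a = (f w - f a - deriv f a * (w - a)) / (w - a)"
    using w by (simp add: field_simps)
  ultimately show ?thesis
    using w by (simp add: norm_divide power2_eq_square pos_divide_le_eq mult.assoc)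
qed

text \<open>The difference quotients at a point are Cauchy because their images under the functionals
  are Cauchy at a uniform rate.\<close>

lemma weakly_holomorphic_imp_analytic_in:
  fixes f :: "complex \<Rightarrow> 'a :: complex_banach"
  assumes S: "open S"
    and bdd: "\<And>a. a \<in> S \<Longrightarrow> \<exists>r>0. \<exists>B. \<forall>w\<in>ball a r. norm (f w) \<le> B"
    and weak: "\<And>l. cfunctional l \<Longrightarrow> (\<lambda>w. l (f w)) holomorphic_on S"
  shows "analytic_in S f"
  unfolding analytic_in_def
proof
  fix a assume a: "a \<in> S"
  obtain r1 B where r1: "r1 > 0" and B: "\<And>w. w \<in> ball a r1 \<Longrightarrow> norm (f w) \<le> B"
    using bdd[OF a] by blast
  obtain r2 where r2: "r2 > 0" "ball a r2 \<subseteq> S"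
    using S a open_contains_ball by blast
  define r where "r = min r1 r2"
  have r: "r > 0" using r1 r2 by (simp add: r_def)
  have rS: "ball a r \<subseteq> S" using r2(2) by (auto simp: r_def)
  define C where "C = 32 * (B + 1) / r\<^sup>2"
  define Q where "Q w = inverse (w - a) *\<^sub>C (f w - f a)" for w
  have C0: "C \<ge> 0"
    using order_trans[OF norm_ge_zero, OF B[of a]] r1
    by (auto simp: C_def intro!: divide_nonneg_nonneg)
  have Q: "norm (Q w - Q v) \<le> C * (cmod (w - a) + cmod (v - a))"
    if wv: "w \<in> ball a (r / 2)" "w \<noteq> a" "v \<in> ball a (r / 2)" "v \<noteq> a" for w v
  proof (rule norm_le_functionals)
    fix l :: "'a \<Rightarrow> complex" assume l: "cfunctional l"
    have h: "(\<lambda>w. l (f w)) holomorphic_on ball a r"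
      using weak[OF l] rS by (rule holomorphic_on_subset)
    have b: "cmod (l (f w)) \<le> B" if "w \<in> ball a r" for w
      using cfunctional_le[OF l, of "f w"] B[of w] that by (simp add: r_def)
    have lQ: "l (Q w) = (l (f w) - l (f a)) / (w - a)" for w
      by (simp add: Q_def cfunctional_scale[OF l] cfunctional_diff[OF l] divide_inverse)
    let ?d = "deriv (\<lambda>w. l (f w)) a"
    have "cmod (l (Q w) - ?d) \<le> C * cmod (w - a)" "cmod (l (Q v) - ?d) \<le> C * cmod (v - a)"
      unfolding lQ C_def by (rule difference_quotient_bound[OF h r b]; use wv in simp)+
    then show "cmod (l (Q w - Q v)) \<le> C * (cmod (w - a) + cmod (v - a))"
      using norm_triangle_ineq4[of "l (Q w) - ?d" "l (Q v) - ?d"]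
      by (simp add: cfunctional_diff[OF l] algebra_simps)
  qed
  \<comment> \<open>The denominator starts at 3, so that already the first point lies in the half
    ball where the estimate \<open>Q\<close> holds.\<close>
  define x where "x n = a + of_real (r / (real n + 3))" for n
  have xa: "cmod (x n - a) = r / (real n + 3)" for n
    using r by (simp add: x_def norm_divide del: of_real_divide)
  have x: "x n \<in> ball a (r / 2)" "x n \<noteq> a" for n
  proof -
    have "r / (real n + 3) < r / 2" using r by (intro divide_strict_left_mono) auto
    then show "x n \<in> ball a (r / 2)" using xa[of n] by (simp add: dist_norm norm_minus_commute)
    show "x n \<noteq> a" using r xa[of n] by auto
  qed
  have lim0: "(\<lambda>n. r / (real n + 3)) \<longlonglongrightarrow> 0" by real_asymp
  have "Cauchy (\<lambda>n. Q (x n))"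
  proof (rule CauchyI)
    fix e :: real assume e: "e > 0"
    have "(\<lambda>n. C * (r / (real n + 3))) \<longlonglongrightarrow> C * 0"
      by (intro tendsto_intros lim0)
    then have "eventually (\<lambda>n. C * (r / (real n + 3)) < e / 2) sequentially"
      using e by (intro order_tendstoD(2)) auto
    then obtain M where M: "\<And>n. n \<ge> M \<Longrightarrow> C * (r / (real n + 3)) < e / 2"
      by (auto simp: eventually_sequentially)
    have "norm (Q (x n) - Q (x k)) < e" if "n \<ge> M" "k \<ge> M" for n k
      using Q[OF x(1,2)[of n] x(1,2)[of k]] M[OF that(1)] M[OF that(2)]
      unfolding xa distrib_left by linarith
    then show "\<exists>M. \<forall>m\<ge>M. \<forall>n\<ge>M. norm (Q (x m) - Q (x n)) < e" by blast
  qed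
  then obtain D where D: "(\<lambda>n. Q (x n)) \<longlonglongrightarrow> D"
    using Cauchy_convergent convergent_def by blast
  \<comment> \<open>Letting one of the two points in \<open>Q\<close> run through the sequence
    leaves an error linear in the distance to \<open>a\<close>, which is more than differentiability
    asks for.\<close>
  have QD: "norm (Q w - D) \<le> C * cmod (w - a)" if "w \<in> ball a (r / 2)" "w \<noteq> a" for w
  proof (rule tendsto_le[OF sequentially_bot])
    show "(\<lambda>n. norm (Q w - Q (x n))) \<longlonglongrightarrow> norm (Q w - D)"
      by (intro tendsto_intros D)
    show "(\<lambda>n. C * (cmod (w - a) + r / (real n + 3))) \<longlonglongrightarrow> C * cmod (w - a)"
      using tendsto_mult_left[OF tendsto_add[OF tendsto_const lim0], of C "cmod (w - a)"] by simp
    show "\<forall>\<^sub>F n in sequentially. norm (Q w - Q (x n)) \<le> C * (cmod (w - a) + r / (real n + 3))"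
      using Q[OF that x] by (simp add: xa)
  qed
  have bl: "bounded_linear (\<lambda>h. h *\<^sub>C D)"
    by (rule bounded_linear_intro[where K="norm D"])
      (simp_all add: scaleC_add_left scaleR_scaleC scaleC_complex_def norm_scaleC)
  have "(f has_derivative (\<lambda>h. h *\<^sub>C D)) (at a)"
    unfolding has_derivative_within
  proof (intro conjI bl)
    have eq: "norm ((1 / norm (w - a)) *\<^sub>R (f w - (f a + (w - a) *\<^sub>C D))) \<le> C * cmod (w - a)"
      if "w \<in> ball a (r / 2)" "w \<noteq> a" for w
    proof -
      have "(w - a) *\<^sub>C Q w = f w - f a"
        using that by (simp add: Q_def)
      then have "f w - (f a + (w - a) *\<^sub>C D) = (w - a) *\<^sub>C (Q w - D)"
        by (simp add: scaleC.scale_right_diff_distrib)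
      then have "norm (f w - (f a + (w - a) *\<^sub>C D)) = cmod (w - a) * norm (Q w - D)"
        by (simp add: norm_scaleC)
      then show ?thesis using QD[OF that] that by simp
    qed
    show "((\<lambda>w. (1 / norm (w - a)) *\<^sub>R (f w - (f a + (w - a) *\<^sub>C D))) \<longlongrightarrow> 0) (at a within UNIV)"
    proof (rule Lim_null_comparison)
      show "\<forall>\<^sub>F w in at a. norm ((1 / norm (w - a)) *\<^sub>R (f w - (f a + (w - a) *\<^sub>C D))) \<le> C * cmod (w - a)"
        unfolding eventually_at using r eq
        by (intro exI[of _ "r / 2"]) (auto simp: dist_commute)
      have "((\<lambda>w. C * cmod (w - a)) \<longlongrightarrow> C * cmod (a - a)) (at a)"
        by (intro tendsto_intros)
      then show "((\<lambda>w. C * cmod (w - a)) \<longlongrightarrow> 0) (at a)" by simp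
    qed
  qed
  then show "\<exists>D. (f has_derivative (\<lambda>h. h *\<^sub>C D)) (at a)" by blast
qed

lemma locally_bounded_of_isCont:
  fixes f :: "complex \<Rightarrow> 'a :: real_normed_vector"
  assumes "isCont f a"
  shows "\<exists>r>0. \<exists>B. \<forall>w\<in>ball a r. norm (f w) \<le> B"
proof -
  obtain r where r: "r > 0" "\<And>w. dist w a < r \<Longrightarrow> dist (f w) (f a) < 1"
    using assms unfolding continuous_at_eps_delta by (metis zero_less_one)
  have "norm (f w) \<le> norm (f a) + 1" if "w \<in> ball a r" for w
  proof -
    have "norm (f w - f a) < 1" using r(2)[of w] that by (simp add: dist_norm norm_minus_commute)
    then show ?thesis using norm_triangle_ineq2[of "f w" "f a"] by simp
  qed
  then show ?thesis using r(1) by blast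
qed

lemma analytic_in_isCont: "analytic_in S f \<Longrightarrow> z \<in> S \<Longrightarrow> isCont f z"
  unfolding analytic_in_def using has_derivative_continuous by blast

text \<open>Weak holomorphy is inherited from the scalar derivatives of l o f. Local boundedness
  comes from Cauchy's estimate, whose constant is uniform in the functional.\<close>

lemma analytic_in_cderivative:
  fixes f :: "complex \<Rightarrow> 'a :: complex_banach"
  assumes S: "open S" and f: "analytic_in S f"
  shows "analytic_in S (cderiv f)"
proof (rule weakly_holomorphic_imp_analytic_in[OF S])
  fix l :: "'a \<Rightarrow> complex" assume l: "cfunctional l"
  have "deriv (\<lambda>w. l (f w)) holomorphic_on S"
    using analytic_in_functional[OF l f] S by (rule holomorphic_deriv)
  then show "(\<lambda>w. l (cderiv f w)) holomorphic_on S"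
    by (rule holomorphic_transform) (simp add: functional_cderiv[OF l f])
next
  fix a assume a: "a \<in> S"
  obtain r1 B where r1: "r1 > 0" and B: "\<And>w. w \<in> ball a r1 \<Longrightarrow> norm (f w) \<le> B"
    using locally_bounded_of_isCont[OF analytic_in_isCont[OF f a]] by blast
  obtain r2 where r2: "r2 > 0" "ball a r2 \<subseteq> S"
    using S a open_contains_ball by blast
  \<comment> \<open>Half the radius, so that closed discs of radius \<open>r\<close> around points
    of \<open>ball a r\<close> stay in both balls.\<close>
  define r where "r = min r1 r2 / 2"
  have r: "r > 0" using r1 r2 by (simp add: r_def)
  have "norm (cderiv f w) \<le> (B + 1) / r" if w: "w \<in> ball a r" for w
  proof (rule norm_le_functionals)
    fix l :: "'a \<Rightarrow> complex" assume l: "cfunctional l"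
    have sub: "x \<in> ball a r1 \<and> x \<in> ball a r2" if "x \<in> cball w r" for x
      using that w dist_triangle[of a x w] by (simp add: r_def)
    have hol: "(\<lambda>w. l (f w)) holomorphic_on cball w r"
      using analytic_in_functional[OF l f] by (rule holomorphic_on_subset) (use sub r2 in blast)
    have "norm ((deriv ^^ 1) (\<lambda>w. l (f w)) w) \<le> fact 1 * (B + 1) / r ^ 1"
    proof (rule Cauchy_higher_deriv_bound[where y=0])
      show "(\<lambda>w. l (f w)) holomorphic_on ball w r"
        using hol by (rule holomorphic_on_subset) auto
      show "continuous_on (cball w r) (\<lambda>w. l (f w))"
        using hol by (rule holomorphic_on_imp_continuous_on)
      show "l (f x) \<in> ball 0 (B + 1)" if "x \<in> ball w r" for x
        using cfunctional_le[OF l, of "f x"] B[of x] sub[of x] that by simp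
    qed (use r in auto)
    moreover have "w \<in> S" using sub[of w] r r2 by auto
    ultimately show "cmod (l (cderiv f w)) \<le> (B + 1) / r"
      by (simp add: functional_cderiv[OF l f])
  qed
  then show "\<exists>r>0. \<exists>B. \<forall>w\<in>ball a r. norm (cderiv f w) \<le> B" using r by blast
qed

lemma analytic_in_higher_cderiv:
  assumes "open S" "analytic_in S f"
  shows "analytic_in S ((cderiv ^^ i) f)"
  using assms by (induction i) (auto intro: analytic_in_cderivative)

lemma functional_higher_cderiv:
  assumes l: "cfunctional l" and S: "open S" and f: "analytic_in S f" and z: "z \<in> S"
  shows "l ((cderiv ^^ i) f z) = (deriv ^^ i) (\<lambda>w. l (f w)) z"
  using z
proof (induction i arbitrary: z)
  case (Suc i)
  have "l ((cderiv ^^ Suc i) f z) = deriv (\<lambda>w. l ((cderiv ^^ i) f w)) z"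
    using functional_cderiv[OF l analytic_in_higher_cderiv[OF S f]] Suc.prems by simp
  also have "\<dots> = deriv ((deriv ^^ i) (\<lambda>w. l (f w))) z"
  proof (rule complex_derivative_transform_within_open)
    have "(\<lambda>w. l (f w)) holomorphic_on S" by (rule analytic_in_functional[OF l f])
    then show "(deriv ^^ i) (\<lambda>w. l (f w)) holomorphic_on S" 
      using S by (rule holomorphic_higher_deriv)
    show "(\<lambda>w. l ((cderiv ^^ i) f w)) holomorphic_on S"
      by (rule analytic_in_functional[OF l analytic_in_higher_cderiv[OF S f]])
  qed (use S Suc in auto)
  finally show ?case by simp
qed auto

lemma functional_taylor:
  assumes "cfunctional l" "open S" "analytic_in S f" "z \<in> S"
  shows "l (taylor i f z) = ctaylor i (\<lambda>w. l (f w)) z"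
  using functional_higher_cderiv[OF assms] assms(1)
  by (simp add: taylor_def ctaylor_def cfunctional_scale)

section \<open>Closure properties of Banach-valued analytic functions\<close>

lemma analytic_inI:
  assumes "\<And>z. z \<in> S \<Longrightarrow> (f has_derivative (\<lambda>h. h *\<^sub>C D z)) (at z)"
  shows "analytic_in S f"
  using assms unfolding analytic_in_def by blast

lemma analytic_in_subset: "analytic_in T f \<Longrightarrow> S \<subseteq> T \<Longrightarrow> analytic_in S f"
  by (auto simp: analytic_in_def)

lemma analytic_in_0: "analytic_in S (\<lambda>z. 0)"
  by (rule analytic_inI[where D="\<lambda>_. 0"]) simp

lemma analytic_in_add:
  assumes "analytic_in S f" "analytic_in S g"
  shows "analytic_in S (\<lambda>z. f z + g z)"
proof (rule analytic_inI)
  fix z assume "z \<in> S"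
  then have "((\<lambda>z. f z + g z) has_derivative (\<lambda>h. h *\<^sub>C cderiv f z + h *\<^sub>C cderiv g z)) (at z)"
    using assms by (intro has_derivative_add analytic_in_cderiv)
  then show "((\<lambda>z. f z + g z) has_derivative (\<lambda>h. h *\<^sub>C (cderiv f z + cderiv g z))) (at z)"
    by (simp add: scaleC_add_right)
qed

lemma analytic_in_sum:
  "(\<And>j. j \<in> I \<Longrightarrow> analytic_in S (f j)) \<Longrightarrow> analytic_in S (\<lambda>z. \<Sum>j\<in>I. f j z)"
  by (induction I rule: infinite_finite_induct) (auto intro: analytic_in_0 analytic_in_add)

lemma bounded_bilinear_scaleC:
  "bounded_bilinear ((*\<^sub>C) :: complex \<Rightarrow> 'a :: complex_banach \<Rightarrow> 'a)"
proof
  show "(r *\<^sub>R a) *\<^sub>C b = r *\<^sub>R a *\<^sub>C b" "a *\<^sub>C r *\<^sub>R b = r *\<^sub>R a *\<^sub>C b" for r a and b :: 'a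
    by (simp_all add: scaleR_scaleC scaleC_complex_def mult.commute)
  show "\<exists>K. \<forall>a (b :: 'a). norm (a *\<^sub>C b) \<le> norm a * norm b * K"
    by (rule exI[of _ 1]) (simp add: norm_scaleC)
qed (simp_all add: scaleC_add_left scaleC_add_right)

lemma analytic_in_scale:
  assumes "h holomorphic_on S" "open S" "analytic_in S f"
  shows "analytic_in S (\<lambda>z. h z *\<^sub>C f z)"
proof (rule analytic_inI)
  fix z assume z: "z \<in> S"
  have "(h has_derivative (*) (deriv h z)) (at z)"
    using holomorphic_derivI[OF assms(1,2) z] by (simp add: has_field_derivative_def)
  then have "((\<lambda>z. h z *\<^sub>C f z) has_derivative
      (\<lambda>k. h z *\<^sub>C k *\<^sub>C cderiv f z + (deriv h z * k) *\<^sub>C f z)) (at z)"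
    using analytic_in_cderiv[OF assms(3) z]
    by (rule bounded_bilinear.FDERIV[OF bounded_bilinear_scaleC])
  then show "((\<lambda>z. h z *\<^sub>C f z) has_derivative
      (\<lambda>k. k *\<^sub>C (h z *\<^sub>C cderiv f z + deriv h z *\<^sub>C f z))) (at z)"
    by (simp add: scaleC_add_right mult.commute)
qed

lemma analytic_in_compose:
  assumes "analytic_in T f" "\<psi> holomorphic_on S" "open S" "\<psi> ` S \<subseteq> T"
  shows "analytic_in S (\<lambda>w. f (\<psi> w))"
proof (rule analytic_inI)
  fix w assume w: "w \<in> S"
  have "(\<psi> has_derivative (*) (deriv \<psi> w)) (at w)"
    using holomorphic_derivI[OF assms(2,3) w] by (simp add: has_field_derivative_def)
  moreover have "(f has_derivative (\<lambda>h. h *\<^sub>C cderiv f (\<psi> w))) (at (\<psi> w))"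
    using assms w by (intro analytic_in_cderiv) auto
  ultimately have "((\<lambda>w. f (\<psi> w)) has_derivative (\<lambda>h. (deriv \<psi> w * h) *\<^sub>C cderiv f (\<psi> w))) (at w)"
    by (rule has_derivative_compose)
  then show "((\<lambda>w. f (\<psi> w)) has_derivative (\<lambda>h. h *\<^sub>C (deriv \<psi> w *\<^sub>C cderiv f (\<psi> w)))) (at w)"
    by (simp add: mult.commute)
qed

lemma analytic_in_transform:
  assumes "analytic_in S f" "open S" "\<And>z. z \<in> S \<Longrightarrow> f z = g z"
  shows "analytic_in S g"
proof (rule analytic_inI)
  fix z assume "z \<in> S"
  then show "(g has_derivative (\<lambda>h. h *\<^sub>C cderiv f z)) (at z)"
    using has_derivative_transform_within_open[OF analytic_in_cderiv[OF assms(1)] assms(2)] assms(3)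
    by blast
qed

section \<open>Taylor coefficients\<close>

text \<open>The bridge to formal power series: Taylor coefficients of products and compositions are
  read off from expansions.\<close>

lemma ctaylor_unique:
  assumes "(\<lambda>h. f (z + h)) has_fps_expansion P"
  shows "ctaylor i f z = fps_nth P i"
  using fps_nth_fps_expansion[OF assms, of i] higher_deriv_shift_0[of i f z]
  by (simp add: ctaylor_def o_def)

lemma has_fps_expansion_ctaylor:
  assumes "f holomorphic_on S" "open S" "z \<in> S"
  shows "(\<lambda>h. f (z + h)) has_fps_expansion Abs_fps (\<lambda>i. ctaylor i f z)"
proof -
  have "f analytic_on {z}" using assms analytic_at by blast
  then show ?thesis
    using analytic_at_imp_has_fps_expansion[of f z] by (simp add: fps_expansion_def ctaylor_def)
qed

lemma ctaylor_cong:
  assumes "open S" "z \<in> S" "\<And>w. w \<in> S \<Longrightarrow> f w = g w"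
  shows "ctaylor i f z = ctaylor i g z"
proof -
  have "\<forall>\<^sub>F w in nhds z. f w = g w"
    using assms eventually_nhds by blast
  then show ?thesis by (simp add: ctaylor_def higher_deriv_cong_ev)
qed

lemma ctaylor_0: "ctaylor 0 f z = f z"
  by (simp add: ctaylor_def)

lemma ctaylor_add:
  assumes "f holomorphic_on S" "g holomorphic_on S" "open S" "z \<in> S"
  shows "ctaylor i (\<lambda>w. f w + g w) z = ctaylor i f z + ctaylor i g z"
  using higher_deriv_add[OF assms(1,2,3,4)] by (simp add: ctaylor_def add_divide_distrib)

lemma ctaylor_mult:
  assumes "f holomorphic_on S" "g holomorphic_on S" "open S" "z \<in> S"
  shows "ctaylor i (\<lambda>w. f w * g w) z = (\<Sum>a=0..i. ctaylor a f z * ctaylor (i - a) g z)"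
proof -
  have "(\<lambda>h. f (z + h) * g (z + h)) has_fps_expansion
      Abs_fps (\<lambda>i. ctaylor i f z) * Abs_fps (\<lambda>i. ctaylor i g z)"
    by (rule has_fps_expansion_mult; rule has_fps_expansion_ctaylor; fact assms)
  then show ?thesis using ctaylor_unique[of "\<lambda>w. f w * g w"] by (simp add: fps_mult_nth)
qed

lemma ctaylor_diff_power: "ctaylor i (\<lambda>v. (v - z) ^ k) z = (if i = k then 1 else 0)"
proof -
  have "(\<lambda>h. (z + h - z) ^ k) has_fps_expansion fps_X ^ k"
    by (simp add: has_fps_expansion_fps_X_power)
  from ctaylor_unique[of "\<lambda>v. (v - z) ^ k", OF this] show ?thesis by simp
qed

lemma ctaylor_1: "ctaylor (Suc 0) f z = deriv f z"
  by (simp add: ctaylor_def)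

lemma ctaylor_ctaylor:
  assumes "f holomorphic_on S" "open S" "z \<in> S"
  shows "ctaylor (Suc 0) (ctaylor i f) z = of_nat (Suc i) * ctaylor (Suc i) f z"
proof -
  have "ctaylor (Suc 0) (ctaylor i f) z = deriv (\<lambda>w. (deriv ^^ i) f w / fact i) z"
    by (simp add: ctaylor_def[abs_def])
  also have "\<dots> = deriv ((deriv ^^ i) f) z / fact i"
    using holomorphic_on_imp_differentiable_at[OF holomorphic_higher_deriv[OF assms(1,2)] assms(2,3)]
    by (rule deriv_cdivide_right)
  finally show ?thesis by (simp add: ctaylor_def field_simps del: of_nat_Suc)
qed

lemma taylor_0 [simp]: "taylor 0 f = f"
  by (simp add: taylor_def fun_eq_iff)

lemma taylor_cong:
  assumes S: "open S" and z: "z \<in> S" and f: "analytic_in S f" and eq: "\<And>w. w \<in> S \<Longrightarrow> f w = g w"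
  shows "taylor i f z = taylor i g z"
proof (rule eq_functionals)
  fix l :: "'a \<Rightarrow> complex" assume l: "cfunctional l"
  have "analytic_in S g" using f S eq by (rule analytic_in_transform)
  then show "l (taylor i f z) = l (taylor i g z)"
    using functional_taylor[OF l S f z] functional_taylor[OF l S _ z, of g]
    by (simp add: ctaylor_cong[OF S z, of "\<lambda>w. l (f w)" "\<lambda>w. l (g w)"] eq)
qed

lemma taylor_scale_fun:
  assumes h: "h holomorphic_on S" and f: "analytic_in S f" and S: "open S" and z: "z \<in> S"
  shows "taylor i (\<lambda>w. h w *\<^sub>C f w) z = (\<Sum>a=0..i. ctaylor a h z *\<^sub>C taylor (i - a) f z)"
proof (rule eq_functionals)
  fix l :: "'a \<Rightarrow> complex" assume l: "cfunctional l"
  show "l (taylor i (\<lambda>w. h w *\<^sub>C f w) z) = l (\<Sum>a=0..i. ctaylor a h z *\<^sub>C taylor (i - a) f z)"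
    using ctaylor_mult[OF h analytic_in_functional[OF l f] S z, of i]
    by (simp add: functional_taylor[OF l S _ z] analytic_in_scale h f S cfunctional_scale[OF l]
        cfunctional_sum[OF l])
qed

lemma taylor_add:
  assumes f: "analytic_in S f" and g: "analytic_in S g" and S: "open S" and z: "z \<in> S"
  shows "taylor i (\<lambda>w. f w + g w) z = taylor i f z + taylor i g z"
proof (rule eq_functionals)
  fix l :: "'a \<Rightarrow> complex" assume l: "cfunctional l"
  show "l (taylor i (\<lambda>w. f w + g w) z) = l (taylor i f z + taylor i g z)"
    using ctaylor_add[OF analytic_in_functional[OF l f] analytic_in_functional[OF l g] S z]
    by (simp add: functional_taylor[OF l S _ z] analytic_in_add f g cfunctional_add[OF l])
qed

lemma higher_cderiv_0: "(cderiv ^^ i) (\<lambda>z. 0 :: 'a :: complex_banach) = (\<lambda>z. 0)"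
proof (induction i)
  case (Suc i)
  have "cderiv (\<lambda>z. 0 :: 'a) = (\<lambda>z. 0)" by (rule ext, rule cderiv_eq) simp
  then show ?case using Suc by simp
qed simp

lemma taylor_zero: "taylor i (\<lambda>z. 0 :: 'a :: complex_banach) z = 0"
  by (simp add: taylor_def higher_cderiv_0)

lemma taylor_sum:
  assumes "\<And>j. j \<in> I \<Longrightarrow> analytic_in S (f j)" "open S" "z \<in> S"
  shows "taylor i (\<lambda>w. \<Sum>j\<in>I. f j w) z = (\<Sum>j\<in>I. taylor i (f j) z)"
  using assms
  by (induction I rule: infinite_finite_induct)
    (auto simp: taylor_zero taylor_add[where S=S] analytic_in_sum)

lemma taylor_cmult:
  assumes f: "analytic_in S f" and S: "open S" and z: "z \<in> S"
  shows "taylor i (\<lambda>w. c *\<^sub>C f w) z = c *\<^sub>C taylor i f z"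
proof -
  have "ctaylor a (\<lambda>w. c) z = (if a = 0 then c else 0)" for a
    by (simp add: ctaylor_def)
  then have "(\<Sum>a=0..i. ctaylor a (\<lambda>w. c) z *\<^sub>C taylor (i - a) f z) = c *\<^sub>C taylor i f z"
    by (simp add: sum.atLeast_Suc_atMost)
  then show ?thesis using taylor_scale_fun[of "\<lambda>w. c" S f z i] f S z by simp
qed

lemma taylor_diff:
  assumes f: "analytic_in S f" and g: "analytic_in S g" and S: "open S" and z: "z \<in> S"
  shows "taylor i (\<lambda>w. f w - g w) z = taylor i f z - taylor i g z"
proof -
  have "analytic_in S (\<lambda>w. (-1) *\<^sub>C g w)" using S g by (intro analytic_in_scale) auto
  from taylor_add[OF f this S z, of i] show ?thesis
    unfolding taylor_cmult[OF g S z] by simp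
qed

lemma analytic_in_taylor:
  assumes "open S" "analytic_in S f"
  shows "analytic_in S (taylor i f)"
  unfolding taylor_def[abs_def]
  using assms by (intro analytic_in_scale analytic_in_higher_cderiv) auto

text \<open>The derivative of f^(i)/i! is f^(i+1)/i!, that is, (i + 1) times the next Taylor
  coefficient. This is the origin of the factors 1, ..., m in the upper row of the matrix of
  \<open>E\<close>.\<close>

lemma taylor_taylor:
  assumes f: "analytic_in S f" and S: "open S" and z: "z \<in> S"
  shows "taylor (Suc 0) (taylor i f) z = of_nat (Suc i) *\<^sub>C taylor (Suc i) f z"
proof (rule eq_functionals)
  fix l :: "'a \<Rightarrow> complex" assume l: "cfunctional l"
  have "ctaylor (Suc 0) (\<lambda>w. l (taylor i f w)) z = ctaylor (Suc 0) (ctaylor i (\<lambda>w. l (f w))) z"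
    by (rule ctaylor_cong[OF S z]) (simp add: functional_taylor[OF l S f])
  then show "l (taylor (Suc 0) (taylor i f) z) = l (of_nat (Suc i) *\<^sub>C taylor (Suc i) f z)"
    by (simp add: functional_taylor[OF l S _ z] f analytic_in_taylor[OF S f] cfunctional_scale[OF l]
        ctaylor_ctaylor[OF analytic_in_functional[OF l f] S z])
qed

section \<open>The chain rule matrix\<close>

text \<open>The expansion of h |-> \<psi>(w + h) - \<psi>(w). The coefficients of its powers are the
  entries of the Faa di Bruno matrix, so Bell polynomials need not be written out.\<close>

definition increment_fps :: "(complex \<Rightarrow> complex) \<Rightarrow> complex \<Rightarrow> complex fps" where
  "increment_fps \<psi> w = Abs_fps (\<lambda>i. ctaylor i \<psi> w) - fps_const (\<psi> w)"

lemma increment_fps_0: "fps_nth (increment_fps \<psi> w) 0 = 0"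
  by (simp add: increment_fps_def ctaylor_0)

text \<open>Composition of power series. The increment series has no constant term, so its k-th
  power starts at order k; the sum over k <= i may therefore be extended to all k < m.\<close>

lemma ctaylor_compose:
  assumes \<psi>: "\<psi> holomorphic_on S" "open S" "w \<in> S"
    and f: "f holomorphic_on V" "open V" "\<psi> w \<in> V" and m: "i < m"
  shows "ctaylor i (f \<circ> \<psi>) w = (\<Sum>k<m. fps_nth (increment_fps \<psi> w ^ k) i * ctaylor k f (\<psi> w))"
proof -
  let ?P = "increment_fps \<psi> w"
  have "(\<lambda>h. f (\<psi> w + h)) has_fps_expansion Abs_fps (\<lambda>i. ctaylor i f (\<psi> w))"
    by (rule has_fps_expansion_ctaylor[OF f])
  moreover have "(\<lambda>h. \<psi> (w + h) - \<psi> w) has_fps_expansion ?P"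
    unfolding increment_fps_def
    by (intro has_fps_expansion_diff has_fps_expansion_ctaylor[OF \<psi>] has_fps_expansion_const)
  ultimately have "((\<lambda>h. f (\<psi> w + h)) \<circ> (\<lambda>h. \<psi> (w + h) - \<psi> w))
      has_fps_expansion (fps_compose (Abs_fps (\<lambda>i. ctaylor i f (\<psi> w))) ?P)"
    by (rule has_fps_expansion_compose) (rule increment_fps_0)
  then have "(\<lambda>h. (f \<circ> \<psi>) (w + h)) has_fps_expansion (fps_compose (Abs_fps (\<lambda>i. ctaylor i f (\<psi> w))) ?P)"
    by (simp add: o_def)
  from ctaylor_unique[of "f \<circ> \<psi>", OF this, of i]
  have "ctaylor i (f \<circ> \<psi>) w = (\<Sum>k=0..i. ctaylor k f (\<psi> w) * fps_nth (?P ^ k) i)"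
    by (simp add: fps_compose_nth)
  also have "\<dots> = (\<Sum>k<m. ctaylor k f (\<psi> w) * fps_nth (?P ^ k) i)"
  proof (rule sum.mono_neutral_left)
    show "\<forall>k\<in>{..<m} - {0..i}. ctaylor k f (\<psi> w) * fps_nth (?P ^ k) i = 0"
      using startsby_zero_power_prefix[of ?P] increment_fps_0 by auto
  qed (use m in auto)
  finally show ?thesis by (simp add: mult.commute)
qed

text \<open>Existence is the composition formula, the diagonal entries being the powers of
  \<psi>'(w). Uniqueness comes from testing with monomials.\<close>

lemma chain_matrix_eq:
  assumes \<psi>: "\<psi> holomorphic_on S" "open S" "w \<in> S" and d: "deriv \<psi> w \<noteq> 0"
  shows "chain_matrix m \<psi> w = (\<lambda>i k. if k \<le> i \<and> i < m then fps_nth (increment_fps \<psi> w ^ k) i else 0)"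
proof -
  let ?P = "increment_fps \<psi> w"
  let ?L = "\<lambda>i k. if k \<le> i \<and> i < m then fps_nth (?P ^ k) i else 0"
  have prefix: "fps_nth (?P ^ k) i = 0" if "i < k" for i k
    using startsby_zero_power_prefix[of ?P k] increment_fps_0 that by auto
  have L: "fps_nth (?P ^ k) i = ?L i k" if "i < m" for i k
    using that prefix by (auto simp: not_le)
  have "fps_nth ?P 1 \<noteq> 0"
    using d by (simp add: increment_fps_def ctaylor_1)
  then have diag: "fps_nth (?P ^ i) i \<noteq> 0" for i
    by (simp add: startsby_zero_power_nth_same increment_fps_0)
  show ?thesis
    unfolding chain_matrix_def
  proof (rule the_equality, intro conjI allI impI)
    fix f V i
    assume "open V \<and> \<psi> w \<in> V \<and> f holomorphic_on V" "i < m"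
    then show "ctaylor i (f \<circ> \<psi>) w = (\<Sum>k<m. ?L i k * ctaylor k f (\<psi> w))"
      using ctaylor_compose[OF \<psi>, of f V i m] L by simp
  next
    fix M
    assume M: "(\<forall>i k. M i k \<noteq> 0 \<longrightarrow> k \<le> i \<and> i < m) \<and> (\<forall>i<m. M i i \<noteq> 0) \<and>
      (\<forall>f V. open V \<and> \<psi> w \<in> V \<and> f holomorphic_on V \<longrightarrow>
        (\<forall>i<m. ctaylor i (f \<circ> \<psi>) w = (\<Sum>k<m. M i k * ctaylor k f (\<psi> w))))"
    show "M = ?L"
    proof (intro ext)
      fix i k
      show "M i k = ?L i k"
      proof (cases "k \<le> i \<and> i < m")
        case True
        \<comment> \<open>The Taylor coefficients of this monomial at \<psi>(w) form the k-th unit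
          vector, so the two sums single out the entries (i, k).\<close>
        let ?f = "\<lambda>v. (v - \<psi> w) ^ k"
        have f: "?f holomorphic_on UNIV" by (intro holomorphic_intros)
        have "(\<Sum>k'<m. M i k' * ctaylor k' ?f (\<psi> w)) = (\<Sum>k'<m. fps_nth (?P ^ k') i * ctaylor k' ?f (\<psi> w))"
        proof -
          have "ctaylor i (?f \<circ> \<psi>) w = (\<Sum>k'<m. M i k' * ctaylor k' ?f (\<psi> w))"
            using M f True open_UNIV UNIV_I by blast
          then show ?thesis using ctaylor_compose[OF \<psi> f, of i m] True by simp
        qed
        then show ?thesis
          using True by (simp add: ctaylor_diff_power if_distrib[of "\<lambda>x. _ * x"] cong: if_cong)
      next
        case False
        then show ?thesis using M by auto
      qed
    qed
  qed (auto simp: diag split: if_splits)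
qed

lemma taylor_compose:
  assumes \<psi>: "\<psi> holomorphic_on S" "open S" "w \<in> S" and d: "deriv \<psi> w \<noteq> 0"
    and f: "analytic_in V f" "open V" "\<psi> ` S \<subseteq> V" and m: "i < m"
  shows "taylor i (\<lambda>w. f (\<psi> w)) w = (\<Sum>k<m. chain_matrix m \<psi> w i k *\<^sub>C taylor k f (\<psi> w))"
proof (rule eq_functionals)
  fix l :: "'a \<Rightarrow> complex" assume l: "cfunctional l"
  have V: "\<psi> w \<in> V" using f \<psi> by blast
  have eq: "fps_nth (increment_fps \<psi> w ^ k) i = chain_matrix m \<psi> w i k" for k
    using m startsby_zero_power_prefix[of "increment_fps \<psi> w" k] increment_fps_0
    by (auto simp: chain_matrix_eq[OF \<psi> d] not_le)
  have "ctaylor i ((\<lambda>v. l (f v)) \<circ> \<psi>) w =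
      (\<Sum>k<m. chain_matrix m \<psi> w i k * ctaylor k (\<lambda>v. l (f v)) (\<psi> w))"
    unfolding eq[symmetric]
    by (rule ctaylor_compose[OF \<psi> analytic_in_functional[OF l f(1)] f(2) V m])
  then show "l (taylor i (\<lambda>w. f (\<psi> w)) w) = l (\<Sum>k<m. chain_matrix m \<psi> w i k *\<^sub>C taylor k f (\<psi> w))"
    by (simp add: functional_taylor[OF l \<psi>(2) analytic_in_compose[OF f(1) \<psi>(1,2) f(3)] \<psi>(3)]
        functional_taylor[OF l f(2,1) V] cfunctional_sum[OF l] cfunctional_scale[OF l] o_def)
qed

section \<open>Seminormed spaces and split exact sequences\<close>

text \<open>Ranges with a quotient norm are at once of this kind; whether the norm is definite is a
  separate question, settled later.\<close>

definition seminormed :: "('v :: complex_vector) nspace \<Rightarrow> bool" where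
  "seminormed X \<longleftrightarrow>
     vadd X = (+) \<and> vscale X = (*\<^sub>C) \<and> 0 \<in> carr X \<and>
     (\<forall>x\<in>carr X. \<forall>y\<in>carr X. x + y \<in> carr X) \<and>
     (\<forall>a. \<forall>x\<in>carr X. a *\<^sub>C x \<in> carr X) \<and>
     (\<forall>x\<in>carr X. 0 \<le> vnorm X x) \<and>
     (\<forall>a. \<forall>x\<in>carr X. vnorm X (a *\<^sub>C x) = cmod a * vnorm X x) \<and>
     (\<forall>x\<in>carr X. \<forall>y\<in>carr X. vnorm X (x + y) \<le> vnorm X x + vnorm X y)"

lemma seminormedD:
  assumes "seminormed X"
  shows "vadd X = (+)" "vscale X = (*\<^sub>C)" "0 \<in> carr X"
    "x \<in> carr X \<Longrightarrow> y \<in> carr X \<Longrightarrow> x + y \<in> carr X"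
    "x \<in> carr X \<Longrightarrow> a *\<^sub>C x \<in> carr X"
    "x \<in> carr X \<Longrightarrow> 0 \<le> vnorm X x"
    "x \<in> carr X \<Longrightarrow> vnorm X (a *\<^sub>C x) = cmod a * vnorm X x"
    "x \<in> carr X \<Longrightarrow> y \<in> carr X \<Longrightarrow> vnorm X (x + y) \<le> vnorm X x + vnorm X y"
  using assms by (simp_all add: seminormed_def)

lemma
  assumes "seminormed X"
  shows seminormed_diff: "x \<in> carr X \<Longrightarrow> y \<in> carr X \<Longrightarrow> x - y \<in> carr X"
    and seminormed_uminus: "y \<in> carr X \<Longrightarrow> - y \<in> carr X"
    and seminormed_norm_minus: "y \<in> carr X \<Longrightarrow> vnorm X (- y) = vnorm X y"
    and seminormed_norm_diff:
      "x \<in> carr X \<Longrightarrow> y \<in> carr X \<Longrightarrow> vnorm X (x - y) \<le> vnorm X x + vnorm X y"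
    and seminormed_norm_0: "vnorm X 0 = 0"
    and seminormed_ndist: "x \<in> carr X \<Longrightarrow> y \<in> carr X \<Longrightarrow> ndist X x y = vnorm X (x - y)"
proof -
  note X = seminormedD[OF assms]
  show u: "- y \<in> carr X" if "y \<in> carr X" for y using X(5)[OF that, of "- 1"] by simp
  show n: "vnorm X (- y) = vnorm X y" if "y \<in> carr X" for y
    using X(7)[OF that, of "- 1"] by simp
  show "x - y \<in> carr X" "vnorm X (x - y) \<le> vnorm X x + vnorm X y"
    if "x \<in> carr X" "y \<in> carr X"
    using X(4)[OF that(1) u[OF that(2)]] X(8)[OF that(1) u[OF that(2)]] n[OF that(2)] by simp_all
  show "vnorm X 0 = 0" using X(7)[OF X(3), of 0] by simp
  show "ndist X x y = vnorm X (x - y)" if "x \<in> carr X" "y \<in> carr X"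
    using that by (simp add: ndist_def X(1,2))
qed

lemma Metric_space_ndist:
  assumes X: "seminormed X" and def: "\<And>x. x \<in> carr X \<Longrightarrow> vnorm X x = 0 \<Longrightarrow> x = 0"
  shows "Metric_space (carr X) (ndist X)"
proof
  fix x y
  have sym: "vnorm X (x - y) = vnorm X (y - x)" if "x \<in> carr X" "y \<in> carr X" for x y
    using seminormed_norm_minus[OF X seminormed_diff[OF X that]] by simp
  show "0 \<le> ndist X x y" 
  proof (cases "x \<in> carr X \<and> y \<in> carr X")
    case True
    then show ?thesis
      using seminormedD(6)[OF X seminormed_diff[OF X]] by (simp add: seminormed_ndist[OF X])
  qed (auto simp: ndist_def)
  show "ndist X x y = ndist X y x"
  proof (cases "x \<in> carr X \<and> y \<in> carr X")
    case True
    then show ?thesis using sym by (simp add: seminormed_ndist[OF X])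
  qed (auto simp: ndist_def)
next
  fix x y assume xy: "x \<in> carr X" "y \<in> carr X"
  show "ndist X x y = 0 \<longleftrightarrow> x = y"
    using def[OF seminormed_diff[OF X xy]] xy
    by (auto simp: seminormed_ndist[OF X] seminormed_norm_0[OF X])
next
  fix x y z assume xyz: "x \<in> carr X" "y \<in> carr X" "z \<in> carr X"
  then have "vnorm X ((x - y) + (y - z)) \<le> vnorm X (x - y) + vnorm X (y - z)"
    by (intro seminormedD(8)[OF X] seminormed_diff[OF X])
  then show "ndist X x z \<le> ndist X x y + ndist X y z"
    using xyz by (simp add: seminormed_ndist[OF X])
qed

lemma bounded_operatorI:
  assumes "seminormed X" "seminormed Y"
    and "\<And>x. x \<in> carr X \<Longrightarrow> T x \<in> carr Y"
    and "\<And>x y. x \<in> carr X \<Longrightarrow> y \<in> carr X \<Longrightarrow> T (x + y) = T x + T y"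
    and "\<And>a x. x \<in> carr X \<Longrightarrow> T (a *\<^sub>C x) = a *\<^sub>C T x"
    and "\<And>x. x \<in> carr X \<Longrightarrow> vnorm Y (T x) \<le> C * vnorm X x"
  shows "bounded_operator X Y T"
  using assms unfolding bounded_operator_def seminormedD(1,2)[OF assms(1)] seminormedD(1,2)[OF assms(2)]
  by blast

lemma bounded_operatorD:
  assumes "seminormed X" "seminormed Y" "bounded_operator X Y T"
  shows "x \<in> carr X \<Longrightarrow> T x \<in> carr Y"
    and "x \<in> carr X \<Longrightarrow> y \<in> carr X \<Longrightarrow> T (x + y) = T x + T y"
    and "x \<in> carr X \<Longrightarrow> T (a *\<^sub>C x) = a *\<^sub>C T x"
    and "x \<in> carr X \<Longrightarrow> y \<in> carr X \<Longrightarrow> T (x - y) = T x - T y"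
proof -
  show add: "x \<in> carr X \<Longrightarrow> y \<in> carr X \<Longrightarrow> T (x + y) = T x + T y"
    and sc: "x \<in> carr X \<Longrightarrow> T (a *\<^sub>C x) = a *\<^sub>C T x"
    and "x \<in> carr X \<Longrightarrow> T x \<in> carr Y" for x y a
    using assms by (auto simp: bounded_operator_def seminormedD(1,2))
  show "T (x - y) = T x - T y" if "x \<in> carr X" "y \<in> carr X"
    using add[OF that(1) seminormed_uminus[OF assms(1) that(2)]] sc[OF that(2), of "- 1"] by simp
qed

text \<open>The constant is made positive so that it can be used as a divisor.\<close>

lemma bounded_operator_bound:
  assumes "seminormed X" "bounded_operator X Y T"
  obtains C where "C > 0" "\<And>x. x \<in> carr X \<Longrightarrow> vnorm Y (T x) \<le> C * vnorm X x"
proof -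
  obtain C where C: "\<And>x. x \<in> carr X \<Longrightarrow> vnorm Y (T x) \<le> C * vnorm X x"
    using assms(2) unfolding bounded_operator_def by blast
  show thesis
  proof
    show "max C 1 > 0" by simp
    show "vnorm Y (T x) \<le> max C 1 * vnorm X x" if "x \<in> carr X" for x
      using C[OF that] seminormedD(6)[OF assms(1) that]
      by (meson max.cobounded1 mult_right_mono order_trans)
  qed
qed

lemma bounded_operator_compose:
  assumes X: "seminormed X" and Y: "seminormed Y"
    and S: "bounded_operator X Y S" and T: "bounded_operator Y V T"
  shows "bounded_operator X V (\<lambda>x. T (S x))"
proof -
  obtain C where C: "C > 0" "\<And>x. x \<in> carr X \<Longrightarrow> vnorm Y (S x) \<le> C * vnorm X x"
    using bounded_operator_bound[OF X S] by blast
  obtain K where K: "K > 0" "\<And>x. x \<in> carr Y \<Longrightarrow> vnorm V (T x) \<le> K * vnorm Y x"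
    using bounded_operator_bound[OF Y T] by blast
  have SX: "S x \<in> carr Y" if "x \<in> carr X" for x
    using S that by (auto simp: bounded_operator_def)
  have "vnorm V (T (S x)) \<le> (K * C) * vnorm X x" if x: "x \<in> carr X" for x
  proof -
    have "vnorm V (T (S x)) \<le> K * vnorm Y (S x)" using SX[OF x] by (rule K)
    also have "\<dots> \<le> K * (C * vnorm X x)" using C(2)[OF x] K(1) by simp
    finally show ?thesis by simp
  qed
  moreover have "(\<lambda>x. T (S x)) ` carr X \<subseteq> carr V"
    "\<forall>x\<in>carr X. \<forall>y\<in>carr X. T (S (vadd X x y)) = vadd V (T (S x)) (T (S y))"
    "\<forall>a. \<forall>x\<in>carr X. T (S (vscale X a x)) = vscale V a (T (S x))"
    using S T SX by (auto simp: bounded_operator_def image_subset_iff)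
  ultimately show ?thesis unfolding bounded_operator_def by blast
qed

text \<open>A short exact sequence 0 -> X -> Y -> Z -> 0 with injection \<open>E\<close>, surjection
  \<open>D\<close>, and a splitting by a bounded left inverse \<open>R\<close> and a bounded section
  \<open>s\<close>. Definiteness is demanded at the two ends and passes to the middle.\<close>

locale split_sequence =
  fixes X :: "('x :: complex_vector) nspace" and Y :: "('y :: complex_vector) nspace"
    and Z :: "('z :: complex_vector) nspace" and E R D s
  assumes X: "seminormed X" and Y: "seminormed Y" and Z: "seminormed Z"
    and definite_X: "\<And>x. x \<in> carr X \<Longrightarrow> vnorm X x = 0 \<Longrightarrow> x = 0"
    and definite_Z: "\<And>x. x \<in> carr Z \<Longrightarrow> vnorm Z x = 0 \<Longrightarrow> x = 0"
    and E: "bounded_operator X Y E" and R: "bounded_operator Y X R"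
    and D: "bounded_operator Y Z D" and s: "bounded_operator Z Y s"
    and RE: "\<And>x. x \<in> carr X \<Longrightarrow> R (E x) = x"
    and DE: "\<And>x. x \<in> carr X \<Longrightarrow> D (E x) = 0"
    and Ds: "\<And>w. w \<in> carr Z \<Longrightarrow> D (s w) = w"
    and split: "\<And>y. y \<in> carr Y \<Longrightarrow> E (R y) + s (D y) = y"
begin

lemmas EX = bounded_operatorD[OF X Y E]
lemmas RY = bounded_operatorD[OF Y X R]
lemmas DY = bounded_operatorD[OF Y Z D]
lemmas sZ = bounded_operatorD[OF Z Y s]

lemma linear_zero:
  assumes "seminormed A" "seminormed B" "bounded_operator A B T"
  shows "T 0 = 0"
  using bounded_operatorD(3)[OF assms seminormedD(3)[OF assms(1)], of 0] by simp

lemma kernel: "y \<in> carr Y \<Longrightarrow> D y = 0 \<Longrightarrow> y \<in> E ` carr X"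
  using split[of y] linear_zero[OF Z Y s] RY(1)[of y] by (metis add.right_neutral imageI)

text \<open>If y has norm 0, then so have \<open>D y\<close> and \<open>R y\<close>; these vanish by
  definiteness at the ends, and y is recovered from them.\<close>

lemma definite_Y: "y \<in> carr Y \<Longrightarrow> vnorm Y y = 0 \<Longrightarrow> y = 0"
proof -
  assume y: "y \<in> carr Y" "vnorm Y y = 0"
  obtain C K where "vnorm Z (D y) \<le> C * vnorm Y y" "vnorm X (R y) \<le> K * vnorm Y y"
    using bounded_operator_bound[OF Y D] bounded_operator_bound[OF Y R] y(1) by metis
  then have "D y = 0" "R y = 0"
    using y definite_Z[OF DY(1)] definite_X[OF RY(1)] seminormedD(6)[OF Z DY(1)[OF y(1)]]
      seminormedD(6)[OF X RY(1)[OF y(1)]] by auto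
  then show "y = 0" using split[OF y(1)] linear_zero[OF X Y E] linear_zero[OF Z Y s] by simp
qed

text \<open>The range is the kernel of \<open>D\<close>. Since D (y - E x) = D y, a point y outside
  has distance at least norm (D y) / C from it, where C bounds \<open>D\<close>.\<close>

lemma closed_range: "closedin (ntopology Y) (E ` carr X)"
proof -
  interpret Metric_space "carr Y" "ndist Y"
    using Metric_space_ndist[OF Y definite_Y] .
  obtain C where C: "C > 0" "\<And>y. y \<in> carr Y \<Longrightarrow> vnorm Z (D y) \<le> C * vnorm Y y"
    using bounded_operator_bound[OF Y D] by blast
  show ?thesis
    unfolding ntopology_def closedin_metric
  proof (intro conjI allI impI)
    show "E ` carr X \<subseteq> carr Y" using EX(1) by blast
    fix y assume y: "y \<in> carr Y - E ` carr X"
    then have "D y \<noteq> 0" using kernel by blast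
    then have pos: "vnorm Z (D y) > 0"
      using y definite_Z[OF DY(1)] seminormedD(6)[OF Z DY(1)] by (metis Diff_iff less_eq_real_def)
    have "ndist Y y (E x) \<ge> vnorm Z (D y) / C" if x: "x \<in> carr X" for x
    proof -
      have "D (y - E x) = D y" using y EX(1)[OF x] DY(4) DE[OF x] by simp
      then show ?thesis
        using C(2)[OF seminormed_diff[OF Y, of y "E x"]] y EX(1)[OF x] C(1)
        by (simp add: seminormed_ndist[OF Y] field_simps)
    qed
    then have "disjnt (E ` carr X) (mball y (vnorm Z (D y) / C))"
      by (force simp: disjnt_def)
    then show "\<exists>r>0. disjnt (E ` carr X) (mball y r)"
      using pos C(1) by (intro exI[of _ "vnorm Z (D y) / C"]) simp
  qed
qed

text \<open>The estimate from below is the boundedness of the left inverse \<open>R\<close>.\<close>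

lemma embedding: "embedding X Y E"
proof -
  obtain C where C: "C > 0" "\<And>y. y \<in> carr Y \<Longrightarrow> vnorm X (R y) \<le> C * vnorm Y y"
    using bounded_operator_bound[OF Y R] by blast
  have "inj_on E (carr X)" using RE by (rule inj_on_inverseI)
  moreover have "vnorm X x \<le> C * vnorm Y (E x)" if "x \<in> carr X" for x
    using C(2)[OF EX(1)[OF that]] RE[OF that] by simp
  ultimately have "isomorphism X (Y\<lparr>carr := E ` carr X\<rparr>) E"
    using E by (auto simp: isomorphism_def bounded_operator_def bij_betw_def)
  moreover have "E ` carr X \<subseteq> carr Y" using EX(1) by blast
  ultimately show ?thesis using closed_range by (simp add: embedding_def)
qed

lemma complemented: "complemented Y (E ` carr X)"
  unfolding complemented_def
proof (intro exI conjI ballI)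
  show "bounded_operator Y Y (\<lambda>y. E (R y))"
    by (rule bounded_operator_compose[OF Y X R E])
  show inv: "E (R w) = w" if "w \<in> E ` carr X" for w using that RE by auto
  show "(\<lambda>y. E (R y)) ` carr Y = E ` carr X"
    using inv RY(1) EX(1) by (auto simp: image_iff) metis
qed

text \<open>Exactness in the middle: the cosets of the range are the fibres of \<open>D\<close>.
  Maps on the quotient can therefore be computed by \<open>D\<close> on any representative.\<close>

lemma coset_eq:
  assumes y: "y \<in> carr Y"
  shows "coset Y (E ` carr X) y = {v \<in> carr Y. D v = D y}"
proof (intro set_eqI iffI)
  fix v assume "v \<in> coset Y (E ` carr X) y"
  then obtain x where x: "x \<in> carr X" "v = y + E x"
    by (auto simp: coset_def seminormedD(1)[OF Y])
  then show "v \<in> {v \<in> carr Y. D v = D y}"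
    using y seminormedD(4)[OF Y y EX(1)[OF x(1)]] DY(2)[OF y EX(1)[OF x(1)]] DE[OF x(1)] by simp
next
  fix v assume v: "v \<in> {v \<in> carr Y. D v = D y}"
  then have "v - y \<in> E ` carr X"
    using kernel[OF seminormed_diff[OF Y, of v y]] DY(4)[of v y] y by simp
  then have "y + (v - y) \<in> coset Y (E ` carr X) y"
    by (simp only: coset_def seminormedD(1)[OF Y] image_eqI)
  then show "v \<in> coset Y (E ` carr X) y" by simp
qed

text \<open>The map induced by \<open>D\<close>. Its bound is that of \<open>D\<close>; the bound of
  the inverse comes from \<open>s\<close>, which supplies a representative of controlled norm in
  each coset.\<close>

lemma quotient_isomorphism:
  "\<exists>S. isomorphism (quotient_space Y (E ` carr X)) Z S"
proof -
  let ?W = "E ` carr X"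
  let ?Q = "quotient_space Y ?W"
  define S where "S A = D (SOME v. v \<in> A)" for A
  have W: "w \<in> carr Y" "D w = 0" if "w \<in> ?W" for w using that EX(1) DE by auto
  have W0: "0 \<in> ?W" using kernel seminormedD(3)[OF Y] linear_zero[OF Y Z D] by blast
  \<comment> \<open>Stated for arbitrary nonempty sets on which \<open>D\<close> is constant, so
    that it also covers the sets that the operations of the quotient produce.\<close>
  have S_eq: "S A = d" if "A \<noteq> {}" "\<And>v. v \<in> A \<Longrightarrow> D v = d" for A d
    unfolding S_def by (rule that(2)) (use that(1) some_in_eq in blast)
  have S: "S (coset Y ?W y) = D y" if y: "y \<in> carr Y" for y
    unfolding coset_eq[OF y] by (rule S_eq) (use y in blast)+
  have carr: "carr ?Q = coset Y ?W ` carr Y" by (simp add: quotient_space_def)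
  have norm: "vnorm ?Q A = Inf (vnorm Y ` A)" for A by (simp add: quotient_space_def)
  obtain C where C: "C > 0" "\<And>y. y \<in> carr Y \<Longrightarrow> vnorm Z (D y) \<le> C * vnorm Y y"
    using bounded_operator_bound[OF Y D] by blast
  obtain K where K: "K > 0" "\<And>w. w \<in> carr Z \<Longrightarrow> vnorm Y (s w) \<le> K * vnorm Z w"
    using bounded_operator_bound[OF Z s] by blast
  have "vnorm Z (S A) \<le> C * vnorm ?Q A" if AQ: "A \<in> carr ?Q" for A
  proof -
    obtain y where y: "y \<in> carr Y" "A = coset Y ?W y" using AQ unfolding carr image_iff by blast
    have "vnorm Z (D y) / C \<le> vnorm ?Q A"
      unfolding norm
    proof (rule cINF_greatest)
      show "A \<noteq> {}" using y by (auto simp: coset_eq)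
      show "vnorm Z (D y) / C \<le> vnorm Y v" if "v \<in> A" for v
        using that C(2)[of v] C(1) y by (auto simp: coset_eq field_simps)
    qed
    then show ?thesis using C(1) y S by (simp add: field_simps)
  qed
  moreover have "vnorm ?Q A \<le> K * vnorm Z (S A)" if AQ: "A \<in> carr ?Q" for A
  proof -
    obtain y where y: "y \<in> carr Y" "A = coset Y ?W y" using AQ unfolding carr image_iff by blast
    have sA: "s (D y) \<in> A" using y sZ(1) Ds DY(1) by (simp add: coset_eq)
    have "vnorm ?Q A \<le> vnorm Y (s (D y))"
      unfolding norm using sA y seminormedD(6)[OF Y]
      by (intro cINF_lower bdd_belowI2[where m=0]) (auto simp: coset_eq)
    also have "\<dots> \<le> K * vnorm Z (D y)" using y DY(1) by (intro K)
    finally show ?thesis using y S by simp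
  qed
  moreover have "bij_betw S (carr ?Q) (carr Z)"
    unfolding bij_betw_def
  proof
    show "inj_on S (carr ?Q)"
    proof (rule inj_onI)
      fix A B assume "A \<in> carr ?Q" "B \<in> carr ?Q" and eq: "S A = S B"
      then obtain a b where ab: "a \<in> carr Y" "A = coset Y ?W a" "b \<in> carr Y" "B = coset Y ?W b"
        unfolding carr image_iff by blast
      then have "D a = D b" using eq S by metis
      then show "A = B" using ab coset_eq by simp
    qed
    show "S ` carr ?Q = carr Z"
    proof
      show "S ` carr ?Q \<subseteq> carr Z" using S DY(1) by (auto simp: carr)
      show "carr Z \<subseteq> S ` carr ?Q"
      proof
        fix w assume w: "w \<in> carr Z"
        then have "w = S (coset Y ?W (s w))" using S[OF sZ(1)] Ds by simp
        then show "w \<in> S ` carr ?Q" using w sZ(1) by (auto simp: carr)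
      qed
    qed
  qed
  moreover have "S (vadd ?Q A B) = vadd Z (S A) (S B)" if AQ: "A \<in> carr ?Q" "B \<in> carr ?Q" for A B
  proof -
    obtain a b where ab: "a \<in> carr Y" "A = coset Y ?W a" "b \<in> carr Y" "B = coset Y ?W b"
      using AQ unfolding carr image_iff by blast
    have "S (vadd ?Q A B) = D a + D b"
    proof (rule S_eq)
      have "a \<in> A" "b \<in> B" using ab by (auto simp: coset_eq)
      then show "vadd ?Q A B \<noteq> {}" by (auto simp: quotient_space_def)
    qed (use ab DY(2) in \<open>auto simp: quotient_space_def coset_eq seminormedD(1)[OF Y]\<close>)
    then show ?thesis using ab S by (simp add: seminormedD(1)[OF Z])
  qed
  moreover have "S (vscale ?Q c A) = vscale Z c (S A)" if AQ: "A \<in> carr ?Q" for c A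
  proof -
    obtain a where a: "a \<in> carr Y" "A = coset Y ?W a" using AQ unfolding carr image_iff by blast
    have "S (vscale ?Q c A) = c *\<^sub>C D a"
    proof (rule S_eq)
      have "a \<in> A" using a by (auto simp: coset_eq)
      then show "vscale ?Q c A \<noteq> {}" using W0 by (auto simp: quotient_space_def)
    next
      fix v assume "v \<in> vscale ?Q c A"
      then obtain b w where b: "b \<in> carr Y" "D b = D a" and w: "w \<in> ?W" and v: "v = c *\<^sub>C b + w"
        using a by (auto simp: quotient_space_def coset_eq seminormedD(1,2)[OF Y])
      then show "D v = c *\<^sub>C D a"
        using DY(2)[OF seminormedD(5)[OF Y b(1)] W(1)[OF w], of c] DY(3)[OF b(1)] W(2)[OF w] by simp
    qed
    then show ?thesis using a S by (simp add: seminormedD(2)[OF Z])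
  qed
  ultimately have "isomorphism ?Q Z S"
    unfolding isomorphism_def bounded_operator_def by (blast dest: bij_betw_imp_surj_on)
  then show ?thesis by blast
qed

end

section \<open>Quotient norms on ranges of linear maps\<close>

lemma range_space_norm_le:
  assumes "seminormed A" "f \<in> carr A"
  shows "vnorm (range_space A t) (t f) \<le> vnorm A f"
  unfolding range_space_def using assms seminormedD(6)[OF assms(1)]
  by (auto intro!: cInf_lower bdd_belowI[where m=0])

lemma range_space_norm_ge:
  assumes "y \<in> carr (range_space A t)" "\<And>f. f \<in> carr A \<Longrightarrow> t f = y \<Longrightarrow> c \<le> vnorm A f"
  shows "c \<le> vnorm (range_space A t) y"
  using assms by (auto simp: range_space_def intro!: cInf_greatest)

lemma carr_range_space: "carr (range_space A t) = t ` carr A"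
  by (simp add: range_space_def)

lemma seminormed_range_space:
  assumes A: "seminormed A"
    and add: "\<And>f g. f \<in> carr A \<Longrightarrow> g \<in> carr A \<Longrightarrow> t (f + g) = t f + t g"
    and scale: "\<And>a f. f \<in> carr A \<Longrightarrow> t (a *\<^sub>C f) = a *\<^sub>C t f"
  shows "seminormed (range_space A t)"
proof -
  let ?R = "range_space A t"
  note le = range_space_norm_le[OF A, of _ t] and ge = range_space_norm_ge[of _ A t]
  have t0: "t 0 = 0" using scale[OF seminormedD(3)[OF A], of 0] by simp
  have nonneg: "0 \<le> vnorm ?R y" if "y \<in> carr ?R" for y
    using ge[OF that] seminormedD(6)[OF A] by blast
  have scale_le: "vnorm ?R (a *\<^sub>C y) \<le> cmod a * vnorm ?R y" if y: "y \<in> carr ?R" for a y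
  proof (cases "a = 0")
    case True
    then show ?thesis using le[OF seminormedD(3)[OF A]] by (simp add: t0 seminormed_norm_0[OF A])
  next
    case False
    have "vnorm ?R (a *\<^sub>C y) / cmod a \<le> vnorm ?R y"
    proof (rule ge[OF y])
      fix f assume f: "f \<in> carr A" "t f = y"
      then have "vnorm ?R (a *\<^sub>C y) \<le> vnorm A (a *\<^sub>C f)"
        using le[OF seminormedD(5)[OF A f(1)], of a] scale[OF f(1)] by simp
      then show "vnorm ?R (a *\<^sub>C y) / cmod a \<le> vnorm A f"
        using False seminormedD(7)[OF A f(1)] by (simp add: field_simps)
    qed
    then show ?thesis using False by (simp add: field_simps)
  qed
  have carr_scale: "a *\<^sub>C y \<in> carr ?R" if "y \<in> carr ?R" for a y
    using that scale seminormedD(5)[OF A] by (auto simp: carr_range_space image_iff) metis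
  have "vnorm ?R (a *\<^sub>C y) = cmod a * vnorm ?R y" if y: "y \<in> carr ?R" for a y
  proof (cases "a = 0")
    case True
    then show ?thesis using scale_le[OF y, of a] nonneg[OF carr_scale[OF y, of a]] by simp
  next
    case False
    have "vnorm ?R y \<le> cmod (inverse a) * vnorm ?R (a *\<^sub>C y)"
      using scale_le[OF carr_scale[OF y, of a], of "inverse a"] False by simp
    then have "cmod a * vnorm ?R y \<le> vnorm ?R (a *\<^sub>C y)"
      using False by (simp add: norm_inverse norm_divide field_simps)
    then show ?thesis using scale_le[OF y, of a] by simp
  qed
  moreover have "vnorm ?R (x + y) \<le> vnorm ?R x + vnorm ?R y"
    if x: "x \<in> carr ?R" and y: "y \<in> carr ?R" for x y
  proof -
    have *: "vnorm ?R (x + y) \<le> vnorm A f + vnorm A g"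
      if "f \<in> carr A" "t f = x" "g \<in> carr A" "t g = y" for f g
      using le[OF seminormedD(4)[OF A that(1,3)]] add[OF that(1,3)] seminormedD(8)[OF A that(1,3)] that
      by simp
    have "vnorm ?R (x + y) - vnorm A f \<le> vnorm ?R y" if "f \<in> carr A" "t f = x" for f
      using *[OF that] by (intro ge[OF y]) (simp add: algebra_simps)
    then have "vnorm ?R (x + y) - vnorm ?R y \<le> vnorm ?R x"
      by (intro ge[OF x]) (simp add: algebra_simps)
    then show ?thesis by simp
  qed
  moreover have "x + y \<in> carr ?R" if "x \<in> carr ?R" "y \<in> carr ?R" for x y
  proof -
    obtain f g where fg: "f \<in> carr A" "g \<in> carr A" "x = t f" "y = t g"
      using \<open>x \<in> carr ?R\<close> \<open>y \<in> carr ?R\<close> by (auto simp: carr_range_space)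
    then have "x + y = t (f + g)" using add by simp
    then show ?thesis using seminormedD(4)[OF A fg(1,2)] by (simp add: carr_range_space)
  qed
  moreover have "0 \<in> carr ?R"
    using t0 seminormedD(3)[OF A] by (force simp: carr_range_space)
  moreover have "vadd ?R = (+)" "vscale ?R = (*\<^sub>C)" by (simp_all add: range_space_def)
  ultimately show ?thesis using nonneg carr_scale by (simp add: seminormed_def)
qed

text \<open>A bound on the quotients needs only a lift of controlled norm for each single
  \<open>f\<close>; the lift may be chosen without regard to linearity. All four operators of the
  splitting are bounded in this way.\<close>

lemma bounded_operator_range_space:
  assumes A: "seminormed A" and B: "seminormed B"
    and tA: "seminormed (range_space A tA)" and tB: "seminormed (range_space B tB)"
    and C: "C > 0"
    and lift: "\<And>f. f \<in> carr A \<Longrightarrow> \<exists>g\<in>carr B. tB g = T (tA f) \<and> vnorm B g \<le> C * vnorm A f"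
    and "\<And>x y. x \<in> carr (range_space A tA) \<Longrightarrow> y \<in> carr (range_space A tA) \<Longrightarrow> T (x + y) = T x + T y"
    and "\<And>a x. x \<in> carr (range_space A tA) \<Longrightarrow> T (a *\<^sub>C x) = a *\<^sub>C T x"
  shows "bounded_operator (range_space A tA) (range_space B tB) T"
proof (rule bounded_operatorI[OF tA tB])
  fix x assume x: "x \<in> carr (range_space A tA)"
  then show "T x \<in> carr (range_space B tB)"
    using lift by (force simp: carr_range_space image_iff)
  have "vnorm (range_space B tB) (T x) / C \<le> vnorm (range_space A tA) x"
  proof (rule range_space_norm_ge[OF x])
    fix f assume f: "f \<in> carr A" "tA f = x"
    obtain g where g: "g \<in> carr B" "tB g = T x" "vnorm B g \<le> C * vnorm A f"
      using lift[OF f(1)] f(2) by auto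
    then show "vnorm (range_space B tB) (T x) / C \<le> vnorm A f"
      using range_space_norm_le[OF B g(1), of tB] C by (simp add: field_simps)
  qed
  then show "vnorm (range_space B tB) (T x) \<le> C * vnorm (range_space A tA) x"
    using C by (simp add: field_simps)
qed (fact assms)+

section \<open>The spaces of tuples\<close>

lemma scaleC_fun_apply [simp]: "(a *\<^sub>C f) x = a *\<^sub>C f x"
  by (simp add: scaleC_fun_def)

text \<open>The recursion in closed form. Entry i at w is the i-th Taylor coefficient at w of the
  sum of (\<omega> - w)^j g_j(\<omega>), since the factor (\<omega> - w)^j shifts coefficients by j
  places.\<close>

definition tower_tuple :: "nat \<Rightarrow> (nat \<Rightarrow> complex \<Rightarrow> 'a :: complex_banach) \<Rightarrow> nat \<Rightarrow> complex \<Rightarrow> 'a" where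
  "tower_tuple m g =
     (\<lambda>i. zero_off unit_disc (\<lambda>w. if i < m then \<Sum>j\<le>i. taylor (i - j) (g j) w else 0))"

lemma tower_tuple_Suc_0:
  assumes "g 0 \<in> analytic_functions unit_disc"
  shows "tower_tuple (Suc m) g 0 = g 0"
  using assms by (auto simp: tower_tuple_def zero_off_def analytic_functions_iff fun_eq_iff)

text \<open>Subtracting the jet of \<open>g 0\<close> deletes the summands with j = 0; what remains
  is the same expression for the shifted family.\<close>

lemma tail_defect_tower_tuple:
  assumes "g 0 \<in> analytic_functions unit_disc"
  shows "tail_defect m (tower_tuple (Suc m) g) = tower_tuple m (\<lambda>j. g (Suc j))"
  unfolding tail_defect_def tower_tuple_Suc_0[of g m, OF assms]
  by (intro ext) (simp add: tower_tuple_def zero_off_def sum.atMost_Suc_shift del: sum.atMost_Suc)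

text \<open>A tuple is determined by its entry 0 together with its defect, so the preceding
  computation can be inverted.\<close>

lemma tower_tuple_of_tail_defect:
  assumes t0: "t 0 \<in> analytic_functions unit_disc" and t: "tail_defect m t = tower_tuple m g"
  shows "t = tower_tuple (Suc m) (case_nat (t 0) g)"
proof
  fix i
  show "t i = tower_tuple (Suc m) (case_nat (t 0) g) i"
  proof (cases i)
    case 0
    then show ?thesis using tower_tuple_Suc_0[of "case_nat (t 0) g"] t0 by simp
  next
    case (Suc k)
    have "tail_defect m t k = tail_defect m (tower_tuple (Suc m) (case_nat (t 0) g)) k"
      using tail_defect_tower_tuple[of "case_nat (t 0) g" m] t t0 by simp
    then show ?thesis
      using tower_tuple_Suc_0[of "case_nat (t 0) g" m] t0 Suc
      by (cases "k < m") (simp_all add: tail_defect_def)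
  qed
qed

text \<open>The tower is parametrised by m free functions of G, and its norm is the sum of their
  norms.\<close>

lemma tower_eq:
  assumes G: "carr G \<subseteq> analytic_functions unit_disc"
  shows "carr (tower G m) = {tower_tuple m g | g. \<forall>j<m. g j \<in> carr G}" (is "?A m = ?B m")
    and "(\<And>j. j < m \<Longrightarrow> g j \<in> carr G) \<Longrightarrow>
      vnorm (tower G m) (tower_tuple m g) = (\<Sum>j<m. vnorm G (g j))"
proof -
  show "?A m = ?B m"
  proof (induction m)
    case 0
    have "tower_tuple 0 g = 0" for g :: "nat \<Rightarrow> complex \<Rightarrow> 'a"
      by (intro ext) (simp add: tower_tuple_def zero_off_def)
    then show ?case by (simp add: zero_fun_def)
  next
    case (Suc m)
    have "t \<in> ?B (Suc m)" if t: "t 0 \<in> carr G" "tail_defect m t \<in> ?A m" for t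
    proof -
      obtain g where g: "tail_defect m t = tower_tuple m g" "\<forall>j<m. g j \<in> carr G"
        using t(2) unfolding Suc.IH by blast
      have "t = tower_tuple (Suc m) (case_nat (t 0) g)"
        using t(1) G g(1) by (intro tower_tuple_of_tail_defect) auto
      moreover have "\<forall>j<Suc m. case_nat (t 0) g j \<in> carr G"
        using t(1) g(2) by (auto split: nat.split)
      ultimately show ?thesis by blast
    qed
    moreover have "tower_tuple (Suc m) g 0 \<in> carr G \<and> tail_defect m (tower_tuple (Suc m) g) \<in> ?A m"
      if g: "\<forall>j<Suc m. g j \<in> carr G" for g
    proof -
      have "g 0 \<in> analytic_functions unit_disc" using g G by auto
      then show ?thesis
        using g unfolding Suc.IH by (auto simp: tower_tuple_Suc_0 tail_defect_tower_tuple)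
    qed
    ultimately show ?case by auto
  qed
  show "(\<And>j. j < m \<Longrightarrow> g j \<in> carr G) \<Longrightarrow>
      vnorm (tower G m) (tower_tuple m g) = (\<Sum>j<m. vnorm G (g j))"
  proof (induction m arbitrary: g)
    case (Suc m)
    have "g 0 \<in> analytic_functions unit_disc" using Suc.prems[of 0] G by auto
    then show ?case
      using Suc.IH[of "\<lambda>j. g (Suc j)"] Suc.prems
      by (simp add: tail_defect_tower_tuple tower_tuple_Suc_0 sum.lessThan_Suc_shift add.commute
          del: sum.lessThan_Suc)
  qed simp
qed

text \<open>The variable u occurs both as base point of the jet and inside the function. Calculus in
  two variables is avoided by induction on \<open>j\<close>: one factor splits as \<phi>(v) -
  \<phi>(u), where \<phi>(v) is absorbed into \<open>f\<close> and \<phi>(u) stands outside the jet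
  as a scalar factor. As \<phi>(z) = 0, differentiating the product at \<open>z\<close> leaves only
  the derivative of that factor.\<close>

lemma
  assumes S: "open S" and z: "z \<in> S" and \<phi>: "\<phi> holomorphic_on S" and \<phi>z: "\<phi> z = 0"
    and f: "analytic_in S f"
  shows analytic_in_diagonal_taylor: "analytic_in S (\<lambda>u. taylor i (\<lambda>v. (\<phi> v - \<phi> u) ^ j *\<^sub>C f v) u)"
    and taylor_diagonal_taylor:
      "taylor (Suc 0) (\<lambda>u. taylor i (\<lambda>v. (\<phi> v - \<phi> u) ^ j *\<^sub>C f v) u) z =
        of_nat (Suc i) *\<^sub>C taylor (Suc i) (\<lambda>v. \<phi> v ^ j *\<^sub>C f v) z -
        (of_nat j * deriv \<phi> z) *\<^sub>C taylor i (\<lambda>v. \<phi> v ^ (j - 1) *\<^sub>C f v) z"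
proof -
  have "analytic_in S (\<lambda>u. taylor i (\<lambda>v. (\<phi> v - \<phi> u) ^ j *\<^sub>C f v) u) \<and>
      taylor (Suc 0) (\<lambda>u. taylor i (\<lambda>v. (\<phi> v - \<phi> u) ^ j *\<^sub>C f v) u) z =
        of_nat (Suc i) *\<^sub>C taylor (Suc i) (\<lambda>v. \<phi> v ^ j *\<^sub>C f v) z -
        (of_nat j * deriv \<phi> z) *\<^sub>C taylor i (\<lambda>v. \<phi> v ^ (j - 1) *\<^sub>C f v) z"
    using f
  proof (induction j arbitrary: f)
    case 0
    then show ?case using analytic_in_taylor[OF S 0] taylor_taylor[OF 0 S z, of i] by simp
  next
    case (Suc j)
    let ?P = "\<lambda>f u. taylor i (\<lambda>v. (\<phi> v - \<phi> u) ^ j *\<^sub>C f v) u"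
    let ?g = "\<lambda>v. \<phi> v *\<^sub>C f v"
    let ?Q = "\<lambda>u. - \<phi> u *\<^sub>C ?P f u"
    \<comment> \<open>The induction hypothesis is used twice, for \<open>f\<close> and for \<phi> f;
      hence \<open>f\<close> is kept arbitrary.\<close>
    have g: "analytic_in S ?g" using \<phi> S Suc.prems by (rule analytic_in_scale)
    note IHf = Suc.IH[OF Suc.prems] and IHg = Suc.IH[OF g]
    have pow: "analytic_in S (\<lambda>v. (\<phi> v - c) ^ k *\<^sub>C h v)" if "analytic_in S h" for h :: "complex \<Rightarrow> 'a" and c k
      using that \<phi> S by (intro analytic_in_scale holomorphic_intros)
    have rec: "?P ?g u + ?Q u = taylor i (\<lambda>v. (\<phi> v - \<phi> u) ^ Suc j *\<^sub>C f v) u" if u: "u \<in> S" for u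
    proof -
      have eq: "(\<lambda>v. (\<phi> v - \<phi> u) ^ Suc j *\<^sub>C f v) =
          (\<lambda>v. (\<phi> v - \<phi> u) ^ j *\<^sub>C ?g v + - \<phi> u *\<^sub>C ((\<phi> v - \<phi> u) ^ j *\<^sub>C f v))"
      proof
        fix v
        have "(\<phi> v - \<phi> u) ^ Suc j = (\<phi> v - \<phi> u) ^ j * \<phi> v + - \<phi> u * (\<phi> v - \<phi> u) ^ j"
          by (simp add: algebra_simps)
        then show "(\<phi> v - \<phi> u) ^ Suc j *\<^sub>C f v =
            (\<phi> v - \<phi> u) ^ j *\<^sub>C ?g v + - \<phi> u *\<^sub>C ((\<phi> v - \<phi> u) ^ j *\<^sub>C f v)"
          by (simp only: scaleC_add_left scaleC_scaleC)
      qed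
      have an: "analytic_in S (\<lambda>v. - \<phi> u *\<^sub>C ((\<phi> v - \<phi> u) ^ j *\<^sub>C f v))"
        using S by (intro analytic_in_scale pow Suc.prems) auto
      show ?thesis
        unfolding eq taylor_add[OF pow[OF g] an S u] taylor_cmult[OF pow[OF Suc.prems] S u] by (rule refl)
    qed
    have m\<phi>: "(\<lambda>u. - \<phi> u) holomorphic_on S" using \<phi> by (intro holomorphic_intros)
    have Q: "analytic_in S ?Q" using m\<phi> S IHf[THEN conjunct1] by (rule analytic_in_scale)
    have sum: "analytic_in S (\<lambda>u. ?P ?g u + ?Q u)" by (intro analytic_in_add conjunct1[OF IHg] Q)
    have an: "analytic_in S (\<lambda>u. taylor i (\<lambda>v. (\<phi> v - \<phi> u) ^ Suc j *\<^sub>C f v) u)"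
      using sum S rec by (rule analytic_in_transform)
    have d: "deriv (\<lambda>u. - \<phi> u) z = - deriv \<phi> z"
      using holomorphic_on_imp_differentiable_at[OF \<phi> S z] by simp
    have Qz: "taylor (Suc 0) ?Q z = - deriv \<phi> z *\<^sub>C taylor i (\<lambda>v. \<phi> v ^ j *\<^sub>C f v) z"
      using taylor_scale_fun[OF m\<phi> IHf[THEN conjunct1] S z, of "Suc 0"]
      by (simp add: ctaylor_0 ctaylor_1 \<phi>z d)
    have "taylor (Suc 0) (\<lambda>u. taylor i (\<lambda>v. (\<phi> v - \<phi> u) ^ Suc j *\<^sub>C f v) u) z =
        taylor (Suc 0) (\<lambda>u. ?P ?g u + ?Q u) z"
      by (rule taylor_cong[OF S z sum rec, symmetric])
    also have "\<dots> = taylor (Suc 0) (?P ?g) z + taylor (Suc 0) ?Q z"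
      by (rule taylor_add[OF conjunct1[OF IHg] Q S z])
    also have "taylor (Suc 0) (?P ?g) z = of_nat (Suc i) *\<^sub>C taylor (Suc i) (\<lambda>v. \<phi> v ^ Suc j *\<^sub>C f v) z -
        (of_nat j * deriv \<phi> z) *\<^sub>C taylor i (\<lambda>v. \<phi> v ^ j *\<^sub>C f v) z"
    \<comment> \<open>For j = 0 the exponent j - 1 is truncated to 0, but its term carries the
      factor j.\<close>
    proof (cases j)
      case (Suc k)
      have "\<phi> v ^ Suc k *\<^sub>C \<phi> v *\<^sub>C f v = \<phi> v ^ Suc (Suc k) *\<^sub>C f v"
        "\<phi> v ^ k *\<^sub>C \<phi> v *\<^sub>C f v = \<phi> v ^ Suc k *\<^sub>C f v" for v
        by (simp_all add: mult_ac)
      then show ?thesis using conjunct2[OF IHg] Suc by (simp add: mult_ac)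
    qed (use conjunct2[OF IHg] in simp)
    finally show ?case using an Qz by (simp add: scaleC_add_left algebra_simps)
  qed
  then show "analytic_in S (\<lambda>u. taylor i (\<lambda>v. (\<phi> v - \<phi> u) ^ j *\<^sub>C f v) u)"
    and "taylor (Suc 0) (\<lambda>u. taylor i (\<lambda>v. (\<phi> v - \<phi> u) ^ j *\<^sub>C f v) u) z =
        of_nat (Suc i) *\<^sub>C taylor (Suc i) (\<lambda>v. \<phi> v ^ j *\<^sub>C f v) z -
        (of_nat j * deriv \<phi> z) *\<^sub>C taylor i (\<lambda>v. \<phi> v ^ (j - 1) *\<^sub>C f v) z"
    by blast+
qed

lemma banach_space_in_seminormed: "banach_space_in X \<Longrightarrow> seminormed X"
  by (simp add: banach_space_in_def seminormed_def)

section \<open>The elements of \<T> as tuples of jets along the diagonal\<close>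

locale acceptable_disc =
  fixes U :: "complex set" and F :: "(complex \<Rightarrow> 'a :: complex_banach) nspace"
    and \<psi> :: "complex \<Rightarrow> complex"
  assumes acceptable: "acceptable_space U F"
    and \<psi>: "conformal_equivalence \<psi> unit_disc U"
begin

definition \<theta> :: "complex \<Rightarrow> complex" where
  "\<theta> = inv_into unit_disc \<psi>"

lemma U: "open U" and F: "seminormed F"
  and F_definite: "f \<in> carr F \<Longrightarrow> vnorm F f = 0 \<Longrightarrow> f = 0"
  and F_analytic: "f \<in> carr F \<Longrightarrow> f \<in> analytic_functions U"
  using acceptable banach_space_in_seminormed[of F]
  by (auto simp: acceptable_space_def banach_space_in_def)

lemma F_analytic_in: "f \<in> carr F \<Longrightarrow> analytic_in U f"
  and F_zero_off: "f \<in> carr F \<Longrightarrow> u \<notin> U \<Longrightarrow> f u = 0"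
  using F_analytic by (auto simp: analytic_functions_iff)

lemma \<psi>_holomorphic: "\<psi> holomorphic_on unit_disc" and \<psi>_inj: "inj_on \<psi> unit_disc"
  and \<psi>_image: "\<psi> ` unit_disc = U"
  using \<psi> by (auto simp: conformal_equivalence_def bij_betw_def)

lemma \<psi>_in: "w \<in> unit_disc \<Longrightarrow> \<psi> w \<in> U"
  using \<psi>_image by blast

lemma \<theta>_\<psi>: "w \<in> unit_disc \<Longrightarrow> \<theta> (\<psi> w) = w"
  unfolding \<theta>_def using \<psi>_inj by (rule inv_into_f_f)

lemma \<psi>_\<theta>: "u \<in> U \<Longrightarrow> \<psi> (\<theta> u) = u" and \<theta>_in: "u \<in> U \<Longrightarrow> \<theta> u \<in> unit_disc"
  unfolding \<theta>_def \<psi>_image[symmetric] by (rule f_inv_into_f, assumption) (rule inv_into_into)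

lemma deriv_\<psi>: "w \<in> unit_disc \<Longrightarrow> deriv \<psi> w \<noteq> 0"
  using holomorphic_injective_imp_regular[OF \<psi>_holomorphic open_ball \<psi>_inj] .

lemma \<theta>_holomorphic: "\<theta> holomorphic_on U"
proof -
  obtain g where g: "g holomorphic_on \<psi> ` unit_disc" "\<And>w. w \<in> unit_disc \<Longrightarrow> g (\<psi> w) = w"
    using holomorphic_has_inverse[OF \<psi>_holomorphic open_ball \<psi>_inj] by metis
  then show ?thesis
    using \<psi>_image \<theta>_\<psi> by (auto intro: holomorphic_transform)
qed

lemma \<theta>_bij: "bij_betw \<theta> U unit_disc"
  using \<psi> unfolding \<theta>_def conformal_equivalence_def by (blast intro: bij_betw_inv_into)

lemma \<theta>_conformal: "conformal_equivalence \<theta> U unit_disc"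
  by (simp add: conformal_equivalence_def \<theta>_holomorphic \<theta>_bij)

lemma deriv_\<theta>: "u \<in> U \<Longrightarrow> deriv \<theta> u \<noteq> 0"
  using holomorphic_injective_imp_regular[OF \<theta>_holomorphic U] \<theta>_bij by (auto simp: bij_betw_def)

text \<open>The tower consists of the sums of shifted jets, and a shift multiplies \<open>m\<close>-jets at \<open>w = \<theta> u\<close> by
  \<open>\<omega> - w\<close>. The substitution \<open>L(u)\<^sup>-\<^sup>1\<close> turns this factor into \<open>\<theta> v - \<theta> u\<close>.\<close>

definition jet_tuple :: "nat \<Rightarrow> (nat \<Rightarrow> complex \<Rightarrow> 'a) \<Rightarrow> nat \<Rightarrow> complex \<Rightarrow> 'a" where
  "jet_tuple m f = (\<lambda>i. zero_off U
     (\<lambda>u. if i < m then taylor i (\<lambda>v. \<Sum>j<m. (\<theta> v - \<theta> u) ^ j *\<^sub>C f j v) u else 0))"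

lemma analytic_in_power:
  "analytic_in U h \<Longrightarrow> analytic_in U (\<lambda>v. (\<theta> v - c) ^ k *\<^sub>C h v)"
  by (intro analytic_in_scale holomorphic_intros \<theta>_holomorphic U)

definition to_disc_fun :: "(complex \<Rightarrow> 'a) \<Rightarrow> complex \<Rightarrow> 'a" where
  "to_disc_fun f = zero_off unit_disc (f \<circ> \<psi>)"

lemma to_disc_fun_analytic:
  assumes "analytic_in U f"
  shows "to_disc_fun f \<in> analytic_functions unit_disc"
proof -
  have "analytic_in unit_disc (\<lambda>w. f (\<psi> w))"
    by (rule analytic_in_compose[OF assms \<psi>_holomorphic]) (simp_all add: \<psi>_image)
  then have "analytic_in unit_disc (to_disc_fun f)"
    by (rule analytic_in_transform) (auto simp: to_disc_fun_def zero_off_def)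
  then show ?thesis by (simp add: analytic_functions_iff to_disc_fun_def zero_off_def)
qed

lemma disc_space_eq:
  "carr (disc_space U \<psi> F) = to_disc_fun ` carr F"
  "f \<in> carr F \<Longrightarrow> vnorm (disc_space U \<psi> F) (to_disc_fun f) = vnorm F f"
proof -
  show "carr (disc_space U \<psi> F) = to_disc_fun ` carr F"
    by (auto simp: disc_space_def to_disc_fun_def)
  assume f: "f \<in> carr F"
  have "zero_off U (to_disc_fun f \<circ> \<theta>) = f"
    using F_zero_off[OF f] \<theta>_in \<psi>_\<theta> by (auto simp: zero_off_def to_disc_fun_def fun_eq_iff)
  then show "vnorm (disc_space U \<psi> F) (to_disc_fun f) = vnorm F f"
    by (simp add: disc_space_def flip: \<theta>_def)
qed

text \<open>Multiplication by L(u) turns a jet at u = \<psi>(w) into the jet at w of the composition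
  with \<psi>; composition turns \<theta> v - \<theta> u into \<omega> - w, and powers of the latter
  shift Taylor coefficients.\<close>

lemma to_disc_jet_tuple:
  assumes f: "\<And>j. j < m \<Longrightarrow> f j \<in> carr F"
  shows "to_disc m \<psi> (jet_tuple m f) = tower_tuple m (\<lambda>j. to_disc_fun (f j))"
proof (intro ext)
  fix i w
  let ?g = "\<lambda>j. to_disc_fun (f j)"
  show "to_disc m \<psi> (jet_tuple m f) i w = tower_tuple m ?g i w"
  proof (cases "w \<in> unit_disc")
    case False
    then show ?thesis by (simp add: to_disc_def tower_tuple_def zero_off_def)
  next
    case w: True
    note chain = chain_matrix_eq[OF \<psi>_holomorphic open_ball w deriv_\<psi>[OF w]]
    show ?thesis
    proof (cases "i < m")
      case False
      then show ?thesis by (simp add: to_disc_def tower_tuple_def zero_off_def chain)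
    next
      case i: True
      \<comment> \<open>The base point is frozen: \<open>h\<close> depends on w, but the jet is
        taken in v only.\<close>
      define h where "h v = (\<Sum>j<m. (\<theta> v - \<theta> (\<psi> w)) ^ j *\<^sub>C f j v)" for v
      have h: "analytic_in U h"
        unfolding h_def using f by (intro analytic_in_sum analytic_in_power F_analytic_in) auto
      have g: "analytic_in unit_disc (?g j)" if "j < m" for j
        using to_disc_fun_analytic[OF F_analytic_in[OF f[OF that]]] by (simp add: analytic_functions_iff)
      have wg: "analytic_in unit_disc (\<lambda>\<omega>. (\<omega> - w) ^ j *\<^sub>C ?g j \<omega>)" if "j < m" for j
        using g[OF that] by (intro analytic_in_scale holomorphic_intros) auto
      have "to_disc m \<psi> (jet_tuple m f) i w =
          (\<Sum>k<m. chain_matrix m \<psi> w i k *\<^sub>C taylor k h (\<psi> w))"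
        using w \<psi>_in[OF w] by (simp add: to_disc_def jet_tuple_def zero_off_def h_def[abs_def])
      also have "\<dots> = taylor i (\<lambda>\<omega>. h (\<psi> \<omega>)) w"
        using taylor_compose[OF \<psi>_holomorphic open_ball w deriv_\<psi>[OF w] h U _ i] \<psi>_image by simp
      also have "\<dots> = taylor i (\<lambda>\<omega>. \<Sum>j<m. (\<omega> - w) ^ j *\<^sub>C ?g j \<omega>) w"
      proof (rule taylor_cong[OF open_ball w])
        show "analytic_in unit_disc (\<lambda>\<omega>. h (\<psi> \<omega>))"
          by (rule analytic_in_compose[OF h \<psi>_holomorphic]) (simp_all add: \<psi>_image)
        show "h (\<psi> \<omega>) = (\<Sum>j<m. (\<omega> - w) ^ j *\<^sub>C ?g j \<omega>)" if "\<omega> \<in> unit_disc" for \<omega>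
          using that w by (simp add: h_def \<theta>_\<psi> to_disc_fun_def zero_off_def)
      qed
      also have "\<dots> = (\<Sum>j<m. taylor i (\<lambda>\<omega>. (\<omega> - w) ^ j *\<^sub>C ?g j \<omega>) w)"
        using wg w by (intro taylor_sum) auto
      also have "\<dots> = (\<Sum>j<m. if j \<le> i then taylor (i - j) (?g j) w else 0)"
      proof (rule sum.cong)
        fix j assume "j \<in> {..<m}"
        then have j: "j < m" by simp
        have hol: "(\<lambda>\<omega>. (\<omega> - w) ^ j) holomorphic_on unit_disc" by (intro holomorphic_intros)
        have "taylor i (\<lambda>\<omega>. (\<omega> - w) ^ j *\<^sub>C ?g j \<omega>) w =
            (\<Sum>a=0..i. if a = j then taylor (i - j) (?g j) w else 0)"
          unfolding taylor_scale_fun[OF hol g[OF j] open_ball w] ctaylor_diff_power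
          by (rule sum.cong) auto
        then show "taylor i (\<lambda>\<omega>. (\<omega> - w) ^ j *\<^sub>C ?g j \<omega>) w =
            (if j \<le> i then taylor (i - j) (?g j) w else 0)"
          by simp
      qed simp
      also have "\<dots> = (\<Sum>j\<le>i. taylor (i - j) (?g j) w)"
        using i by (intro sum.mono_neutral_cong_right) auto
      also have "\<dots> = tower_tuple m ?g i w"
        using i w by (simp add: tower_tuple_def zero_off_def)
      finally show ?thesis .
    qed
  qed
qed

text \<open>Forward substitution in a triangular system whose diagonal entries, the powers of
  \<psi>'(w), do not vanish.\<close>

lemma to_disc_inj:
  assumes T: "to_disc m \<psi> T = to_disc m \<psi> T'" and u: "u \<in> U" and "k < m"
  shows "T k u = T' k u"
  using \<open>k < m\<close>
proof (induction k rule: less_induct)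
  case (less i)
  let ?w = "\<theta> u"
  let ?L = "chain_matrix m \<psi> ?w i"
  have w: "?w \<in> unit_disc" by (rule \<theta>_in[OF u])
  note chain = chain_matrix_eq[OF \<psi>_holomorphic open_ball w deriv_\<psi>[OF w]]
  have "deriv \<psi> ?w ^ i \<noteq> 0" using deriv_\<psi>[OF w] by simp
  then have diag: "?L i \<noteq> 0"
    using less.prems startsby_zero_power_nth_same[of "increment_fps \<psi> ?w" i]
    by (simp add: chain increment_fps_0) (simp add: increment_fps_def ctaylor_1)
  have "(\<Sum>k<m. ?L k *\<^sub>C T k u) = (\<Sum>k<m. ?L k *\<^sub>C T' k u)"
    using fun_cong[OF fun_cong[OF T, of i], of ?w] w by (simp add: to_disc_def zero_off_def \<psi>_\<theta>[OF u])
  moreover have "(\<Sum>k\<in>{..<m} - {i}. ?L k *\<^sub>C T k u) = (\<Sum>k\<in>{..<m} - {i}. ?L k *\<^sub>C T' k u)"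
  proof (rule sum.cong)
    fix k assume "k \<in> {..<m} - {i}"
    then show "?L k *\<^sub>C T k u = ?L k *\<^sub>C T' k u"
      using less.IH[of k] by (cases "k < i") (auto simp: chain)
  qed simp
  ultimately have "?L i *\<^sub>C T i u = ?L i *\<^sub>C T' i u"
    using less.prems by (simp add: sum.remove[of "{..<m}" i])
  then show ?case using diag by (simp add: scaleC.scale_cancel_left)
qed

text \<open>Injectivity of \<open>to_disc\<close> carries the description of the tower over to \<T>:
  tuples of m functions of F parametrise it, with the sum of their norms as norm.\<close>

lemma T_space_eq:
  "carr (T_space U \<psi> F m) = {jet_tuple m f | f. \<forall>j<m. f j \<in> carr F}"
  "(\<And>j. j < m \<Longrightarrow> f j \<in> carr F) \<Longrightarrow>
    vnorm (T_space U \<psi> F m) (jet_tuple m f) = (\<Sum>j<m. vnorm F (f j))"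
proof -
  let ?G = "disc_space U \<psi> F"
  have G: "carr ?G \<subseteq> analytic_functions unit_disc"
    using to_disc_fun_analytic F_analytic_in by (auto simp: disc_space_eq)
  show "carr (T_space U \<psi> F m) = {jet_tuple m f | f. \<forall>j<m. f j \<in> carr F}"
  proof (intro set_eqI iffI)
    fix T assume "T \<in> carr (T_space U \<psi> F m)"
    then have T: "\<And>i. i \<ge> m \<Longrightarrow> T i = 0" "\<And>i u. u \<notin> U \<Longrightarrow> T i u = 0"
      "to_disc m \<psi> T \<in> carr (tower ?G m)"
      by (auto simp: T_space_def)
    obtain g where g: "to_disc m \<psi> T = tower_tuple m g" "\<forall>j<m. g j \<in> to_disc_fun ` carr F"
      using T(3) unfolding tower_eq(1)[OF G] disc_space_eq by blast
    then obtain f where f: "\<And>j. j < m \<Longrightarrow> f j \<in> carr F" "\<And>j. j < m \<Longrightarrow> g j = to_disc_fun (f j)"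
      unfolding image_iff by metis
    have "tower_tuple m g = tower_tuple m (\<lambda>j. to_disc_fun (f j))"
      using f(2) by (intro ext) (auto simp: tower_tuple_def zero_off_def intro!: sum.cong)
    then have "to_disc m \<psi> T = to_disc m \<psi> (jet_tuple m f)"
      using g(1) to_disc_jet_tuple[of m f] f(1) by simp
    then have "T i u = jet_tuple m f i u" for i u
      using to_disc_inj[of m T _ u i] T(1)[of i] T(2)[of u i]
      by (cases "u \<in> U \<and> i < m") (auto simp: jet_tuple_def zero_off_def)
    then show "T \<in> {jet_tuple m f | f. \<forall>j<m. f j \<in> carr F}"
      using f(1) by blast
  next
    fix T assume "T \<in> {jet_tuple m f | f. \<forall>j<m. f j \<in> carr F}"
    then obtain f where f: "T = jet_tuple m f" "\<And>j. j < m \<Longrightarrow> f j \<in> carr F" by blast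
    have "to_disc m \<psi> T \<in> carr (tower ?G m)"
      unfolding tower_eq(1)[OF G] f(1) disc_space_eq
      using to_disc_jet_tuple[of m f, OF f(2)] f(2)
      by (intro CollectI exI[of _ "\<lambda>j. to_disc_fun (f j)"]) auto
    moreover have "T i = 0" if "i \<ge> m" for i
      using that by (auto simp: f(1) jet_tuple_def zero_off_def fun_eq_iff)
    ultimately show "T \<in> carr (T_space U \<psi> F m)"
      by (simp add: T_space_def) (simp add: f(1) jet_tuple_def zero_off_def)
  qed
  assume f: "\<And>j. j < m \<Longrightarrow> f j \<in> carr F"
  then show "vnorm (T_space U \<psi> F m) (jet_tuple m f) = (\<Sum>j<m. vnorm F (f j))"
    using tower_eq(2)[OF G, of m "\<lambda>j. to_disc_fun (f j)"] to_disc_jet_tuple[of m f]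
    by (simp add: T_space_def disc_space_eq)
qed

lemma jet_tuple_add:
  assumes f: "\<And>j. j < m \<Longrightarrow> f j \<in> carr F" and g: "\<And>j. j < m \<Longrightarrow> g j \<in> carr F"
  shows "jet_tuple m f + jet_tuple m g = jet_tuple m (\<lambda>j. f j + g j)"
proof (intro ext)
  fix i u
  let ?h = "\<lambda>f v. \<Sum>j<m. (\<theta> v - \<theta> u) ^ j *\<^sub>C f j v"
  have an: "analytic_in U (?h f)" if "\<And>j. j < m \<Longrightarrow> f j \<in> carr F" for f
    using that by (intro analytic_in_sum analytic_in_power F_analytic_in) auto
  have "?h (\<lambda>j. f j + g j) = (\<lambda>v. ?h f v + ?h g v)"
    by (simp add: scaleC_add_right sum.distrib)
  then show "(jet_tuple m f + jet_tuple m g) i u = jet_tuple m (\<lambda>j. f j + g j) i u"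
    using taylor_add[OF an[of f] an[of g] U, of u i] f g by (simp add: jet_tuple_def zero_off_def)
qed

lemma jet_tuple_scale:
  assumes f: "\<And>j. j < m \<Longrightarrow> f j \<in> carr F"
  shows "c *\<^sub>C jet_tuple m f = jet_tuple m (\<lambda>j. c *\<^sub>C f j)"
proof (intro ext)
  fix i u
  let ?h = "\<lambda>f v. \<Sum>j<m. (\<theta> v - \<theta> u) ^ j *\<^sub>C f j v"
  have an: "analytic_in U (?h f)"
    using f by (intro analytic_in_sum analytic_in_power F_analytic_in) auto
  have "?h (\<lambda>j. c *\<^sub>C f j) = (\<lambda>v. c *\<^sub>C ?h f v)"
    by (simp add: scaleC.scale_sum_right mult.commute)
  then show "(c *\<^sub>C jet_tuple m f) i u = jet_tuple m (\<lambda>j. c *\<^sub>C f j) i u"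
    using taylor_cmult[OF an U, of u i c] by (simp add: jet_tuple_def zero_off_def)
qed

lemma seminormed_T_space: "seminormed (T_space U \<psi> F m)"
proof -
  let ?T = "T_space U \<psi> F m"
  note carr = T_space_eq(1)[of m] and norm = T_space_eq(2)[of m]
  have ops: "vadd ?T = (+)" "vscale ?T = (*\<^sub>C)" by (simp_all add: T_space_def)
  have add: "jet_tuple m f + jet_tuple m g \<in> carr ?T"
    "vnorm ?T (jet_tuple m f + jet_tuple m g) \<le> vnorm ?T (jet_tuple m f) + vnorm ?T (jet_tuple m g)"
    if "\<forall>j<m. f j \<in> carr F" "\<forall>j<m. g j \<in> carr F" for f g
  proof -
    have fg: "\<forall>j<m. f j + g j \<in> carr F" using that seminormedD(4)[OF F] by blast
    then show "jet_tuple m f + jet_tuple m g \<in> carr ?T"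
      unfolding carr using jet_tuple_add[of m f g] that by blast
    have "(\<Sum>j<m. vnorm F (f j + g j)) \<le> (\<Sum>j<m. vnorm F (f j) + vnorm F (g j))"
      using that by (intro sum_mono seminormedD(8)[OF F]) auto
    then show "vnorm ?T (jet_tuple m f + jet_tuple m g) \<le> vnorm ?T (jet_tuple m f) + vnorm ?T (jet_tuple m g)"
      using that fg jet_tuple_add[of m f g] norm[of f] norm[of g] norm[of "\<lambda>j. f j + g j"]
      by (simp add: sum.distrib)
  qed
  have scale: "c *\<^sub>C jet_tuple m f \<in> carr ?T"
    "vnorm ?T (c *\<^sub>C jet_tuple m f) = cmod c * vnorm ?T (jet_tuple m f)"
    if "\<forall>j<m. f j \<in> carr F" for f c
  proof -
    have cf: "\<forall>j<m. c *\<^sub>C f j \<in> carr F" using that seminormedD(5)[OF F] by blast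
    then show "c *\<^sub>C jet_tuple m f \<in> carr ?T"
      unfolding carr using jet_tuple_scale[of m f c] that by blast
    show "vnorm ?T (c *\<^sub>C jet_tuple m f) = cmod c * vnorm ?T (jet_tuple m f)"
      using that cf jet_tuple_scale[of m f c] norm[of f] norm[of "\<lambda>j. c *\<^sub>C f j"] seminormedD(7)[OF F]
      by (simp add: sum_distrib_left)
  qed
  have "0 *\<^sub>C jet_tuple m (\<lambda>j. 0) \<in> carr ?T"
    using seminormedD(3)[OF F] by (intro scale) auto
  then have "0 \<in> carr ?T" by simp
  moreover have nonneg: "0 \<le> vnorm ?T (jet_tuple m f)" if "\<forall>j<m. f j \<in> carr F" for f
    using that norm[of f] seminormedD(6)[OF F] by (auto intro: sum_nonneg)
  ultimately show ?thesis
    unfolding seminormed_def ops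
  proof (intro conjI ballI allI)
    fix x y c assume "x \<in> carr ?T" "y \<in> carr ?T"
    then obtain f g where fg: "\<forall>j<m. f j \<in> carr F" "x = jet_tuple m f"
        "\<forall>j<m. g j \<in> carr F" "y = jet_tuple m g"
      unfolding carr by blast
    show "x + y \<in> carr ?T" "vnorm ?T (x + y) \<le> vnorm ?T x + vnorm ?T y"
      using add[OF fg(1,3)] fg(2,4) by simp_all
  next
    fix x c assume "x \<in> carr ?T"
    then obtain f where f: "\<forall>j<m. f j \<in> carr F" "x = jet_tuple m f" unfolding carr by blast
    show "c *\<^sub>C x \<in> carr ?T" "vnorm ?T (c *\<^sub>C x) = cmod c * vnorm ?T x" "0 \<le> vnorm ?T x"
      using scale[OF f(1)] nonneg[OF f(1)] f(2) by simp_all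
  qed simp_all
qed

end

section \<open>Division and definiteness of the quotient norms\<close>

text \<open>Removable singularity. Under each functional this is the scalar theorem; the local bound
  at \<open>z\<close>, needed to return to vector values, is differentiability there.\<close>

lemma analytic_in_difference_quotient:
  fixes f :: "complex \<Rightarrow> 'a :: complex_banach"
  assumes S: "open S" and z: "z \<in> S" and f: "analytic_in S f" and fz: "f z = 0"
  shows "analytic_in S (\<lambda>v. if v = z then cderiv f z else inverse (v - z) *\<^sub>C f v)"
    (is "analytic_in S ?q")
proof (rule weakly_holomorphic_imp_analytic_in[OF S])
  fix a assume a: "a \<in> S"
  show "\<exists>r>0. \<exists>B. \<forall>w\<in>ball a r. norm (?q w) \<le> B"
  proof (cases "a = z")
    case True
    have "\<exists>d>0. \<forall>y. norm (y - z) < d \<longrightarrow> norm (f y - f z - (y - z) *\<^sub>C cderiv f z) \<le> 1 * norm (y - z)"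
      using analytic_in_cderiv[OF f z] unfolding has_derivative_at_alt by (meson zero_less_one)
    then obtain d where d: "d > 0"
      "\<And>y. norm (y - z) < d \<Longrightarrow> norm (f y - (y - z) *\<^sub>C cderiv f z) \<le> norm (y - z)"
      by (auto simp: fz)
    have "norm (?q y) \<le> 1 + norm (cderiv f z)" if y: "y \<in> ball z d" for y
    proof (cases "y = z")
      case False
      have "norm (f y - (y - z) *\<^sub>C cderiv f z) \<le> norm (y - z)"
        using y d(2)[of y] by (simp add: dist_norm norm_minus_commute)
      then have "norm (f y) \<le> norm (y - z) + norm ((y - z) *\<^sub>C cderiv f z)"
        using norm_triangle_ineq2[of "f y" "(y - z) *\<^sub>C cderiv f z"] by linarith
      also have "\<dots> = (1 + norm (cderiv f z)) * norm (y - z)"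
        by (simp add: norm_scaleC distrib_right)
      finally have "norm (f y) / norm (y - z) \<le> 1 + norm (cderiv f z)"
        using False by (simp add: pos_divide_le_eq)
      then show ?thesis
        using False by (simp add: norm_scaleC norm_inverse divide_inverse mult.commute)
    qed simp
    then show ?thesis using d(1) True by blast
  next
    case False
    have "analytic_in (S - {z}) (\<lambda>v. inverse (v - z) *\<^sub>C f v)"
      using S f by (intro analytic_in_scale holomorphic_intros analytic_in_subset[OF f]) auto
    then have "analytic_in (S - {z}) ?q"
      by (rule analytic_in_transform) (use S in auto)
    then have "isCont ?q a" by (rule analytic_in_isCont) (use a False in simp)
    then show ?thesis by (rule locally_bounded_of_isCont)
  qed
next
  fix l :: "'a \<Rightarrow> complex" assume l: "cfunctional l"
  show "(\<lambda>w. l (?q w)) holomorphic_on S"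
    by (rule pole_theorem_open_0[OF analytic_in_functional[OF l f] S, of z])
      (auto simp: cfunctional_scale[OF l] functional_cderiv[OF l f z] fz cfunctional_0[OF l])
qed

text \<open>Write \<phi>(v) = (v - z) p(v) with p free of zeros; then f / \<phi> is the difference
  quotient of \<open>f\<close> divided by p.\<close>

lemma analytic_in_divide:
  fixes f :: "complex \<Rightarrow> 'a :: complex_banach"
  assumes S: "open S" and z: "z \<in> S" and f: "analytic_in S f" and fz: "f z = 0"
    and \<phi>: "\<phi> holomorphic_on S" "\<phi> z = 0" "deriv \<phi> z \<noteq> 0" "\<And>v. v \<in> S \<Longrightarrow> v \<noteq> z \<Longrightarrow> \<phi> v \<noteq> 0"
  obtains g where "analytic_in S g" "\<And>v. v \<in> S \<Longrightarrow> f v = \<phi> v *\<^sub>C g v"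
proof -
  define p where "p v = (if v = z then deriv \<phi> z else \<phi> v / (v - z))" for v
  define q where "q v = (if v = z then cderiv f z else inverse (v - z) *\<^sub>C f v)" for v
  have "p holomorphic_on S"
    by (rule pole_theorem_open_0[OF \<phi>(1) S, of z]) (auto simp: p_def \<phi>)
  moreover have p0: "p v \<noteq> 0" if "v \<in> S" for v using that \<phi> by (simp add: p_def)
  ultimately have "(\<lambda>v. inverse (p v)) holomorphic_on S" by (intro holomorphic_intros) auto
  moreover have "analytic_in S q"
    unfolding q_def using S z f fz by (rule analytic_in_difference_quotient)
  ultimately have "analytic_in S (\<lambda>v. inverse (p v) *\<^sub>C q v)"
    using S by (intro analytic_in_scale)
  moreover have "f v = \<phi> v *\<^sub>C inverse (p v) *\<^sub>C q v" if v: "v \<in> S" for v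
    using \<phi>(2,4) v by (cases "v = z") (simp_all add: fz p_def q_def)
  ultimately show thesis by (rule that)
qed

text \<open>A factor with a simple zero raises the order of vanishing by exactly one: coefficient i
  + 1 of the product is \<phi>'(z) times coefficient i of \<open>d\<close>, up to terms that vanish
  by induction or by \<phi>(z) = 0.\<close>

lemma jet_zero_of_multiple:
  assumes S: "open S" and z: "z \<in> S" and \<phi>: "\<phi> holomorphic_on S" "\<phi> z = 0" "deriv \<phi> z \<noteq> 0"
    and d: "analytic_in S d" and jet: "\<And>i. i \<le> n \<Longrightarrow> taylor i (\<lambda>v. \<phi> v *\<^sub>C d v) z = 0"
    and i: "i < n"
  shows "taylor i d z = 0"
  using i
proof (induction i rule: less_induct)
  case (less i)
  have "0 = (\<Sum>a=0..Suc i. ctaylor a \<phi> z *\<^sub>C taylor (Suc i - a) d z)"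
    using jet[of "Suc i"] less.prems taylor_scale_fun[OF \<phi>(1) d S z, of "Suc i"] by simp
  also have "\<dots> = (\<Sum>a\<in>{1}. ctaylor a \<phi> z *\<^sub>C taylor (Suc i - a) d z)"
  proof (rule sum.mono_neutral_right)
    show "\<forall>a\<in>{0..Suc i} - {1}. ctaylor a \<phi> z *\<^sub>C taylor (Suc i - a) d z = 0"
    proof
      fix a assume "a \<in> {0..Suc i} - {1}"
      then have "a = 0 \<or> Suc i - a < i" by auto
      then show "ctaylor a \<phi> z *\<^sub>C taylor (Suc i - a) d z = 0"
        using less.IH[of "Suc i - a"] less.prems \<phi>(2) by (auto simp: ctaylor_0)
    qed
  qed auto
  finally show ?case using \<phi>(3) by (simp add: ctaylor_1)
qed

context acceptable_disc
begin

text \<open>Continuity at 0 is turned into a norm bound by rescaling to norm r/2, strictly inside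
  the ball of radius r; this gives 2/r.\<close>

lemma evaluation_bound:
  assumes u: "u \<in> U"
  obtains C where "C > 0" "\<And>f. f \<in> carr F \<Longrightarrow> norm (f u) \<le> C * vnorm F f"
proof -
  interpret Metric_space "carr F" "ndist F"
    using Metric_space_ndist[OF F F_definite] .
  have cont: "continuous_map mtopology euclidean (\<lambda>f. f u)"
    using acceptable u by (auto simp: acceptable_space_def ntopology_def)
  have "openin mtopology {f \<in> topspace mtopology. f u \<in> ball 0 1}"
    by (rule openin_continuous_map_preimage[OF cont]) simp
  moreover have "0 \<in> {f \<in> topspace mtopology. f u \<in> ball 0 1}"
    using seminormedD(3)[OF F] by simp
  ultimately obtain r where r: "r > 0" "mball 0 r \<subseteq> {f \<in> topspace mtopology. f u \<in> ball 0 1}"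
    unfolding openin_mtopology by blast
  have small: "norm (f u) < 1" if f: "f \<in> carr F" "vnorm F f < r" for f
  proof -
    have "f \<in> mball 0 r"
      using f seminormedD(3)[OF F] by (simp add: seminormed_ndist[OF F] seminormed_norm_minus[OF F])
    then show ?thesis using r(2) by auto
  qed
  have "norm (f u) \<le> 2 / r * vnorm F f" if f: "f \<in> carr F" for f
  proof (cases "vnorm F f = 0")
    case True
    then show ?thesis using F_definite[OF f] by simp
  next
    case False
    then have N: "vnorm F f > 0" using seminormedD(6)[OF F f] by simp
    define c where "c = complex_of_real (r / 2 / vnorm F f)"
    have c: "cmod c = r / 2 / vnorm F f" using r(1) N by (simp add: c_def norm_divide norm_mult)
    have "norm ((c *\<^sub>C f) u) < 1"
      using N r(1) small[OF seminormedD(5)[OF F f, of c]] by (simp add: seminormedD(7)[OF F f] c)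
    then show ?thesis using N r(1) by (simp add: norm_scaleC c field_simps)
  qed
  then show thesis using r(1) by (intro that[of "2 / r"]) auto
qed

text \<open>An automorphism of the disc moving \<theta>(z) to 0 yields a conformal map with its only
  zero at \<open>z\<close>, and it is simple. The quotient is analytic, so the equivalence in
  condition (c) puts it into F and the estimate there bounds it.\<close>

lemma division:
  assumes z: "z \<in> U"
  shows "\<exists>\<phi> K. \<phi> holomorphic_on U \<and> \<phi> z = 0 \<and> deriv \<phi> z \<noteq> 0 \<and> K > 0 \<and>
    (\<forall>f\<in>carr F. f z = 0 \<longrightarrow>
      (\<exists>g\<in>carr F. f = (\<lambda>v. \<phi> v *\<^sub>C g v) \<and> vnorm F g \<le> K * vnorm F f))"
proof -
  obtain h k where h: "h (\<theta> z) = 0" "h holomorphic_on unit_disc" "h ` unit_disc \<subseteq> unit_disc"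
      "k ` unit_disc \<subseteq> unit_disc" "\<And>w. w \<in> unit_disc \<Longrightarrow> h (k w) = w" "\<And>w. w \<in> unit_disc \<Longrightarrow> k (h w) = w"
    using ball_biholomorphism_exists[OF \<theta>_in[OF z]] by metis
  define \<phi> where "\<phi> = h \<circ> \<theta>"
  have "bij_betw h unit_disc unit_disc"
    using h by (intro bij_betw_byWitness[where f'=k]) auto
  then have bij: "bij_betw \<phi> U unit_disc" unfolding \<phi>_def by (rule bij_betw_trans[OF \<theta>_bij])
  have hol: "\<phi> holomorphic_on U"
    unfolding \<phi>_def using \<theta>_holomorphic h(2) \<theta>_in by (auto intro: holomorphic_on_compose_gen)
  have conf: "conformal_equivalence \<phi> U unit_disc" by (simp add: conformal_equivalence_def bij hol)
  have \<phi>z: "\<phi> z = 0" by (simp add: \<phi>_def h(1))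
  have inj: "inj_on \<phi> U" using bij by (simp add: bij_betw_def)
  have d: "deriv \<phi> z \<noteq> 0" using holomorphic_injective_imp_regular[OF hol U inj z] .
  have nz: "\<phi> v \<noteq> 0" if "v \<in> U" "v \<noteq> z" for v using inj_onD[OF inj] \<phi>z that z by metis
  obtain K where K: "K > 0" "\<And>g. g \<in> analytic_functions U \<Longrightarrow>
      ((\<lambda>v. \<phi> v *\<^sub>C g v) \<in> carr F \<longleftrightarrow> g \<in> carr F) \<and>
      (g \<in> carr F \<longrightarrow> vnorm F g \<le> K * vnorm F (\<lambda>v. \<phi> v *\<^sub>C g v))"
    using acceptable conf unfolding acceptable_space_def by meson
  have "\<exists>g\<in>carr F. f = (\<lambda>v. \<phi> v *\<^sub>C g v) \<and> vnorm F g \<le> K * vnorm F f" if f: "f \<in> carr F" "f z = 0" for f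
  proof -
    obtain g where g: "analytic_in U g" "\<And>v. v \<in> U \<Longrightarrow> f v = \<phi> v *\<^sub>C g v"
      using analytic_in_divide[OF U z F_analytic_in[OF f(1)] f(2) hol \<phi>z d nz] by blast
    let ?g = "zero_off U g"
    have "analytic_in U ?g" using g(1) U by (rule analytic_in_transform) (simp add: zero_off_def)
    then have an: "?g \<in> analytic_functions U" by (simp add: analytic_functions_iff zero_off_def)
    have eq: "f = (\<lambda>v. \<phi> v *\<^sub>C ?g v)"
      using g(2) F_zero_off[OF f(1)] by (auto simp: zero_off_def)
    then show ?thesis using K(2)[OF an] f(1) by auto
  qed
  then show ?thesis using hol \<phi>z d K(1) by (intro exI[of _ \<phi>] exI[of _ K]) simp
qed

text \<open>The Taylor coefficients are not obviously continuous on \<open>F\<close>. Along functions with a fixed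
  nonzero jet, dividing by a conformal map vanishing at \<open>z\<close> reduces the claim to the
  evaluation at \<open>z\<close>.\<close>

lemma jet_lower_bound:
  assumes z: "z \<in> U" and "f1 \<in> carr F" and "\<exists>i<n. taylor i f1 z \<noteq> 0"
  shows "\<exists>\<delta>>0. \<forall>f\<in>carr F. (\<forall>i<n. taylor i f z = taylor i f1 z) \<longrightarrow> \<delta> \<le> vnorm F f"
  using assms(2,3)
proof (induction n arbitrary: f1)
  case (Suc n)
  show ?case
  proof (cases "f1 z = 0")
    case False
    obtain C where C: "C > 0" "\<And>f. f \<in> carr F \<Longrightarrow> norm (f z) \<le> C * vnorm F f"
      using evaluation_bound[OF z] by blast
    have "norm (f1 z) / C \<le> vnorm F f" if "f \<in> carr F" "\<forall>i<Suc n. taylor i f z = taylor i f1 z" for f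
    proof -
      have "taylor 0 f z = taylor 0 f1 z" using that(2) by blast
      then show ?thesis using C(2)[OF that(1)] C(1) by (simp add: field_simps)
    qed
    then show ?thesis using False C(1) by (intro exI[of _ "norm (f1 z) / C"]) auto
  next
    case f1z: True
    obtain \<phi> K where \<phi>: "\<phi> holomorphic_on U" "\<phi> z = 0" "deriv \<phi> z \<noteq> 0" and K: "K > 0"
      "\<And>f. f \<in> carr F \<Longrightarrow> f z = 0 \<Longrightarrow>
        \<exists>g\<in>carr F. f = (\<lambda>v. \<phi> v *\<^sub>C g v) \<and> vnorm F g \<le> K * vnorm F f"
      using division[OF z] by blast
    obtain g1 where g1: "g1 \<in> carr F" "f1 = (\<lambda>v. \<phi> v *\<^sub>C g1 v)"
      using K(2)[OF Suc.prems(1) f1z] by blast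
    have "\<exists>i<n. taylor i g1 z \<noteq> 0"
    proof (rule ccontr)
      assume "\<not> (\<exists>i<n. taylor i g1 z \<noteq> 0)"
      then have "ctaylor a \<phi> z *\<^sub>C taylor (i - a) g1 z = 0" if "i < Suc n" "a \<le> i" for a i
        using that \<phi>(2) by (cases "a = 0") (auto simp: ctaylor_0)
      then have "taylor i f1 z = 0" if "i < Suc n" for i
        unfolding g1(2) taylor_scale_fun[OF \<phi>(1) F_analytic_in[OF g1(1)] U z]
        using that by (intro sum.neutral ballI) simp
      then show False using Suc.prems(2) by blast
    qed
    then obtain \<delta> where \<delta>: "\<delta> > 0"
      "\<And>g. g \<in> carr F \<Longrightarrow> (\<forall>i<n. taylor i g z = taylor i g1 z) \<Longrightarrow> \<delta> \<le> vnorm F g"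
      using Suc.IH[OF g1(1)] by blast
    have "\<delta> / K \<le> vnorm F f" if f: "f \<in> carr F" "\<forall>i<Suc n. taylor i f z = taylor i f1 z" for f
    proof -
      have "taylor 0 f z = taylor 0 f1 z" using f(2) by blast
      then obtain g where g: "g \<in> carr F" "f = (\<lambda>v. \<phi> v *\<^sub>C g v)" "vnorm F g \<le> K * vnorm F f"
        using K(2)[OF f(1)] f1z by auto
      have an: "analytic_in U g" "analytic_in U g1" using F_analytic_in g(1) g1(1) by auto
      \<comment> \<open>The two functions have the same jet of length n + 1, so \<phi> (g - g1)
        vanishes to that order and g - g1 to one order less. Hence \<open>g\<close> falls under the
        induction hypothesis for \<open>g1\<close>.\<close>
      have "(\<lambda>v. f v - f1 v) = (\<lambda>v. \<phi> v *\<^sub>C (g - g1) v)"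
        by (simp add: g(2) g1(2) scaleC.scale_right_diff_distrib)
      then have jet: "taylor i (\<lambda>v. \<phi> v *\<^sub>C (g - g1) v) z = 0" if "i \<le> n" for i
        using that f(2) taylor_diff[OF F_analytic_in[OF f(1)] F_analytic_in[OF Suc.prems(1)] U z, of i]
        by simp
      have "taylor i g z = taylor i g1 z" if "i < n" for i
        using jet_zero_of_multiple[OF U z \<phi> F_analytic_in[OF seminormed_diff[OF F g(1) g1(1)]] jet that]
          taylor_diff[OF an U z, of i] by (simp add: fun_diff_def)
      then show ?thesis using \<delta>(2)[OF g(1)] g(3) K(1) by (simp add: field_simps)
    qed
    then show ?thesis using \<delta>(1) K(1) by (intro exI[of _ "\<delta> / K"]) auto
  qed
qed simp

lemma tau_add:
  assumes "analytic_in U f" "analytic_in U g" "z \<in> U"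
  shows "tau n (f + g) z = tau n f z + tau n g z"
  using taylor_add[OF assms(1,2) U assms(3)] by (simp add: tau_def fun_eq_iff plus_fun_def)

lemma tau_scale:
  assumes "analytic_in U f" "z \<in> U"
  shows "tau n (c *\<^sub>C f) z = c *\<^sub>C tau n f z"
  using taylor_cmult[OF assms(1) U assms(2)] by (simp add: tau_def fun_eq_iff scaleC_fun_def)

lemma seminormed_Rochberg: "z \<in> U \<Longrightarrow> seminormed (Rochberg F n z)"
  unfolding Rochberg_def
  by (intro seminormed_range_space F tau_add tau_scale F_analytic_in)

lemma carr_Rochberg: "carr (Rochberg F n z) = (\<lambda>f. tau n f z) ` carr F"
  by (simp add: Rochberg_def carr_range_space)

lemma Rochberg_definite:
  assumes z: "z \<in> U" and x: "x \<in> carr (Rochberg F n z)" and "vnorm (Rochberg F n z) x = 0"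
  shows "x = 0"
proof (rule ccontr)
  assume nz: "x \<noteq> 0"
  obtain f1 where f1: "f1 \<in> carr F" "x = tau n f1 z" using x by (auto simp: carr_Rochberg)
  then have "\<exists>i<n. taylor i f1 z \<noteq> 0" using nz by (auto simp: tau_def fun_eq_iff split: if_splits)
  then obtain \<delta> where \<delta>: "\<delta> > 0"
    "\<And>f. f \<in> carr F \<Longrightarrow> (\<forall>i<n. taylor i f z = taylor i f1 z) \<Longrightarrow> \<delta> \<le> vnorm F f"
    using jet_lower_bound[OF z f1(1)] by blast
  have "\<delta> \<le> vnorm (Rochberg F n z) x"
    unfolding Rochberg_def
  proof (rule range_space_norm_ge)
    show "x \<in> carr (range_space F (\<lambda>f. tau n f z))" using x by (simp add: Rochberg_def)
    fix f assume f: "f \<in> carr F" "tau n f z = x"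
    have "taylor i f z = taylor i f1 z" if "i < n" for i
      using fun_cong[OF f(2), of i] that by (simp add: f1(2) tau_def)
    then show "\<delta> \<le> vnorm F f" using \<delta>(2)[OF f(1)] by blast
  qed
  then show False using assms(3) \<delta>(1) by simp
qed

end

section \<open>The matrices of a tuple\<close>

text \<open>The matrix of a pair (h, k) as in the overview, \<open>x\<close> and \<open>k\<close>
  being the sequences of Taylor coefficients at z. Zero in the second place gives the matrix of
  \<open>E\<close>.\<close>

definition jet_matrix :: "nat \<Rightarrow> (nat \<Rightarrow> 'a :: complex_vector) \<Rightarrow> (nat \<Rightarrow> 'a) \<Rightarrow> nat \<Rightarrow> nat \<Rightarrow> 'a" where
  "jet_matrix m x k = (\<lambda>r c. if r = 1 \<and> c < m then of_nat (c + 1) *\<^sub>C x (c + 1) + k c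
     else if r = 0 \<and> c < m then x c else 0)"

text \<open>The last column c = m - 1 is left out: its upper entry would have to be compared with
  x_m, which the lower row does not contain.\<close>

definition row_defect :: "nat \<Rightarrow> (nat \<Rightarrow> nat \<Rightarrow> 'a :: complex_vector) \<Rightarrow> nat \<Rightarrow> 'a" where
  "row_defect m M = (\<lambda>c. if c + 1 < m then M 1 c - of_nat (c + 1) *\<^sub>C M 0 (c + 1) else 0)"

text \<open>Recovers x from the matrix of (x, 0). The coefficient x_m occurs only in the upper left
  corner, as m x_m.\<close>

definition matrix_jet :: "nat \<Rightarrow> (nat \<Rightarrow> nat \<Rightarrow> 'a :: complex_vector) \<Rightarrow> nat \<Rightarrow> 'a" where
  "matrix_jet m M = (\<lambda>c. if c < m then M 0 c else if c = m then (1 / of_nat m) *\<^sub>C M 1 (m - 1) else 0)"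

lemma jet_matrix_add: "jet_matrix m (x + y) (k + l) = jet_matrix m x k + jet_matrix m y l"
  by (intro ext) (simp add: jet_matrix_def scaleC_add_right)

lemma jet_matrix_diff: "jet_matrix m (x - y) (k - l) = jet_matrix m x k - jet_matrix m y l"
  by (intro ext) (simp add: jet_matrix_def scaleC.scale_right_diff_distrib)

lemma jet_matrix_scale: "jet_matrix m (a *\<^sub>C x) (a *\<^sub>C k) = a *\<^sub>C jet_matrix m x k"
  by (intro ext) (simp add: jet_matrix_def scaleC_add_right mult.commute)

lemma jet_matrix_cong:
  assumes "\<And>c. c \<le> m \<Longrightarrow> x c = y c" "\<And>c. c < m \<Longrightarrow> k c = l c"
  shows "jet_matrix m x k = jet_matrix m y l"
  using assms by (intro ext) (simp add: jet_matrix_def)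

lemma row_defect_add: "row_defect m (M + N) = row_defect m M + row_defect m N"
  by (intro ext) (simp add: row_defect_def scaleC_add_right)

lemma row_defect_scale: "row_defect m (a *\<^sub>C M) = a *\<^sub>C row_defect m M"
  by (intro ext) (simp add: row_defect_def scaleC.scale_right_diff_distrib mult.commute)

lemma matrix_jet_add: "matrix_jet m (M + N) = matrix_jet m M + matrix_jet m N"
  by (intro ext) (simp add: matrix_jet_def scaleC_add_right)

lemma matrix_jet_scale: "matrix_jet m (a *\<^sub>C M) = a *\<^sub>C matrix_jet m M"
  by (intro ext) (simp add: matrix_jet_def mult.commute)

lemma row_defect_jet_matrix:
  "row_defect m (jet_matrix m x k) = (\<lambda>c. if c + 1 < m then k c else 0)"
  by (intro ext) (simp add: row_defect_def jet_matrix_def)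

lemma matrix_jet_jet_matrix:
  assumes "m \<ge> 1" "\<And>c. c > m \<Longrightarrow> x c = 0"
  shows "matrix_jet m (jet_matrix m x 0) = x"
proof
  fix c
  consider "c < m" | "c = m" | "c > m" by linarith
  then show "matrix_jet m (jet_matrix m x 0) c = x c"
    using assms by cases (simp_all add: matrix_jet_def jet_matrix_def of_nat_diff)
qed

lemma tau_tuple_tau:
  assumes S: "open S" and z: "z \<in> S" and f: "analytic_in S f"
  shows "tau_tuple 2 (\<lambda>c w. tau m f w c) z = jet_matrix m (tau (m + 1) f z) 0"
proof (intro ext)
  fix r c
  show "tau_tuple 2 (\<lambda>c w. tau m f w c) z r c = jet_matrix m (tau (m + 1) f z) 0 r c"
  proof (cases "c < m")
    case True
    then have "(\<lambda>w. tau m f w c) = taylor c f" by (simp add: tau_def fun_eq_iff)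
    then show ?thesis
      using True taylor_taylor[OF f S z, of c]
      by (auto simp: tau_tuple_def tau_def jet_matrix_def less_2_cases_iff)
  next
    case False
    then have "(\<lambda>w. tau m f w c) = (\<lambda>w. 0)" by (simp add: tau_def fun_eq_iff)
    then show ?thesis
      using False by (simp add: tau_tuple_def tau_def[of 2] jet_matrix_def taylor_zero)
  qed
qed

section \<open>The matrices of F[m,2] in terms of the pairs (h, k)\<close>

locale acceptable_point = acceptable_disc U F \<psi>
  for U :: "complex set" and F :: "(complex \<Rightarrow> 'a :: complex_banach) nspace" and \<psi> +
  fixes z :: complex and m :: nat
  assumes z: "z \<in> U" and m: "m \<ge> 1"
begin

definition \<phi> :: "complex \<Rightarrow> complex" where
  "\<phi> v = \<theta> v - \<theta> z"

lemma \<phi>: "\<phi> holomorphic_on U" "\<phi> z = 0" "deriv \<phi> z = deriv \<theta> z"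
proof -
  show "\<phi> holomorphic_on U" unfolding \<phi>_def by (intro holomorphic_intros \<theta>_holomorphic)
  show "\<phi> z = 0" by (simp add: \<phi>_def)
  show "deriv \<phi> z = deriv \<theta> z"
    unfolding \<phi>_def using holomorphic_on_imp_differentiable_at[OF \<theta>_holomorphic U z] by simp
qed

text \<open>The function h of the overview.\<close>

definition diag_fun :: "(nat \<Rightarrow> complex \<Rightarrow> 'a) \<Rightarrow> complex \<Rightarrow> 'a" where
  "diag_fun f = (\<lambda>v. \<Sum>j<m. \<phi> v ^ j *\<^sub>C f j v)"

text \<open>The function k of the overview: the derivative at u = z of the sum of (\<theta> v -
  \<theta> u)^j f_j(v). The truncated exponent for j = 0 is harmless, as the coefficient is
  0.\<close>

definition diag_deriv_fun :: "(nat \<Rightarrow> complex \<Rightarrow> 'a) \<Rightarrow> complex \<Rightarrow> 'a" where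
  "diag_deriv_fun f = (\<lambda>v. \<Sum>j<m. (- of_nat j * deriv \<theta> z * \<phi> v ^ (j - 1)) *\<^sub>C f j v)"

lemma analytic_in_\<phi>_power: "analytic_in U h \<Longrightarrow> analytic_in U (\<lambda>v. (b * \<phi> v ^ k) *\<^sub>C h v)"
  by (intro analytic_in_scale holomorphic_intros \<phi> U)

text \<open>Condition (c) is applied to \<theta>, which maps onto the unit disc, and \<theta>(z)
  times the function is subtracted; each factor \<phi> then costs at most K + |\<theta>(z)|.\<close>

lemma multiple_in_F:
  "\<exists>C>0. \<forall>f\<in>carr F. (\<lambda>v. (b * \<phi> v ^ k) *\<^sub>C f v) \<in> carr F \<and>
    vnorm F (\<lambda>v. (b * \<phi> v ^ k) *\<^sub>C f v) \<le> C * vnorm F f"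
proof (induction k)
  case 0
  have "(\<lambda>v. (b * \<phi> v ^ 0) *\<^sub>C f v) = b *\<^sub>C f" for f :: "complex \<Rightarrow> 'a" by (simp add: scaleC_fun_def)
  then show ?case
    using seminormedD(5,7)[OF F] seminormedD(6)[OF F]
    by (intro exI[of _ "cmod b + 1"]) (auto simp: add_nonneg_pos distrib_right)
next
  case (Suc k)
  then obtain C where C: "C > 0" "\<And>f. f \<in> carr F \<Longrightarrow> (\<lambda>v. (b * \<phi> v ^ k) *\<^sub>C f v) \<in> carr F"
    "\<And>f. f \<in> carr F \<Longrightarrow> vnorm F (\<lambda>v. (b * \<phi> v ^ k) *\<^sub>C f v) \<le> C * vnorm F f"
    by blast
  obtain K where K: "K > 0" "\<And>f. f \<in> analytic_functions U \<Longrightarrow>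
      ((\<lambda>v. \<theta> v *\<^sub>C f v) \<in> carr F \<longleftrightarrow> f \<in> carr F) \<and>
      (f \<in> carr F \<longrightarrow> inverse K * vnorm F (\<lambda>v. \<theta> v *\<^sub>C f v) \<le> vnorm F f)"
    using acceptable \<theta>_conformal unfolding acceptable_space_def by meson
  have step: "(\<lambda>v. \<phi> v *\<^sub>C f v) \<in> carr F"
    "vnorm F (\<lambda>v. \<phi> v *\<^sub>C f v) \<le> (K + cmod (\<theta> z)) * vnorm F f" if f: "f \<in> carr F" for f
  proof -
    have \<theta>f: "(\<lambda>v. \<theta> v *\<^sub>C f v) \<in> carr F" "vnorm F (\<lambda>v. \<theta> v *\<^sub>C f v) \<le> K * vnorm F f"
      using K(2)[OF F_analytic[OF f]] f K(1) by (auto simp: field_simps)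
    have eq: "(\<lambda>v. \<phi> v *\<^sub>C f v) = (\<lambda>v. \<theta> v *\<^sub>C f v) - \<theta> z *\<^sub>C f"
      by (intro ext) (simp add: \<phi>_def scaleC.scale_left_diff_distrib)
    show "(\<lambda>v. \<phi> v *\<^sub>C f v) \<in> carr F"
      unfolding eq using \<theta>f(1) seminormedD(5)[OF F f] by (rule seminormed_diff[OF F])
    show "vnorm F (\<lambda>v. \<phi> v *\<^sub>C f v) \<le> (K + cmod (\<theta> z)) * vnorm F f"
      unfolding eq using seminormed_norm_diff[OF F \<theta>f(1) seminormedD(5)[OF F f, of "\<theta> z"]] \<theta>f(2)
      by (simp add: seminormedD(7)[OF F f] distrib_right)
  qed
  have "(\<lambda>v. (b * \<phi> v ^ Suc k) *\<^sub>C f v) \<in> carr F \<and>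
      vnorm F (\<lambda>v. (b * \<phi> v ^ Suc k) *\<^sub>C f v) \<le> (K + cmod (\<theta> z)) * C * vnorm F f"
    if f: "f \<in> carr F" for f
  proof -
    have eq: "(\<lambda>v. (b * \<phi> v ^ Suc k) *\<^sub>C f v) = (\<lambda>v. \<phi> v *\<^sub>C (b * \<phi> v ^ k) *\<^sub>C f v)"
      by (simp add: mult_ac)
    have "vnorm F (\<lambda>v. \<phi> v *\<^sub>C (b * \<phi> v ^ k) *\<^sub>C f v) \<le>
        (K + cmod (\<theta> z)) * vnorm F (\<lambda>v. (b * \<phi> v ^ k) *\<^sub>C f v)"
      by (rule step(2)[OF C(2)[OF f]])
    also have "\<dots> \<le> (K + cmod (\<theta> z)) * (C * vnorm F f)"
      using C(3)[OF f] K(1) by (intro mult_left_mono) auto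
    finally show ?thesis unfolding eq using step(1)[OF C(2)[OF f]] by (simp add: mult.assoc)
  qed
  moreover have "(K + cmod (\<theta> z)) * C > 0" using K(1) C(1) by (simp add: add_pos_nonneg)
  ultimately show ?case by blast
qed

lemma sum_of_multiples_in_F:
  fixes n :: nat
  shows "\<exists>C>0. \<forall>f. (\<forall>j<n. f j \<in> carr F) \<longrightarrow>
    (\<lambda>v. \<Sum>j<n. (b j * \<phi> v ^ e j) *\<^sub>C f j v) \<in> carr F \<and>
    vnorm F (\<lambda>v. \<Sum>j<n. (b j * \<phi> v ^ e j) *\<^sub>C f j v) \<le> C * (\<Sum>j<n. vnorm F (f j))"
proof (induction n)
  case 0
  show ?case
    using seminormedD(3)[OF F] seminormed_norm_0[OF F]
    by (intro exI[of _ 1]) (simp add: zero_fun_def)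
next
  case (Suc n)
  let ?s = "\<lambda>f v. \<Sum>j<n. (b j * \<phi> v ^ e j) *\<^sub>C f j v"
  let ?t = "\<lambda>f v. (b n * \<phi> v ^ e n) *\<^sub>C f n v"
  obtain C where C: "C > 0" "\<And>f. \<forall>j<n. f j \<in> carr F \<Longrightarrow> ?s f \<in> carr F"
    "\<And>f. \<forall>j<n. f j \<in> carr F \<Longrightarrow> vnorm F (?s f) \<le> C * (\<Sum>j<n. vnorm F (f j))"
    using Suc.IH by blast
  obtain K where K: "K > 0" "\<And>h. h \<in> carr F \<Longrightarrow> (\<lambda>v. (b n * \<phi> v ^ e n) *\<^sub>C h v) \<in> carr F"
    "\<And>h. h \<in> carr F \<Longrightarrow> vnorm F (\<lambda>v. (b n * \<phi> v ^ e n) *\<^sub>C h v) \<le> K * vnorm F h"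
    using multiple_in_F[of "b n" "e n"] by blast
  have "(\<lambda>v. \<Sum>j<Suc n. (b j * \<phi> v ^ e j) *\<^sub>C f j v) \<in> carr F \<and>
      vnorm F (\<lambda>v. \<Sum>j<Suc n. (b j * \<phi> v ^ e j) *\<^sub>C f j v) \<le> (C + K) * (\<Sum>j<Suc n. vnorm F (f j))"
    if f: "\<forall>j<Suc n. f j \<in> carr F" for f
  proof -
    have eq: "(\<lambda>v. \<Sum>j<Suc n. (b j * \<phi> v ^ e j) *\<^sub>C f j v) = ?s f + ?t f"
      by (simp add: fun_eq_iff)
    have fn: "f n \<in> carr F" and fj: "\<forall>j<n. f j \<in> carr F" using f by auto
    have pos: "0 \<le> vnorm F (f n)" "0 \<le> (\<Sum>j<n. vnorm F (f j))"
      using fn fj seminormedD(6)[OF F] by (auto intro: sum_nonneg)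
    have "vnorm F (?s f + ?t f) \<le> C * (\<Sum>j<n. vnorm F (f j)) + K * vnorm F (f n)"
      using seminormedD(8)[OF F C(2)[OF fj] K(2)[OF fn]] C(3)[OF fj] K(3)[OF fn] by linarith
    also have "\<dots> \<le> (C + K) * (\<Sum>j<Suc n. vnorm F (f j))"
      using pos C(1) K(1) by (simp add: algebra_simps)
    finally show ?thesis
      unfolding eq using seminormedD(4)[OF F C(2)[OF fj] K(2)[OF fn]] by simp
  qed
  moreover have "C + K > 0" using C(1) K(1) by simp
  ultimately show ?case by blast
qed

lemma diag_fun_in_F:
  "\<exists>C>0. \<forall>f. (\<forall>j<m. f j \<in> carr F) \<longrightarrow>
    diag_fun f \<in> carr F \<and> vnorm F (diag_fun f) \<le> C * (\<Sum>j<m. vnorm F (f j))"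
  using sum_of_multiples_in_F[of m "\<lambda>j. 1" "\<lambda>j. j"] by (simp add: diag_fun_def)

lemma diag_deriv_fun_in_F:
  "\<exists>C>0. \<forall>f. (\<forall>j<m. f j \<in> carr F) \<longrightarrow>
    diag_deriv_fun f \<in> carr F \<and> vnorm F (diag_deriv_fun f) \<le> C * (\<Sum>j<m. vnorm F (f j))"
  using sum_of_multiples_in_F[of m "\<lambda>j. - of_nat j * deriv \<theta> z" "\<lambda>j. j - 1"]
  by (simp add: diag_deriv_fun_def)

text \<open>Replacing \<theta> by its translate \<phi> changes no difference \<theta> v - \<theta>
  u, and it provides the zero at z that the formula for the derivative along the diagonal
  requires.\<close>

lemma jet_tuple_eq_sum:
  assumes f: "\<And>j. j < m \<Longrightarrow> f j \<in> carr F" and u: "u \<in> U" and i: "i < m"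
  shows "jet_tuple m f i u = (\<Sum>j<m. taylor i (\<lambda>v. (\<phi> v - \<phi> u) ^ j *\<^sub>C f j v) u)"
proof -
  have "jet_tuple m f i u = taylor i (\<lambda>v. \<Sum>j<m. (\<theta> v - \<theta> u) ^ j *\<^sub>C f j v) u"
    using u i by (simp add: jet_tuple_def zero_off_def)
  also have "\<dots> = (\<Sum>j<m. taylor i (\<lambda>v. (\<theta> v - \<theta> u) ^ j *\<^sub>C f j v) u)"
    using f by (intro taylor_sum[OF _ U u] analytic_in_power F_analytic_in) auto
  finally show ?thesis by (simp add: \<phi>_def)
qed

lemma jet_tuple_analytic:
  assumes f: "\<And>j. j < m \<Longrightarrow> f j \<in> carr F"
  shows "analytic_in U (jet_tuple m f i)"
proof (cases "i < m")
  case True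
  have "analytic_in U (\<lambda>u. \<Sum>j<m. taylor i (\<lambda>v. (\<phi> v - \<phi> u) ^ j *\<^sub>C f j v) u)"
    using f by (intro analytic_in_sum analytic_in_diagonal_taylor[OF U z \<phi>(1,2)] F_analytic_in) auto
  then show ?thesis
    by (rule analytic_in_transform) (use U jet_tuple_eq_sum[OF f _ True] in auto)
next
  case False
  then have "jet_tuple m f i = (\<lambda>u. 0)" by (simp add: jet_tuple_def zero_off_def fun_eq_iff)
  then show ?thesis by (simp add: analytic_in_0)
qed

text \<open>For the lower row, \<phi>(v) - \<phi>(z) is \<phi>(v). For the upper row, the derivative
  along the diagonal has two parts: moving the base point of the jet contributes h, and moving u
  inside the powers contributes k.\<close>

lemma tau_tuple_jet_tuple:
  assumes f: "\<And>j. j < m \<Longrightarrow> f j \<in> carr F"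
  shows "tau_tuple 2 (jet_tuple m f) z =
    jet_matrix m (\<lambda>i. taylor i (diag_fun f) z) (\<lambda>i. taylor i (diag_deriv_fun f) z)"
proof (intro ext)
  fix r c
  have an: "analytic_in U (f j)" if "j < m" for j using F_analytic_in[OF f[OF that]] .
  have an1: "analytic_in U (\<lambda>v. \<phi> v ^ k *\<^sub>C f j v)" if "j < m" for j k
    using analytic_in_\<phi>_power[OF an[OF that], of 1 k] by simp
  have H: "taylor i (diag_fun f) z = (\<Sum>j<m. taylor i (\<lambda>v. \<phi> v ^ j *\<^sub>C f j v) z)" for i
    unfolding diag_fun_def using an1 by (intro taylor_sum[OF _ U z]) auto
  have K: "taylor i (diag_deriv_fun f) z =
      (\<Sum>j<m. (- of_nat j * deriv \<theta> z) *\<^sub>C taylor i (\<lambda>v. \<phi> v ^ (j - 1) *\<^sub>C f j v) z)" for i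
  proof -
    have "taylor i (diag_deriv_fun f) z =
        (\<Sum>j<m. taylor i (\<lambda>v. (- of_nat j * deriv \<theta> z * \<phi> v ^ (j - 1)) *\<^sub>C f j v) z)"
      unfolding diag_deriv_fun_def
      using an by (intro taylor_sum[OF _ U z] analytic_in_\<phi>_power) auto
    also have "\<dots> = (\<Sum>j<m. (- of_nat j * deriv \<theta> z) *\<^sub>C taylor i (\<lambda>v. \<phi> v ^ (j - 1) *\<^sub>C f j v) z)"
    proof (rule sum.cong)
      fix j assume "j \<in> {..<m}"
      then have "taylor i (\<lambda>v. (- of_nat j * deriv \<theta> z) *\<^sub>C (\<phi> v ^ (j - 1) *\<^sub>C f j v)) z =
          (- of_nat j * deriv \<theta> z) *\<^sub>C taylor i (\<lambda>v. \<phi> v ^ (j - 1) *\<^sub>C f j v) z"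
        by (intro taylor_cmult[OF an1 U z]) simp
      then show "taylor i (\<lambda>v. (- of_nat j * deriv \<theta> z * \<phi> v ^ (j - 1)) *\<^sub>C f j v) z =
          (- of_nat j * deriv \<theta> z) *\<^sub>C taylor i (\<lambda>v. \<phi> v ^ (j - 1) *\<^sub>C f j v) z"
        unfolding scaleC_scaleC .
    qed simp
    finally show ?thesis .
  qed
  show "tau_tuple 2 (jet_tuple m f) z r c =
    jet_matrix m (\<lambda>i. taylor i (diag_fun f) z) (\<lambda>i. taylor i (diag_deriv_fun f) z) r c"
  proof (cases "c < m")
    case c: True
    let ?P = "\<lambda>j u. taylor c (\<lambda>v. (\<phi> v - \<phi> u) ^ j *\<^sub>C f j v) u"
    have P: "analytic_in U (?P j)" if "j < m" for j
      by (rule analytic_in_diagonal_taylor[OF U z \<phi>(1,2) an[OF that]])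
    have "taylor (Suc 0) (jet_tuple m f c) z = taylor (Suc 0) (\<lambda>u. \<Sum>j<m. ?P j u) z"
      using jet_tuple_analytic[OF f] jet_tuple_eq_sum[OF f _ c] by (intro taylor_cong[OF U z]) auto
    also have "\<dots> = (\<Sum>j<m. taylor (Suc 0) (?P j) z)"
      using P by (intro taylor_sum[OF _ U z]) auto
    also have "\<dots> = (\<Sum>j<m. of_nat (Suc c) *\<^sub>C taylor (Suc c) (\<lambda>v. \<phi> v ^ j *\<^sub>C f j v) z -
        (of_nat j * deriv \<phi> z) *\<^sub>C taylor c (\<lambda>v. \<phi> v ^ (j - 1) *\<^sub>C f j v) z)"
      using taylor_diagonal_taylor[OF U z \<phi>(1,2) an] by (intro sum.cong) auto
    also have "\<dots> = of_nat (Suc c) *\<^sub>C taylor (Suc c) (diag_fun f) z + taylor c (diag_deriv_fun f) z"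
      by (simp add: H K \<phi>(3) sum_subtractf sum_negf scaleC.scale_sum_right)
    finally have 1: "taylor (Suc 0) (jet_tuple m f c) z =
      of_nat (Suc c) *\<^sub>C taylor (Suc c) (diag_fun f) z + taylor c (diag_deriv_fun f) z" .
    have 0: "jet_tuple m f c z = taylor c (diag_fun f) z"
      using jet_tuple_eq_sum[OF f z c] by (simp add: H \<phi>(2))
    show ?thesis
      using c 0 1 by (auto simp: tau_tuple_def tau_def jet_matrix_def less_2_cases_iff)
  next
    case False
    then have "jet_tuple m f c = (\<lambda>u. 0)" by (simp add: jet_tuple_def zero_off_def fun_eq_iff)
    then show ?thesis using False by (simp add: tau_tuple_def tau_def jet_matrix_def taylor_zero)
  qed
qed

section \<open>The splitting\<close>

text \<open>The factor \<open>-1/m\<close> is chosen such that the entry with indices \<open>1\<close> and \<open>m - 1\<close> of the matrix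
  of the pair \<open>\<eta> g\<close>, \<open>g\<close>, which is \<open>m (\<eta> g)\<^bsup>[m]\<^esup> + g\<^bsup>[m-1]\<^esup>\<close> in terms of Taylor coefficients, does not
  involve \<open>g\<^bsup>[m-1]\<^esup>\<close>. So this matrix is a function of the \<open>(m - 1)\<close>-jet of \<open>g\<close>.\<close>

definition \<eta> :: "complex \<Rightarrow> complex" where
  "\<eta> v = - 1 / (of_nat m * deriv \<theta> z) * \<phi> v"

text \<open>Leibniz' rule for the coefficients of \<eta> g, without the summand a = 0, which
  vanishes with \<eta>(z). So the coefficient of order c involves only those of g of order less than
  c.\<close>

definition \<eta>_multiple :: "(nat \<Rightarrow> 'a) \<Rightarrow> nat \<Rightarrow> 'a" where
  "\<eta>_multiple w = (\<lambda>c. \<Sum>a=1..c. ctaylor a \<eta> z *\<^sub>C w (c - a))"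

definition section_op :: "(nat \<Rightarrow> 'a) \<Rightarrow> nat \<Rightarrow> nat \<Rightarrow> 'a" where
  "section_op w = jet_matrix m (\<eta>_multiple w) w"

text \<open>On the matrix of (h, k) this is the jet of h - \<eta> k, but as a formula in the entries
  it requires no choice of h and k.\<close>

definition retract_op :: "(nat \<Rightarrow> nat \<Rightarrow> 'a) \<Rightarrow> nat \<Rightarrow> 'a" where
  "retract_op M = matrix_jet m (M - section_op (row_defect m M))"

lemma \<eta>: "\<eta> holomorphic_on U" "\<eta> z = 0" "of_nat m * ctaylor 1 \<eta> z = - 1"
proof -
  show hol: "\<eta> holomorphic_on U" unfolding \<eta>_def by (intro holomorphic_intros \<phi>)
  show "\<eta> z = 0" by (simp add: \<eta>_def \<phi>(2))
  have "deriv \<eta> z = - 1 / (of_nat m * deriv \<theta> z) * deriv \<phi> z"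
    unfolding \<eta>_def by (rule deriv_cmult) (rule holomorphic_on_imp_differentiable_at[OF \<phi>(1) U z])
  then show "of_nat m * ctaylor 1 \<eta> z = - 1"
    using m deriv_\<theta>[OF z] by (simp add: ctaylor_1 \<phi>(3))
qed

lemma \<eta>_multiple_in_F:
  "\<exists>C>0. \<forall>f\<in>carr F. (\<lambda>v. \<eta> v *\<^sub>C f v) \<in> carr F \<and> vnorm F (\<lambda>v. \<eta> v *\<^sub>C f v) \<le> C * vnorm F f"
  using multiple_in_F[of "- 1 / (of_nat m * deriv \<theta> z)" 1] by (simp add: \<eta>_def)

lemma \<eta>_multiple_linear:
  "\<eta>_multiple (x + y) = \<eta>_multiple x + \<eta>_multiple y" "\<eta>_multiple (a *\<^sub>C x) = a *\<^sub>C \<eta>_multiple x"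
  by (intro ext; simp add: \<eta>_multiple_def scaleC_add_right sum.distrib scaleC.scale_sum_right mult.commute)+

lemma section_op_linear:
  "section_op (x + y) = section_op x + section_op y" "section_op (a *\<^sub>C x) = a *\<^sub>C section_op x"
  by (simp_all add: section_op_def \<eta>_multiple_linear jet_matrix_add jet_matrix_scale)

lemma section_op_0: "section_op 0 = 0"
  using section_op_linear(2)[of 0 0] by simp

lemma retract_op_linear:
  "retract_op (x + y) = retract_op x + retract_op y" "retract_op (a *\<^sub>C x) = a *\<^sub>C retract_op x"
proof -
  have "x + y - section_op (row_defect m (x + y)) =
      (x - section_op (row_defect m x)) + (y - section_op (row_defect m y))"
    by (simp add: row_defect_add section_op_linear)
  then show "retract_op (x + y) = retract_op x + retract_op y"
    by (simp only: retract_op_def matrix_jet_add)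
  have "a *\<^sub>C x - section_op (row_defect m (a *\<^sub>C x)) = a *\<^sub>C (x - section_op (row_defect m x))"
    by (simp only: row_defect_scale section_op_linear scaleC.scale_right_diff_distrib)
  then show "retract_op (a *\<^sub>C x) = a *\<^sub>C retract_op x"
    by (simp only: retract_op_def matrix_jet_scale)
qed

text \<open>The left side sees g only up to order m - 2. On the right the coefficient of order m - 1
  occurs only in the upper left corner, where the choice of \<eta> makes it cancel.\<close>

lemma section_op_tau:
  assumes g: "analytic_in U g"
  shows "section_op (tau (m - 1) g z) =
    jet_matrix m (\<lambda>i. taylor i (\<lambda>v. \<eta> v *\<^sub>C g v) z) (\<lambda>i. taylor i g z)"
proof (intro ext)
  fix r c
  let ?w = "tau (m - 1) g z"
  have \<eta>g: "taylor c (\<lambda>v. \<eta> v *\<^sub>C g v) z = (\<Sum>a=1..c. ctaylor a \<eta> z *\<^sub>C taylor (c - a) g z)" for c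
    unfolding taylor_scale_fun[OF \<eta>(1) g U z]
    by (rule sum.mono_neutral_right) (auto simp: ctaylor_0 \<eta>(2) not_le)
  have low: "\<eta>_multiple ?w c = taylor c (\<lambda>v. \<eta> v *\<^sub>C g v) z" if "c < m" for c
    unfolding \<eta>g \<eta>_multiple_def using that by (intro sum.cong) (auto simp: tau_def)
  \<comment> \<open>In \<open>?w\<close> the entry m - 1 is 0. The omitted term m \<eta>'(z) times
    the coefficient of order m - 1 of g is minus that coefficient and cancels the last
    summand.\<close>
  have top: "of_nat m *\<^sub>C \<eta>_multiple ?w m =
      of_nat m *\<^sub>C taylor m (\<lambda>v. \<eta> v *\<^sub>C g v) z + taylor (m - 1) g z"
  proof -
    have "\<eta>_multiple ?w m = (\<Sum>a=2..m. ctaylor a \<eta> z *\<^sub>C taylor (m - a) g z)"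
      unfolding \<eta>_multiple_def
      by (rule sum.mono_neutral_cong_right) (auto simp: tau_def)
    moreover have "taylor m (\<lambda>v. \<eta> v *\<^sub>C g v) z =
        ctaylor 1 \<eta> z *\<^sub>C taylor (m - 1) g z + (\<Sum>a=2..m. ctaylor a \<eta> z *\<^sub>C taylor (m - a) g z)"
      unfolding \<eta>g using m by (simp add: sum.atLeast_Suc_atMost numeral_2_eq_2)
    ultimately have "of_nat m *\<^sub>C taylor m (\<lambda>v. \<eta> v *\<^sub>C g v) z =
        (of_nat m * ctaylor 1 \<eta> z) *\<^sub>C taylor (m - 1) g z + of_nat m *\<^sub>C \<eta>_multiple ?w m"
      by (simp add: scaleC_add_right)
    then show ?thesis unfolding \<eta>(3) by simp
  qed
  consider "c + 1 < m" | "c + 1 = m" | "c \<ge> m" by linarith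
  then show "section_op ?w r c =
      jet_matrix m (\<lambda>i. taylor i (\<lambda>v. \<eta> v *\<^sub>C g v) z) (\<lambda>i. taylor i g z) r c"
  proof cases
    case 1
    then show ?thesis using low[of c] low[of "c + 1"] by (auto simp: section_op_def jet_matrix_def tau_def)
  next
    case 2
    have w0: "?w c = 0" using 2 by (auto simp: tau_def)
    show ?thesis
      unfolding section_op_def jet_matrix_def 2 w0 using low[of c] top 2 by auto
  next
    case 3
    then show ?thesis by (simp add: section_op_def jet_matrix_def)
  qed
qed

lemma row_defect_jet:
  "row_defect m (jet_matrix m x (\<lambda>i. taylor i g z)) = tau (m - 1) g z"
  unfolding row_defect_jet_matrix tau_def by (intro ext) (simp add: less_diff_conv)

text \<open>The matrix depends linearly on the pair, and (h, k) - (\<eta> k, k) = (h - \<eta> k,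
  0).\<close>

lemma jet_matrix_minus_section:
  assumes h: "h \<in> carr F" and k: "k \<in> carr F" and \<eta>k: "(\<lambda>v. \<eta> v *\<^sub>C k v) \<in> carr F"
    and M: "M = jet_matrix m (\<lambda>i. taylor i h z) (\<lambda>i. taylor i k z)"
  shows "M - section_op (row_defect m M) = jet_matrix m (tau (m + 1) (h - (\<lambda>v. \<eta> v *\<^sub>C k v)) z) 0"
    and "retract_op M = tau (m + 1) (h - (\<lambda>v. \<eta> v *\<^sub>C k v)) z"
proof -
  let ?\<eta>k = "\<lambda>v. \<eta> v *\<^sub>C k v"
  have "M - section_op (row_defect m M) =
      jet_matrix m (\<lambda>i. taylor i h z) (\<lambda>i. taylor i k z) -
      jet_matrix m (\<lambda>i. taylor i ?\<eta>k z) (\<lambda>i. taylor i k z)"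
    unfolding M row_defect_jet section_op_tau[OF F_analytic_in[OF k]] ..
  also have "\<dots> = jet_matrix m (tau (m + 1) (h - ?\<eta>k) z) 0"
    unfolding jet_matrix_diff[symmetric]
    using taylor_diff[OF F_analytic_in[OF h] F_analytic_in[OF \<eta>k] U z]
    by (intro jet_matrix_cong) (simp_all add: tau_def fun_diff_def)
  finally show 1: "M - section_op (row_defect m M) = jet_matrix m (tau (m + 1) (h - ?\<eta>k) z) 0" .
  show "retract_op M = tau (m + 1) (h - ?\<eta>k) z"
    unfolding retract_op_def 1 using m by (intro matrix_jet_jet_matrix) (simp_all add: tau_def)
qed

lemma carr_F_bracket:
  "carr (F_bracket U \<psi> F m 2 z) = {tau_tuple 2 (jet_tuple m f) z | f. \<forall>j<m. f j \<in> carr F}"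
  by (auto simp: F_bracket_def carr_range_space T_space_eq)

lemma seminormed_F_bracket: "seminormed (F_bracket U \<psi> F m 2 z)"
  unfolding F_bracket_def
proof (rule seminormed_range_space[OF seminormed_T_space])
  have an: "analytic_in U (T i)" if T: "T \<in> carr (T_space U \<psi> F m)" for T i
  proof -
    obtain f where "T = jet_tuple m f" "\<forall>j<m. f j \<in> carr F"
      using T by (auto simp: T_space_eq)
    then show ?thesis using jet_tuple_analytic by simp
  qed
  show "tau_tuple 2 (S + T) z = tau_tuple 2 S z + tau_tuple 2 T z"
    if "S \<in> carr (T_space U \<psi> F m)" "T \<in> carr (T_space U \<psi> F m)" for S T
    using tau_add[OF an[OF that(1)] an[OF that(2)] z, of 2] by (intro ext) (simp add: tau_tuple_def)
  show "tau_tuple 2 (a *\<^sub>C T) z = a *\<^sub>C tau_tuple 2 T z" if "T \<in> carr (T_space U \<psi> F m)" for a T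
    using tau_scale[OF an[OF that] z, of 2 a] by (intro ext) (simp add: tau_tuple_def)
qed

section \<open>Boundedness of the four operators\<close>

lemmas seminormed_matrices = seminormed_F_bracket[unfolded F_bracket_def]
lemmas seminormed_jets = seminormed_Rochberg[OF z, unfolded Rochberg_def]

abbreviation "X \<equiv> Rochberg F (m + 1) z"
abbreviation "Y \<equiv> F_bracket U \<psi> F m 2 z"
abbreviation "Z \<equiv> Rochberg F (m - 1) z"
abbreviation "E \<equiv> E_op F m 2 z"

text \<open>The description defining \<open>E_op\<close> denotes: by \<open>tau_tuple_tau\<close>
  the matrix depends on the jet only, so all functions with this jet yield the same one.\<close>

lemma E_tau:
  assumes f: "f \<in> carr F"
  shows "E (tau (m + 1) f z) = jet_matrix m (tau (m + 1) f z) 0"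
proof -
  have jm: "tau_tuple 2 (\<lambda>c w. tau m f w c) z = jet_matrix m (tau (m + 1) f z) 0" if "f \<in> carr F" for f
    by (rule tau_tuple_tau[OF U z F_analytic_in[OF that]])
  show ?thesis
    unfolding E_op_def using f jm by (intro the_equality) auto
qed

lemma E_eq: "x \<in> carr X \<Longrightarrow> E x = jet_matrix m x 0"
  using E_tau by (auto simp: carr_Rochberg)

lemma bounded_operator_E: "bounded_operator X Y E"
proof -
  note sX = seminormed_Rochberg[OF z, of "m + 1"]
  have lift: "\<exists>T\<in>carr (T_space U \<psi> F m). tau_tuple 2 T z = E (tau (m + 1) f z) \<and>
      vnorm (T_space U \<psi> F m) T \<le> 1 * vnorm F f" if f: "f \<in> carr F" for f
  proof -
    \<comment> \<open>With f_0 = f and all other f_j = 0 one has h = f and k = 0, and the norm is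
      unchanged.\<close>
    define g where "g = (\<lambda>j :: nat. if j = 0 then f else 0)"
    have g: "\<forall>j<m. g j \<in> carr F" using f seminormedD(3)[OF F] by (simp add: g_def)
    have single: "(\<Sum>j<m. G j) = G 0" if "\<And>j. j \<noteq> 0 \<Longrightarrow> G j = 0" for G :: "nat \<Rightarrow> 'b :: comm_monoid_add"
      using m that sum.mono_neutral_right[of "{..<m}" "{0}" G] by auto
    have "diag_fun g = f" "diag_deriv_fun g = (\<lambda>v. 0)"
      by (intro ext; simp add: diag_fun_def diag_deriv_fun_def single g_def)+
    then have "tau_tuple 2 (jet_tuple m g) z = jet_matrix m (tau (m + 1) f z) 0"
      using g by (subst tau_tuple_jet_tuple) (auto intro!: jet_matrix_cong simp: tau_def taylor_zero)
    moreover have "vnorm (T_space U \<psi> F m) (jet_tuple m g) = vnorm F f"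
      using g by (simp add: T_space_eq single g_def seminormed_norm_0[OF F])
    ultimately show ?thesis
      using g E_tau[OF f] T_space_eq(1)[of m]
      by (intro bexI[of _ "jet_tuple m g"]) auto
  qed
  have "bounded_operator (range_space F (\<lambda>f. tau (m + 1) f z))
      (range_space (T_space U \<psi> F m) (\<lambda>T. tau_tuple 2 T z)) E"
  proof ((rule bounded_operator_range_space[where tA="\<lambda>f. tau (m + 1) f z" and tB="\<lambda>T. tau_tuple 2 T z"
          and T=E, OF F seminormed_T_space seminormed_jets seminormed_matrices zero_less_one lift]); (unfold Rochberg_def[symmetric])?)
    show "E (x + y) = E x + E y" if "x \<in> carr X" "y \<in> carr X" for x y
      using that seminormedD(4)[OF sX that] jet_matrix_add[of m x y 0 0] by (simp add: E_eq)
    show "E (a *\<^sub>C x) = a *\<^sub>C E x" if "x \<in> carr X" for a x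
      using that seminormedD(5)[OF sX that] jet_matrix_scale[of m a x 0] by (simp add: E_eq)
  qed
  then show ?thesis by (simp add: Rochberg_def F_bracket_def)
qed

text \<open>The tuple given by f_0, ..., f_(m-1) is sent to k, whose (m - 1)-jet is the
  defect.\<close>

lemma bounded_operator_row_defect: "bounded_operator Y Z (row_defect m)"
proof -
  obtain C where C: "C > 0" "\<And>f. \<forall>j<m. f j \<in> carr F \<Longrightarrow>
      diag_deriv_fun f \<in> carr F \<and> vnorm F (diag_deriv_fun f) \<le> C * (\<Sum>j<m. vnorm F (f j))"
    using diag_deriv_fun_in_F by blast
  have lift: "\<exists>g\<in>carr F. tau (m - 1) g z = row_defect m (tau_tuple 2 T z) \<and>
      vnorm F g \<le> C * vnorm (T_space U \<psi> F m) T" if T: "T \<in> carr (T_space U \<psi> F m)" for T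
  proof -
    obtain f where f: "T = jet_tuple m f" "\<forall>j<m. f j \<in> carr F" using T by (auto simp: T_space_eq)
    have "row_defect m (tau_tuple 2 T z) = tau (m - 1) (diag_deriv_fun f) z"
      using f by (simp add: tau_tuple_jet_tuple row_defect_jet)
    then show ?thesis using C(2)[OF f(2)] f by (auto simp: T_space_eq)
  qed
  show ?thesis
    unfolding Rochberg_def F_bracket_def
    by (rule bounded_operator_range_space[where tA="\<lambda>T. tau_tuple 2 T z" and tB="\<lambda>f. tau (m - 1) f z"
          and T="row_defect m", OF seminormed_T_space F seminormed_matrices seminormed_jets C(1) lift])
      (simp_all add: row_defect_add row_defect_scale)
qed

text \<open>Here the lift is h - \<eta> k; \<open>C\<close>, \<open>D\<close> and \<open>K\<close>
  bound the passage to h, the passage to k and the multiplication by \<eta>.\<close>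

lemma bounded_operator_retract: "bounded_operator Y X retract_op"
proof -
  obtain C where C: "C > 0" "\<And>f. \<forall>j<m. f j \<in> carr F \<Longrightarrow>
      diag_fun f \<in> carr F \<and> vnorm F (diag_fun f) \<le> C * (\<Sum>j<m. vnorm F (f j))"
    using diag_fun_in_F by blast
  obtain D where D: "D > 0" "\<And>f. \<forall>j<m. f j \<in> carr F \<Longrightarrow>
      diag_deriv_fun f \<in> carr F \<and> vnorm F (diag_deriv_fun f) \<le> D * (\<Sum>j<m. vnorm F (f j))"
    using diag_deriv_fun_in_F by blast
  obtain K where K: "K > 0" "\<And>f. f \<in> carr F \<Longrightarrow>
      (\<lambda>v. \<eta> v *\<^sub>C f v) \<in> carr F \<and> vnorm F (\<lambda>v. \<eta> v *\<^sub>C f v) \<le> K * vnorm F f"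
    using \<eta>_multiple_in_F by blast
  have pos: "C + K * D > 0" using C(1) D(1) K(1) by (simp add: add_pos_pos)
  have lift: "\<exists>g\<in>carr F. tau (m + 1) g z = retract_op (tau_tuple 2 T z) \<and>
      vnorm F g \<le> (C + K * D) * vnorm (T_space U \<psi> F m) T" if T: "T \<in> carr (T_space U \<psi> F m)" for T
  proof -
    obtain f where f: "T = jet_tuple m f" "\<forall>j<m. f j \<in> carr F" using T by (auto simp: T_space_eq)
    let ?k = "diag_deriv_fun f"
    let ?g = "diag_fun f - (\<lambda>v. \<eta> v *\<^sub>C ?k v)"
    note C' = C(2)[OF f(2)] and D' = D(2)[OF f(2)]
    note K' = K(2)[OF conjunct1[OF D']]
    have "retract_op (tau_tuple 2 T z) = tau (m + 1) ?g z"
      using f C' D' K' by (intro jet_matrix_minus_section) (auto simp: tau_tuple_jet_tuple)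
    moreover have "?g \<in> carr F" using C' K' by (intro seminormed_diff[OF F]) auto
    moreover have "vnorm F ?g \<le> (C + K * D) * vnorm (T_space U \<psi> F m) T"
    proof -
      have "K * vnorm F ?k \<le> K * (D * (\<Sum>j<m. vnorm F (f j)))"
        using D' K(1) by (intro mult_left_mono) auto
      then show ?thesis
        using seminormed_norm_diff[OF F conjunct1[OF C'] conjunct1[OF K']] C' K' f
        by (simp add: T_space_eq distrib_right)
    qed
    ultimately show ?thesis by (intro bexI[of _ ?g]) auto
  qed
  show ?thesis
    unfolding Rochberg_def F_bracket_def
    by (rule bounded_operator_range_space[where tA="\<lambda>T. tau_tuple 2 T z" and tB="\<lambda>f. tau (m + 1) f z"
          and T=retract_op, OF seminormed_T_space F seminormed_matrices seminormed_jets pos lift])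
      (simp_all add: retract_op_linear)
qed

lemma bounded_operator_section: "bounded_operator Z Y section_op"
proof -
  \<comment> \<open>For f_0 = b \<phi> g and f_1 = d g one gets k = - \<theta>'(z) d g and h = (b +
    d) \<phi> g. The requirements k = g and h = \<eta> g determine d = - 1 / \<theta>'(z) and b + d
    = - 1 / (m \<theta>'(z)).\<close>
  define b where "b = (1 - 1 / of_nat m) / deriv \<theta> z"
  define d where "d = - 1 / deriv \<theta> z"
  define f where "f g = (\<lambda>j :: nat. if j = 0 then (\<lambda>v. (b * \<phi> v ^ 1) *\<^sub>C g v)
    else if j = 1 then d *\<^sub>C g else (0 :: complex \<Rightarrow> 'a))" for g
  obtain C where C: "C > 0" "\<And>g. g \<in> carr F \<Longrightarrow> f g 0 \<in> carr F"
    "\<And>g. g \<in> carr F \<Longrightarrow> vnorm F (f g 0) \<le> C * vnorm F g"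
    using multiple_in_F[of b 1] unfolding f_def by auto
  have pos: "C + cmod d + 1 > 0" using C(1) by (simp add: add_pos_nonneg)
  have lift: "\<exists>T\<in>carr (T_space U \<psi> F m). tau_tuple 2 T z = section_op (tau (m - 1) g z) \<and>
      vnorm (T_space U \<psi> F m) T \<le> (C + cmod d + 1) * vnorm F g" if g: "g \<in> carr F" for g
  proof -
    have fF: "\<forall>j<m. f g j \<in> carr F"
      using C(2)[OF g] seminormedD(3)[OF F] seminormedD(5)[OF F g] by (simp add: f_def)
    have N: "vnorm F g \<ge> 0" "vnorm F (f g 1) = cmod d * vnorm F g"
      using seminormedD(6)[OF F g] seminormedD(7)[OF F g] by (simp_all add: f_def)
    have T: "jet_tuple m (f g) \<in> carr (T_space U \<psi> F m)" using fF T_space_eq(1)[of m] by auto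
    have "(\<Sum>j<m. vnorm F (f g j)) \<le> vnorm F (f g 0) + vnorm F (f g 1)"
    proof -
      have "(\<Sum>j<m. vnorm F (f g j)) = (\<Sum>j\<in>{..<m} \<inter> {0, 1}. vnorm F (f g j))"
        by (rule sum.mono_neutral_right) (auto simp: f_def seminormed_norm_0[OF F])
      also have "\<dots> \<le> (\<Sum>j\<in>{0, 1}. vnorm F (f g j))"
        using C(2)[OF g] N seminormedD(6)[OF F] by (intro sum_mono2) auto
      finally show ?thesis by simp
    qed
    then have "vnorm (T_space U \<psi> F m) (jet_tuple m (f g)) \<le> (C + cmod d + 1) * vnorm F g"
      using C(3)[OF g] N fF by (simp add: T_space_eq distrib_right)
    moreover have "tau_tuple 2 (jet_tuple m (f g)) z = section_op (tau (m - 1) g z)"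
    \<comment> \<open>For m = 1 there is no f_1; but then b = 0 and the jet of length m - 1 is
      empty, so both sides are the zero matrix.\<close>
    proof (cases "m = 1")
      case True
      have "f g 0 = 0"
        using True by (simp add: f_def b_def fun_eq_iff)
      then have "diag_fun (f g) = (\<lambda>v. 0)" "diag_deriv_fun (f g) = (\<lambda>v. 0)"
        unfolding diag_fun_def diag_deriv_fun_def using True by simp_all
      then have "tau_tuple 2 (jet_tuple m (f g)) z = jet_matrix m 0 0"
        using fF by (subst tau_tuple_jet_tuple) (auto intro!: jet_matrix_cong simp: taylor_zero)
      moreover have "tau (m - 1) g z = 0" using True by (simp add: tau_def fun_eq_iff)
      moreover have "jet_matrix m 0 0 = (0 :: nat \<Rightarrow> nat \<Rightarrow> 'a)"
        by (simp add: jet_matrix_def fun_eq_iff)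
      ultimately show ?thesis by (simp add: section_op_0)
    next
      case False
      have two: "(\<Sum>j<m. G j) = G 0 + G 1" if G: "\<And>j. j \<noteq> 0 \<Longrightarrow> j \<noteq> 1 \<Longrightarrow> G j = 0"
        for G :: "nat \<Rightarrow> 'a"
      proof -
        have "1 < m" using False m by simp
        then have "(\<Sum>j<m. G j) = (\<Sum>j\<in>{0, 1}. G j)"
          by (intro sum.mono_neutral_right) (auto simp: G)
        then show ?thesis by simp
      qed
      have "diag_fun (f g) v = \<eta> v *\<^sub>C g v" for v
      proof -
        have "b * \<phi> v + \<phi> v * d = \<eta> v"
          using m deriv_\<theta>[OF z] by (simp add: b_def d_def \<eta>_def field_simps)
        then show ?thesis
          unfolding diag_fun_def by (subst two) (auto simp: f_def simp flip: scaleC_add_left)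
      qed
      moreover have "diag_deriv_fun (f g) v = g v" for v
        unfolding diag_deriv_fun_def using deriv_\<theta>[OF z]
        by (subst two) (auto simp: f_def d_def)
      ultimately have "diag_fun (f g) = (\<lambda>v. \<eta> v *\<^sub>C g v)" "diag_deriv_fun (f g) = g"
        by auto
      then show ?thesis
        using fF tau_tuple_jet_tuple[of "f g"] section_op_tau[OF F_analytic_in[OF g]] by simp
    qed
    ultimately show ?thesis using T by blast
  qed
  show ?thesis
    unfolding Rochberg_def F_bracket_def
    by (rule bounded_operator_range_space[where tA="\<lambda>f. tau (m - 1) f z" and tB="\<lambda>T. tau_tuple 2 T z"
          and T=section_op, OF F seminormed_T_space seminormed_jets seminormed_matrices pos lift])
      (simp_all add: section_op_linear)
qed

text \<open>The algebra is that of the pairs: the matrix of (h, k) is that of (h - \<eta> k, 0),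
  which lies in the range of \<open>E\<close>, plus that of (\<eta> k, k), which is the section
  applied to the jet of k.\<close>

sublocale split: split_sequence X Y Z E retract_op "row_defect m" section_op
proof
  show "seminormed X" "seminormed Z" using z by (rule seminormed_Rochberg)+
  show "seminormed Y" by (rule seminormed_F_bracket)
  show "x = 0" if "x \<in> carr X" "vnorm X x = 0" for x using Rochberg_definite[OF z that] .
  show "x = 0" if "x \<in> carr Z" "vnorm Z x = 0" for x using Rochberg_definite[OF z that] .
  show "bounded_operator X Y E" by (rule bounded_operator_E)
  show "bounded_operator Y X retract_op" by (rule bounded_operator_retract)
  show "bounded_operator Y Z (row_defect m)" by (rule bounded_operator_row_defect)
  show "bounded_operator Z Y section_op" by (rule bounded_operator_section)
  have DE: "row_defect m (E x) = 0" if "x \<in> carr X" for x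
    using that by (simp add: E_eq row_defect_jet_matrix fun_eq_iff)
  then show "row_defect m (E x) = 0" if "x \<in> carr X" for x using that .
  show "retract_op (E x) = x" if x: "x \<in> carr X" for x
  proof -
    have "x c = 0" if "c > m" for c using x that by (auto simp: carr_Rochberg tau_def)
    then show ?thesis
      unfolding retract_op_def DE[OF x] section_op_0 using x m
      by (simp add: E_eq matrix_jet_jet_matrix)
  qed
  show "row_defect m (section_op w) = w" if w: "w \<in> carr Z" for w
  proof -
    obtain g where g: "g \<in> carr F" "w = tau (m - 1) g z" using w by (auto simp: carr_Rochberg)
    show ?thesis unfolding g(2) section_op_tau[OF F_analytic_in[OF g(1)]] row_defect_jet ..
  qed
  show "E (retract_op y) + section_op (row_defect m y) = y" if y: "y \<in> carr Y" for y
  proof -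
    obtain f where f: "y = tau_tuple 2 (jet_tuple m f) z" "\<forall>j<m. f j \<in> carr F"
      using y by (auto simp: carr_F_bracket)
    have h: "diag_fun f \<in> carr F" "diag_deriv_fun f \<in> carr F"
      using diag_fun_in_F diag_deriv_fun_in_F f(2) by blast+
    have \<eta>k: "(\<lambda>v. \<eta> v *\<^sub>C diag_deriv_fun f v) \<in> carr F" using \<eta>_multiple_in_F h(2) by blast
    have "y = jet_matrix m (\<lambda>i. taylor i (diag_fun f) z) (\<lambda>i. taylor i (diag_deriv_fun f) z)"
      using f by (simp add: tau_tuple_jet_tuple)
    note y = jet_matrix_minus_section[OF h \<eta>k this]
    have "E (retract_op y) = y - section_op (row_defect m y)"
      unfolding y(2) E_tau[OF seminormed_diff[OF F h(1) \<eta>k]] y(1) ..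
    then show ?thesis by simp
  qed
qed

end

text \<open>Since \<open>E_op\<close> is given by a description, the first conjunct certifies that
  it denotes the map intended, and the second that this map has the displayed matrix.\<close>

theorem proposition7p2:
  fixes U :: "complex set"
    and F :: "(complex \<Rightarrow> 'a :: complex_banach) nspace"
    and \<psi> :: "complex \<Rightarrow> complex"
    and m :: nat and z :: complex
  assumes "acceptable_space U F"
    and "conformal_equivalence \<psi> unit_disc U"
    and "m \<ge> 1" and "z \<in> U"
  shows "(\<forall>f\<in>carr F. E_op F m 2 z (tau (m + 1) f z) = tau_tuple 2 (\<lambda>c w. tau m f w c) z) \<and>
    (\<forall>x\<in>carr (Rochberg F (m + 1) z). E_op F m 2 z x =
       (\<lambda>r c. if r = 1 \<and> c < m then of_nat (c + 1) *\<^sub>C x (c + 1)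
              else if r = 0 \<and> c < m then x c else 0)) \<and>
    embedding (Rochberg F (m + 1) z) (F_bracket U \<psi> F m 2 z) (E_op F m 2 z) \<and>
    complemented (F_bracket U \<psi> F m 2 z) (E_op F m 2 z ` carr (Rochberg F (m + 1) z)) \<and>
    (\<exists>S. isomorphism
       (quotient_space (F_bracket U \<psi> F m 2 z) (E_op F m 2 z ` carr (Rochberg F (m + 1) z)))
       (Rochberg F (m - 1) z) S)"
proof -
  interpret acceptable_point U F \<psi> z m
    using assms by unfold_locales
  show ?thesis
  proof (intro conjI ballI)
    show "E_op F m 2 z (tau (m + 1) f z) = tau_tuple 2 (\<lambda>c w. tau m f w c) z" if "f \<in> carr F" for f
      using E_tau[OF that] tau_tuple_tau[OF U z F_analytic_in[OF that]] by simp
    show "E_op F m 2 z x = (\<lambda>r c. if r = 1 \<and> c < m then of_nat (c + 1) *\<^sub>C x (c + 1)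
        else if r = 0 \<and> c < m then x c else 0)" if "x \<in> carr (Rochberg F (m + 1) z)" for x
      using E_eq[OF that] by (simp add: jet_matrix_def fun_eq_iff)
  qed (fact split.embedding split.complemented split.quotient_isomorphism)+
qed

end
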